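(* Let $1<p\le2$. Let $\Phi:(0,\infty)\to\mathbb{C}$ be twice continuously differentiable with $$\sup_{0<t<\infty}\big(|\Phi(t)|+t|\Phi'(t)|\big)+\sup_{0<t\le 1}|t^2\Phi''(t)|<\infty,$$ suppose that there exist an integer $N$ and a constant $C_0$ such that $|\Phi'(t)|+t|\Phi''(t)|\le C_0\,t^N$ for all $t\ge1$, and let $$\phi(\lambda)=\int_0^\infty\Phi(t)(t\lambda)^2e^{-t\lambda}\,\frac{dt}{t},\qquad\lambda\ge0.$$ Then there is a constant $C$ such that for every polynomial $f$ on $\mathbb{R}^n$ with $\int_{\mathbb{R}^n}f\,d\gamma=0$, $$\|\phi(L)f\|_p\le C\big(\|Sf\|_p+\|f\|_p\big).$$
   Context: Work on $\mathbb{R}^n$ with the Gaussian measure $d\gamma(x)=\pi^{-n/2}e^{-|x|^2}\,dx$; $\|\cdot\|_p$ is the norm of $L^p(\gamma)$. The Ornstein--Uhlenbeck operator is $L=-\frac12\Delta+x\cdot\nabla$, realized as a non-negative self-adjoint operator on $L^2(\gamma)$ with spectrum $\{0,1,2,\dots\}$ and the Hermite polynomials as eigenfunctions; $\phi(L)$ is defined by the spectral theorem. The semigroup is $e^{-tL}f(x)=\int_{\mathbb{R}^n}M_t(x,y)f(y)\,d\gamma(y)$, $t>0$, with Mehler kernel $$M_t(x,y)=\frac{1}{(1-e^{-2t})^{n/2}}\exp\Big(-\frac{e^{-t}}{1-e^{-2t}}|x-y|^2\Big)\exp\Big(\frac{e^{-t}}{1+e^{-t}}(|x|^2+|y|^2)\Big).$$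 Admissibility function: $m(x)=\min(1,|x|^{-1})$. Admissible conical square function: $$Sf(x)=\Big(\int_0^{2m(x)}\frac{1}{\gamma(B(x,t))}\int_{B(x,t)}|t^2Le^{-t^2L}f(y)|^2\,d\gamma(y)\,\frac{dt}{t}\Big)^{1/2}.$$ *)

theory Defs
  imports "HOL-Analysis.Analysis" "HOL-Computational_Algebra.Polynomial"
begin

subsection \<open>Gaussian measure and norms\<close>

definition gauss :: "(real ^ 'n) measure" where
  "gauss = density lborel
     (\<lambda>x. ennreal (pi powr (- real CARD('n) / 2) * exp (- (norm x)\<^sup>2)))"

definition gauss_norm :: "real \<Rightarrow> (real ^ 'n \<Rightarrow> 'b::real_normed_vector) \<Rightarrow> real" where
  "gauss_norm p f = (LINT x|gauss. norm (f x) powr p) powr (1 / p)"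

subsection \<open>The Ornstein--Uhlenbeck operator and its semigroup\<close>

definition partial_deriv ::
    "'n \<Rightarrow> (real ^ 'n \<Rightarrow> 'b::real_normed_vector) \<Rightarrow> real ^ 'n \<Rightarrow> 'b" where
  "partial_deriv i u x = vector_derivative (\<lambda>s. u (x + s *\<^sub>R axis i 1)) (at 0)"

definition OU :: "(real ^ 'n \<Rightarrow> 'b::real_normed_vector) \<Rightarrow> real ^ 'n \<Rightarrow> 'b" where
  "OU u x = - (1 / 2) *\<^sub>R (\<Sum>i\<in>UNIV. partial_deriv i (partial_deriv i u) x)
            + (\<Sum>i\<in>UNIV. (x $ i) *\<^sub>R partial_deriv i u x)"

definition mehler_kernel :: "real \<Rightarrow> real ^ 'n \<Rightarrow> real ^ 'n \<Rightarrow> real" where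
  "mehler_kernel t x y =
     1 / (1 - exp (- 2 * t)) powr (real CARD('n) / 2)
     * exp (- (exp (- t) / (1 - exp (- 2 * t))) * (norm (x - y))\<^sup>2)
     * exp (exp (- t) / (1 + exp (- t)) * ((norm x)\<^sup>2 + (norm y)\<^sup>2))"

definition OU_semigroup :: "real \<Rightarrow> (real ^ 'n \<Rightarrow> complex) \<Rightarrow> real ^ 'n \<Rightarrow> complex" where
  "OU_semigroup t f x = (LINT y|gauss. mehler_kernel t x y *\<^sub>R f y)"

subsection \<open>Hermite polynomials and the spectral calculus\<close>

primrec hermite :: "nat \<Rightarrow> real poly" where
  "hermite 0 = 1"
| "hermite (Suc k) = [:0, 2:] * hermite k - pderiv (hermite k)"

definition multi_hermite :: "('n::finite \<Rightarrow> nat) \<Rightarrow> real ^ 'n \<Rightarrow> real" where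
  "multi_hermite \<alpha> x = (\<Prod>i\<in>UNIV. poly (hermite (\<alpha> i)) (x $ i))"

definition multi_degree :: "('n::finite \<Rightarrow> nat) \<Rightarrow> nat" where
  "multi_degree \<alpha> = (\<Sum>i\<in>UNIV. \<alpha> i)"

definition hermite_coeff :: "(real ^ 'n \<Rightarrow> complex) \<Rightarrow> ('n \<Rightarrow> nat) \<Rightarrow> complex" where
  "hermite_coeff f \<alpha> =
     (LINT x|gauss. multi_hermite \<alpha> x *\<^sub>R f x) /
     of_real (LINT x|gauss. (multi_hermite \<alpha> x)\<^sup>2)"

text \<open>
  The Hermite polynomials form a complete orthogonal system of eigenfunctions
  (\<open>OU_multi_hermite\<close> below), so the self-adjoint operator \<open>L\<close> acts on
  \<open>f = (\<Sum>\<alpha>. c\<^sub>\<alpha> H\<^sub>\<alpha>)\<close> as multiplication of \<open>c\<^sub>\<alpha>\<close> by \<open>|\<alpha>|\<close>, and the spectral theorem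
  gives \<open>\<phi>(L) f = (\<Sum>\<alpha>. \<phi>(|\<alpha>|) c\<^sub>\<alpha> H\<^sub>\<alpha>)\<close>, with unconditional convergence in \<open>L\<^sup>2(\<gamma>)\<close>.
  The function \<open>OU_calculus \<phi> f\<close> is determined up to null sets whenever \<open>f\<close> lies in the
  domain of \<open>\<phi>(L)\<close>. For polynomial \<open>f\<close> this is automatic, the expansion being finite.
\<close>

definition is_OU_calculus ::
    "(real \<Rightarrow> complex) \<Rightarrow> (real ^ 'n \<Rightarrow> complex) \<Rightarrow> (real ^ 'n \<Rightarrow> complex) \<Rightarrow> bool" where
  "is_OU_calculus \<phi> f g \<longleftrightarrow>
     g \<in> borel_measurable gauss \<and> integrable gauss (\<lambda>x. (cmod (g x))\<^sup>2) \<and>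
     ((\<lambda>F. gauss_norm 2 (\<lambda>x. g x -
         (\<Sum>\<alpha>\<in>F. \<phi> (real (multi_degree \<alpha>)) * hermite_coeff f \<alpha> * of_real (multi_hermite \<alpha> x))))
       \<longlongrightarrow> 0) (finite_subsets_at_top UNIV)"

definition OU_calculus ::
    "(real \<Rightarrow> complex) \<Rightarrow> (real ^ 'n \<Rightarrow> complex) \<Rightarrow> real ^ 'n \<Rightarrow> complex" where
  "OU_calculus \<phi> f = (SOME g. is_OU_calculus \<phi> f g)"

lemma pderiv_hermite_Suc: "pderiv (hermite (Suc k)) = smult (2 * real (Suc k)) (hermite k)"
proof (induction k)
  case 0
  show ?case by (simp add: pderiv_pCons pderiv_1)
next
  case (Suc k)
  have "pderiv (hermite (Suc (Suc k)))
      = pderiv [:0, 2:] * hermite (Suc k) + [:0, 2:] * pderiv (hermite (Suc k))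
        - pderiv (pderiv (hermite (Suc k)))"
    by (simp only: hermite.simps(2)[of "Suc k"] pderiv_diff pderiv_mult) (simp add: algebra_simps)
  also have "\<dots> = smult 2 (hermite (Suc k))
        + smult (2 * real (Suc k)) ([:0, 2:] * hermite k - pderiv (hermite k))"
    unfolding Suc.IH pderiv_smult by (simp add: pderiv_pCons smult_diff_right)
  also have "\<dots> = smult (2 * real (Suc (Suc k))) (hermite (Suc k))"
    by (simp only: hermite.simps(2)[symmetric] smult_add_left[symmetric]) simp
  finally show ?case .
qed

lemma hermite_ode:
  "poly (pderiv (pderiv (hermite k))) s =
     2 * s * poly (pderiv (hermite k)) s - 2 * real k * poly (hermite k) s"
proof (cases k)
  case 0
  then show ?thesis by (simp add: pderiv_1)
next
  case (Suc j)
  have "poly (hermite (Suc j)) s = 2 * s * poly (hermite j) s - poly (pderiv (hermite j)) s"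
    by simp
  then show ?thesis
    unfolding Suc pderiv_hermite_Suc pderiv_smult poly_smult by (simp only:) (simp add: algebra_simps)
qed

lemma partial_deriv_prod_poly:
  fixes q :: "'n::finite \<Rightarrow> real poly"
  shows "partial_deriv i (\<lambda>x. \<Prod>j\<in>UNIV. poly (q j) (x $ j))
       = (\<lambda>x. \<Prod>j\<in>UNIV. poly ((q(i := pderiv (q i))) j) (x $ j))"
proof
  fix x :: "real ^ 'n"
  have split: "(\<Prod>j\<in>UNIV. poly (r j) (y $ j))
      = poly (r i) (y $ i) * (\<Prod>j\<in>UNIV - {i}. poly (r j) (y $ j))"
    for r :: "'n \<Rightarrow> real poly" and y :: "real ^ 'n"
    by (simp add: prod.remove[of UNIV i])
  define K where "K = (\<Prod>j\<in>UNIV - {i}. poly (q j) (x $ j))"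
  have eq: "(\<Prod>j\<in>UNIV. poly (q j) ((x + s *\<^sub>R axis i 1) $ j)) = poly (q i) (x $ i + s) * K" for s
    unfolding split[of q] K_def by (auto simp: axis_def intro!: prod.cong)
  have "((\<lambda>s. poly (q i) (x $ i + s) * K) has_field_derivative poly (pderiv (q i)) (x $ i) * K) (at 0)"
    by (auto intro!: derivative_eq_intros DERIV_chain'[where g = "poly (q i)", OF _ poly_DERIV])
  then have "partial_deriv i (\<lambda>x. \<Prod>j\<in>UNIV. poly (q j) (x $ j)) x = poly (pderiv (q i)) (x $ i) * K"
    unfolding partial_deriv_def eq
    by (intro vector_derivative_at) (simp add: has_real_derivative_iff_has_vector_derivative)
  also have "\<dots> = (\<Prod>j\<in>UNIV. poly ((q(i := pderiv (q i))) j) (x $ j))"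
    unfolding split K_def by (auto intro!: prod.cong)
  finally show "partial_deriv i (\<lambda>x. \<Prod>j\<in>UNIV. poly (q j) (x $ j)) x = \<dots>" .
qed

lemma OU_multi_hermite: "OU (multi_hermite \<alpha>) x = real (multi_degree \<alpha>) * multi_hermite \<alpha> x"
proof -
  define q where "q = (\<lambda>j. hermite (\<alpha> j))"
  have H: "multi_hermite \<alpha> = (\<lambda>x. \<Prod>j\<in>UNIV. poly (q j) (x $ j))"
    by (auto simp: multi_hermite_def q_def)
  have upd: "(\<Prod>j\<in>UNIV. poly ((q(i := r)) j) (x $ j))
      = poly r (x $ i) * (\<Prod>j\<in>UNIV - {i}. poly (q j) (x $ j))" for i r
    by (simp add: prod.remove[of UNIV i])
  have one: "- (1 / 2) * partial_deriv i (partial_deriv i (multi_hermite \<alpha>)) x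
      + x $ i * partial_deriv i (multi_hermite \<alpha>) x = real (\<alpha> i) * multi_hermite \<alpha> x" for i
  proof -
    have "multi_hermite \<alpha> x = poly (q i) (x $ i) * (\<Prod>j\<in>UNIV - {i}. poly (q j) (x $ j))"
      using upd[of i "q i"] by (simp add: H)
    moreover have "partial_deriv i (multi_hermite \<alpha>) x
        = poly (pderiv (q i)) (x $ i) * (\<Prod>j\<in>UNIV - {i}. poly (q j) (x $ j))"
      unfolding H partial_deriv_prod_poly by (rule upd)
    moreover have "partial_deriv i (partial_deriv i (multi_hermite \<alpha>)) x
        = poly (pderiv (pderiv (q i))) (x $ i) * (\<Prod>j\<in>UNIV - {i}. poly (q j) (x $ j))"
      unfolding H partial_deriv_prod_poly by (simp only: fun_upd_same fun_upd_upd upd)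
    ultimately show ?thesis
      by (simp add: q_def hermite_ode algebra_simps)
  qed
  have "OU (multi_hermite \<alpha>) x = (\<Sum>i\<in>UNIV. - (1 / 2) * partial_deriv i (partial_deriv i (multi_hermite \<alpha>)) x
      + x $ i * partial_deriv i (multi_hermite \<alpha>) x)"
    by (simp only: OU_def sum.distrib sum_distrib_left real_scaleR_def)
  also have "\<dots> = real (multi_degree \<alpha>) * multi_hermite \<alpha> x"
    by (simp only: one multi_degree_def of_nat_sum sum_distrib_right)
  finally show ?thesis .
qed

subsection \<open>The admissible conical square function\<close>

text \<open>The case distinction accounts for \<open>1 / 0 = 0\<close>: here \<open>1 / |0|\<close> means \<open>\<infinity>\<close>.\<close>

definition admissible :: "real ^ 'n \<Rightarrow> real" where
  "admissible x = (if x = 0 then 1 else min 1 (1 / norm x))"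

definition conical_square :: "(real ^ 'n \<Rightarrow> complex) \<Rightarrow> real ^ 'n \<Rightarrow> real" where
  "conical_square f x = sqrt
     (LINT t:{0<..<2 * admissible x}|lborel.
        1 / measure gauss (ball x t)
        * (LINT y:ball x t|gauss. (cmod (t\<^sup>2 *\<^sub>R OU (OU_semigroup (t\<^sup>2) f) y))\<^sup>2) / t)"

subsection \<open>The multiplier\<close>

definition multiplier :: "(real \<Rightarrow> complex) \<Rightarrow> real \<Rightarrow> complex" where
  "multiplier \<Phi> s = (LINT t:{0<..}|lborel. ((t * s)\<^sup>2 * exp (- t * s) / t) *\<^sub>R \<Phi> t)"

end

theory Submission
  imports Defs "HOL-Real_Asymp.Real_Asymp"
begin

text \<open>
  Already \<open>\<parallel>\<phi>(L) f\<parallel>\<^sub>p \<le> C \<parallel>f\<parallel>\<^sub>p\<close>. Integration by parts gives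
  \<open>\<phi>(\<lambda>) = \<lambda> \<integral> (t \<Phi>(t))' e\<^sup>-\<^sup>t\<^sup>\<lambda> dt\<close> with \<open>(t \<Phi>(t))'\<close> bounded, so that \<open>\<phi>(L)\<close> is a multiplier of
  Laplace transform type, which is bounded on \<open>L\<^sup>p(\<gamma>)\<close> (Stein). For the latter, pair \<open>\<phi>(L) f\<close>
  with a polynomial \<open>h\<close>: it suffices to bound
  \<open>\<integral>\<^sub>0\<^sup>\<infinity> |\<langle>L e\<^sup>-\<^sup>t\<^sup>L f, h\<rangle>| dt\<close>. There is a smooth \<open>Q\<close> on the plane with
  \<open>0 \<le> Q(z, e) \<le> C (1 + |z|\<^sup>p + |e|\<^sup>q)\<close> whose Hessian form dominates \<open>\<kappa> |r| |s|\<close>, for some \<open>\<kappa> > 0\<close>. Along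
  \<open>U = e\<^sup>-\<^sup>t\<^sup>L\<^sup>/\<^sup>2 f\<close> and \<open>V = e\<^sup>-\<^sup>t\<^sup>L\<^sup>/\<^sup>2 h\<close> the functional \<open>\<integral> Q(U, V) d\<gamma>\<close> therefore decreases
  at least at the rate \<open>(\<kappa> / 4) \<integral> \<Sum>\<^sub>i |\<partial>\<^sub>i U| |\<partial>\<^sub>i V| d\<gamma>\<close>, which controls \<open>|\<langle>L e\<^sup>-\<^sup>t\<^sup>L f, h\<rangle>|\<close>. The additive
  constant disappears by homogeneity, and polynomials are dense enough to take
  \<open>h = sgn(g) |g|\<^sup>p\<^sup>-\<^sup>1\<close> for \<open>g = \<phi>(L) f\<close>.
\<close>

subsection \<open>Functions of exponential growth\<close>

text \<open>The Hessian of \<open>Q\<close> is compared with \<open>|r| |s|\<close> and not with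
  \<open>r^2 + s^2\<close> because the lower bounds for its diagonal entries are opposite powers of
  \<open>1 + z^2\<close>; only their product is free of weights. Smoothness has a price: powers are
  taken only of quantities that are at least 1, so integrating \<open>Q\<close> brings in a
  constant. Scaling \<open>f\<close> by \<open>N\<close> and \<open>h\<close> by
  \<open>N^(p - 1)\<close> multiplies every other term by \<open>N^p\<close>, and the constant is
  lost as \<open>N\<close> grows. \<open>U\<close> and \<open>V\<close> each run at half speed, so
  that the product of their exponentials restores that of \<open>e^(- t L)\<close>; being finite
  Hermite sums, they are differentiated termwise. \<open>Q\<close> takes real arguments, hence the
  multiplier and \<open>f\<close> are split into real and imaginary parts. The extremal
  \<open>h\<close> is not a polynomial, and polynomials approximating it need a common majorant on
  the whole space. Growth \<open>C exp (C |x|)\<close> is the class for all of this: it contains the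
  polynomials, is closed under products and under the powers in \<open>Q\<close>, and is integrable
  against the Gaussian weight. A single constant as factor and as rate keeps the closure rules
  simple.\<close>

definition exp_bounded :: "('a::real_normed_vector \<Rightarrow> real) \<Rightarrow> bool" where
  "exp_bounded g \<longleftrightarrow> continuous_on UNIV g \<and> (\<exists>C. \<forall>x. \<bar>g x\<bar> \<le> C * exp (C * norm x))"

lemma exp_boundedI:
  assumes "continuous_on UNIV g" and "\<And>x. \<bar>g x\<bar> \<le> A * exp (B * norm x)"
  shows "exp_bounded g"
  unfolding exp_bounded_def
proof (intro conjI exI allI)
  fix x
  have "\<bar>g x\<bar> \<le> A * exp (B * norm x)" by fact
  also have "\<dots> \<le> (\<bar>A\<bar> + \<bar>B\<bar>) * exp ((\<bar>A\<bar> + \<bar>B\<bar>) * norm x)"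
    by (intro mult_mono) (auto intro: mult_right_mono)
  finally show "\<bar>g x\<bar> \<le> (\<bar>A\<bar> + \<bar>B\<bar>) * exp ((\<bar>A\<bar> + \<bar>B\<bar>) * norm x)" .
qed fact

lemma exp_boundedE:
  fixes g :: "'a::real_normed_vector \<Rightarrow> real"
  assumes "exp_bounded g"
  obtains C where "C \<ge> 0" "\<And>x. \<bar>g x\<bar> \<le> C * exp (C * norm x)"
proof -
  obtain C where C: "\<And>x. \<bar>g x\<bar> \<le> C * exp (C * norm x)"
    using assms by (auto simp: exp_bounded_def)
  from order_trans[OF abs_ge_zero C[of 0]] have "C \<ge> 0" by simp
  then show ?thesis using C by (rule that)
qed

lemma exp_bounded_continuous: "exp_bounded g \<Longrightarrow> continuous_on S g"
  by (auto simp: exp_bounded_def intro: continuous_on_subset)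

lemma exp_bounded_dominated:
  assumes "continuous_on UNIV f" "exp_bounded g" "\<And>x. \<bar>f x\<bar> \<le> \<bar>g x\<bar>"
  shows "exp_bounded f"
proof -
  obtain C where "\<And>x. \<bar>g x\<bar> \<le> C * exp (C * norm x)" using exp_boundedE[OF assms(2)] by blast
  with assms(3) have "\<And>x. \<bar>f x\<bar> \<le> C * exp (C * norm x)" using order_trans by blast
  with assms(1) show ?thesis by (rule exp_boundedI)
qed

named_theorems exp_bounded_intros

lemma exp_bounded_const [exp_bounded_intros]: "exp_bounded (\<lambda>x. c)"
  by (rule exp_boundedI[of _ "\<bar>c\<bar>" 0]) auto

lemma exp_bounded_bounded_linear:
  assumes "bounded_linear g" shows "exp_bounded g"
proof -
  obtain K where K: "\<And>x. norm (g x) \<le> norm x * K" "K > 0"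
    using bounded_linear.pos_bounded[OF assms] by auto
  show ?thesis
  proof (rule exp_boundedI[of _ K 1])
    fix x
    have "\<bar>g x\<bar> \<le> K * norm x" using K(1)[of x] by (simp add: mult.commute)
    also have "norm x \<le> exp (1 * norm x)" using exp_ge_add_one_self[of "norm x"] unfolding mult_1 by linarith
    finally show "\<bar>g x\<bar> \<le> K * exp (1 * norm x)" using K(2) by simp
  qed (simp add: assms linear_continuous_on)
qed

lemma exp_bounded_nth [exp_bounded_intros]: "exp_bounded (\<lambda>x::real^'n. x $ i)"
  by (rule exp_bounded_bounded_linear) (rule bounded_linear_vec_nth)

lemma exp_bounded_add [exp_bounded_intros]:
  fixes f g :: "'a::real_normed_vector \<Rightarrow> real"
  assumes "exp_bounded f" "exp_bounded g" shows "exp_bounded (\<lambda>x. f x + g x)"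
proof -
  obtain A where A: "A \<ge> 0" "\<And>x. \<bar>f x\<bar> \<le> A * exp (A * norm x)"
    using exp_boundedE[OF assms(1)] by blast
  obtain B where B: "B \<ge> 0" "\<And>x. \<bar>g x\<bar> \<le> B * exp (B * norm x)"
    using exp_boundedE[OF assms(2)] by blast
  show ?thesis
  proof (rule exp_boundedI[of _ "A + B" "A + B"])
    fix x :: 'a
    have "A * exp (A * norm x) \<le> A * exp ((A + B) * norm x)"
      "B * exp (B * norm x) \<le> B * exp ((A + B) * norm x)"
      using A B by (auto intro!: mult_left_mono simp: distrib_right)
    with A(2)[of x] B(2)[of x] show "\<bar>f x + g x\<bar> \<le> (A + B) * exp ((A + B) * norm x)"
      by (simp add: distrib_right)
  qed (intro continuous_intros exp_bounded_continuous assms)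
qed

lemma exp_bounded_mult [exp_bounded_intros]:
  fixes f g :: "'a::real_normed_vector \<Rightarrow> real"
  assumes "exp_bounded f" "exp_bounded g" shows "exp_bounded (\<lambda>x. f x * g x)"
proof -
  obtain A where A: "A \<ge> 0" "\<And>x. \<bar>f x\<bar> \<le> A * exp (A * norm x)"
    using exp_boundedE[OF assms(1)] by blast
  obtain B where B: "B \<ge> 0" "\<And>x. \<bar>g x\<bar> \<le> B * exp (B * norm x)"
    using exp_boundedE[OF assms(2)] by blast
  show ?thesis
  proof (rule exp_boundedI[of _ "A * B" "A + B"])
    fix x
    have "\<bar>f x * g x\<bar> \<le> (A * exp (A * norm x)) * (B * exp (B * norm x))"
      unfolding abs_mult using A B by (intro mult_mono) auto
    also have "\<dots> = A * B * exp ((A + B) * norm x)"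
      by (simp add: distrib_right exp_add)
    finally show "\<bar>f x * g x\<bar> \<le> A * B * exp ((A + B) * norm x)" .
  qed (intro continuous_intros exp_bounded_continuous assms)
qed

lemma exp_bounded_uminus [exp_bounded_intros]:
  "exp_bounded f \<Longrightarrow> exp_bounded (\<lambda>x. - f x)"
  using exp_bounded_mult[OF exp_bounded_const[of "-1"], of f] by simp

lemma exp_bounded_diff [exp_bounded_intros]:
  "exp_bounded f \<Longrightarrow> exp_bounded g \<Longrightarrow> exp_bounded (\<lambda>x. f x - g x)"
  using exp_bounded_add[OF _ exp_bounded_uminus, of f g] by simp

lemma exp_bounded_abs [exp_bounded_intros]: "exp_bounded f \<Longrightarrow> exp_bounded (\<lambda>x. \<bar>f x\<bar>)"
  by (rule exp_bounded_dominated[of _ f]) (simp_all add: exp_bounded_continuous continuous_on_rabs)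

lemma exp_bounded_divide_const [exp_bounded_intros]:
  "exp_bounded f \<Longrightarrow> exp_bounded (\<lambda>x. f x / c)"
  using exp_bounded_mult[OF _ exp_bounded_const[of "inverse c"], of f] by (simp add: field_simps)

lemma exp_bounded_power [exp_bounded_intros]:
  "exp_bounded f \<Longrightarrow> exp_bounded (\<lambda>x. f x ^ k)"
  by (induction k) (auto intro!: exp_bounded_intros)

lemma exp_bounded_sum [exp_bounded_intros]:
  "(\<And>i. i \<in> I \<Longrightarrow> exp_bounded (f i)) \<Longrightarrow> exp_bounded (\<lambda>x. \<Sum>i\<in>I. f i x)"
  by (induction I rule: infinite_finite_induct) (auto intro!: exp_bounded_intros)

lemma exp_bounded_prod [exp_bounded_intros]:
  "(\<And>i. i \<in> I \<Longrightarrow> exp_bounded (f i)) \<Longrightarrow> exp_bounded (\<lambda>x. \<Prod>i\<in>I. f i x)"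
  by (induction I rule: infinite_finite_induct) (auto intro!: exp_bounded_intros)

lemma exp_bounded_poly [exp_bounded_intros]:
  "exp_bounded f \<Longrightarrow> exp_bounded (\<lambda>x. poly q (f x))"
  by (induction q) (auto intro!: exp_bounded_intros)

lemma exp_bounded_powr_pos:
  assumes "exp_bounded f" "\<And>x. 0 \<le> f x" "0 < r"
  shows "exp_bounded (\<lambda>x. f x powr r)"
proof -
  obtain A where A: "A \<ge> 0" "\<And>x. \<bar>f x\<bar> \<le> A * exp (A * norm x)"
    using exp_boundedE[OF assms(1)] by blast
  show ?thesis
  proof (rule exp_boundedI[of _ "A powr r" "r * A"])
    show "continuous_on UNIV (\<lambda>x. f x powr r)"
      using assms by (intro continuous_on_powr' continuous_intros exp_bounded_continuous) auto
    fix x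
    have "f x powr r \<le> (A * exp (A * norm x)) powr r"
      using A(2)[of x] assms(2)[of x] assms(3) by (intro powr_mono2) auto
    also have "\<dots> = A powr r * exp (r * A * norm x)"
      using A(1) by (simp add: powr_mult exp_powr_real mult_ac)
    finally show "\<bar>f x powr r\<bar> \<le> A powr r * exp (r * A * norm x)" by simp
  qed
qed

text \<open>With a base of at least 1 nothing is singular: a nonpositive exponent gives a function
  bounded by 1. All powers in the Bellman function are of this kind.\<close>

lemma exp_bounded_powr:
  assumes "exp_bounded f" "\<And>x. 1 \<le> f x"
  shows "exp_bounded (\<lambda>x. f x powr r)"
proof (cases "r > 0")
  case True
  then show ?thesis using assms order_trans[OF zero_le_one] by (intro exp_bounded_powr_pos) auto
next
  case False
  show ?thesis
  proof (rule exp_bounded_dominated[of _ "\<lambda>x. 1"])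
    show "continuous_on UNIV (\<lambda>x. f x powr r)"
      by (intro continuous_on_powr continuous_intros exp_bounded_continuous assms(1))
        (metis assms(2) not_one_le_zero)
    show "\<bar>f x powr r\<bar> \<le> \<bar>1\<bar>" for x
      using powr_mono[of r 0 "f x"] assms(2)[of x] False by simp
  qed (rule exp_bounded_const)
qed

lemma exp_bounded_compose_snd:
  fixes f :: "'a::real_normed_vector \<Rightarrow> real"
  assumes "exp_bounded f" shows "exp_bounded (\<lambda>z :: 'b::real_normed_vector \<times> 'a. f (snd z))"
proof -
  obtain A where A: "A \<ge> 0" "\<And>x. \<bar>f x\<bar> \<le> A * exp (A * norm x)"
    using exp_boundedE[OF assms] by blast
  show ?thesis
  proof (rule exp_boundedI[of _ A A])
    show "continuous_on UNIV (\<lambda>z. f (snd z))"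
      by (rule continuous_on_compose2[OF exp_bounded_continuous[OF assms, of UNIV]])
        (auto intro: continuous_intros)
    fix z :: "'b \<times> 'a"
    have "norm (snd z) \<le> norm z" by (cases z) (simp add: norm_snd_le)
    then have "A * exp (A * norm (snd z)) \<le> A * exp (A * norm z)"
      using A(1) by (auto intro!: mult_left_mono)
    with A(2)[of "snd z"] show "\<bar>f (snd z)\<bar> \<le> A * exp (A * norm z)" by linarith
  qed
qed

lemma exp_bounded_exp_fst: "exp_bounded (\<lambda>z :: real \<times> 'a::real_normed_vector. exp (c * fst z))"
proof (rule exp_boundedI[of _ 1 "\<bar>c\<bar>"])
  fix z :: "real \<times> 'a"
  have "c * fst z \<le> \<bar>c\<bar> * norm (fst z)"
    by (metis abs_ge_self abs_mult real_norm_def)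
  also have "\<dots> \<le> \<bar>c\<bar> * norm z"
    using norm_fst_le[of "fst z" "snd z"] by (intro mult_left_mono) (simp_all del: norm_fst_le)
  finally show "\<bar>exp (c * fst z)\<bar> \<le> 1 * exp (\<bar>c\<bar> * norm z)" by simp
qed (intro continuous_intros)

text \<open>On a bounded time interval the growth in time goes into the constant. The majorant left
  over depends on \<open>x\<close> alone, which is what Fubini between time and the Gaussian measure
  asks for.\<close>

lemma exp_bounded_slice_uniform:
  fixes f :: "real \<times> 'a::real_normed_vector \<Rightarrow> real"
  assumes "exp_bounded f"
  obtains A where "A \<ge> 0" "\<And>t (x::'a). \<bar>t\<bar> \<le> T \<Longrightarrow> \<bar>f (t, x)\<bar> \<le> A * exp (A * norm x)"
proof -
  obtain A where A: "A \<ge> 0" "\<And>x. \<bar>f x\<bar> \<le> A * exp (A * norm x)"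
    using exp_boundedE[OF assms] by blast
  define B where "B = A + A * exp (A * \<bar>T\<bar>)"
  show ?thesis
  proof (rule that[of B])
    show "B \<ge> 0" using A(1) by (simp add: B_def)
    fix t and x :: 'a assume t: "\<bar>t\<bar> \<le> T"
    have "norm (t, x) \<le> norm t + norm x" by (rule norm_Pair_le)
    then have "norm (t, x) \<le> \<bar>T\<bar> + norm x" using t by simp
    then have "A * norm (t, x) \<le> A * \<bar>T\<bar> + A * norm x"
      using mult_left_mono[OF _ A(1)] by (simp add: distrib_left[symmetric])
    then have "A * exp (A * norm (t, x)) \<le> A * exp (A * \<bar>T\<bar>) * exp (A * norm x)"
      using A(1) by (auto simp: exp_add[symmetric] mult.assoc intro!: mult_left_mono)
    also have "\<dots> \<le> B * exp (B * norm x)"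
      using A(1) by (intro mult_mono) (auto simp: B_def intro!: mult_right_mono)
    finally show "\<bar>f (t, x)\<bar> \<le> B * exp (B * norm x)" using A(2)[of "(t,x)"] by linarith
  qed
qed

lemma exp_bounded_slice:
  fixes f :: "real \<times> 'a::real_normed_vector \<Rightarrow> real"
  assumes "exp_bounded f" shows "exp_bounded (\<lambda>x. f (t, x))"
proof -
  obtain A where A: "\<And>s (x::'a). \<bar>s\<bar> \<le> \<bar>t\<bar> \<Longrightarrow> \<bar>f (s, x)\<bar> \<le> A * exp (A * norm x)"
    using exp_bounded_slice_uniform[OF assms, of "\<bar>t\<bar>"] by metis
  have "continuous_on UNIV (\<lambda>x. f (t, x))"
    by (rule continuous_on_compose2[OF exp_bounded_continuous[OF assms, of UNIV]])
      (auto intro: continuous_intros)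
  then show ?thesis using A[of t] by (rule exp_boundedI) simp
qed

subsection \<open>Integration by parts for the Gaussian measure\<close>

text \<open>Where \<open>norm x\<close> has integer part \<open>k\<close>, the point lies in the
  ball of radius \<open>k + 1\<close> and the integrand is at most \<open>exp (- k)\<close>; the
  volumes grow only polynomially in \<open>k\<close>. In dimension one this also yields the
  integrability of decaying exponentials in time.\<close>

lemma integrable_exp_minus_norm:
  "integrable lborel (\<lambda>x::'a::euclidean_space. exp (- norm x))"
proof (rule integrableI_bounded)
  have le_suminf: "h k \<le> (\<Sum>k. h k)" for h :: "nat \<Rightarrow> ennreal" and k
    using sum_le_suminf[OF summableI, of "{k}" h] by simp
  let ?V = "unit_ball_vol (DIM('a))" and ?d = "DIM('a)"
  have sum: "summable (\<lambda>k. exp (- real k) * (?V * (real k + 1) ^ ?d))"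
  proof (rule summable_comparison_test_ev)
    have "eventually (\<lambda>k. (real k + 1) ^ ?d \<le> exp (real k / 2)) sequentially"
      by real_asymp
    then show "eventually (\<lambda>k. norm (exp (- real k) * (?V * (real k + 1) ^ ?d)) \<le> ?V * exp (- (1/2)) ^ k) sequentially"
    proof eventually_elim
      case (elim k)
      have "exp (- real k) * (?V * (real k + 1) ^ ?d) \<le> exp (- real k) * (?V * exp (real k / 2))"
        using elim by (intro mult_left_mono) auto
      also have "\<dots> = ?V * exp (- (1/2)) ^ k"
        by (simp add: exp_of_nat_mult[symmetric] exp_add[symmetric] mult_ac)
      finally show ?case by simp
    qed
    show "summable (\<lambda>k. ?V * exp (- (1/2)::real) ^ k)"
      by (intro summable_mult summable_geometric) auto
  qed
  have "(\<integral>\<^sup>+x. ennreal (norm (exp (- norm (x::'a)))) \<partial>lborel)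
     \<le> (\<integral>\<^sup>+x. (\<Sum>k. ennreal (exp (- real k)) * indicator (cball 0 (real k + 1)) (x::'a)) \<partial>lborel)"
  proof (intro nn_integral_mono)
    fix x :: 'a
    define k where "k = nat \<lfloor>norm x\<rfloor>"
    have "real k = of_int \<lfloor>norm x\<rfloor>" by (simp add: k_def)
    then have k: "real k \<le> norm x" "norm x \<le> real k + 1" by linarith+
    have "ennreal (norm (exp (- norm x))) \<le> ennreal (exp (- real k)) * indicator (cball 0 (real k + 1)) x"
      using k by (auto simp: indicator_def intro!: ennreal_leI)
    also have "\<dots> \<le> (\<Sum>k. ennreal (exp (- real k)) * indicator (cball 0 (real k + 1)) x)"
      by (rule le_suminf)
    finally show "ennreal (norm (exp (- norm x))) \<le> \<dots>" .
  qed
  also have "\<dots> = (\<Sum>k. ennreal (exp (- real k)) * emeasure lborel (cball (0::'a) (real k + 1)))"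
    by (subst nn_integral_suminf)
      (auto simp: nn_integral_cmult_indicator intro!: borel_measurable_times_ennreal borel_measurable_indicator)
  also have "\<dots> = (\<Sum>k. ennreal (exp (- real k) * (?V * (real k + 1) ^ ?d)))"
    by (simp add: emeasure_cball ennreal_mult')
  also have "\<dots> < \<infinity>"
    using sum by (subst suminf_ennreal2) auto
  finally show "(\<integral>\<^sup>+x. ennreal (norm (exp (- norm (x::'a)))) \<partial>lborel) < \<infinity>" .
qed simp


lemma borel_measurable_exp_bounded:
  fixes g :: "'a::euclidean_space \<Rightarrow> real"
  shows "exp_bounded g \<Longrightarrow> g \<in> borel_measurable borel"
  by (intro borel_measurable_continuous_onI exp_bounded_continuous)

lemma sets_gauss [measurable_cong, simp]: "sets gauss = sets borel"
  by (simp add: gauss_def)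

lemma space_gauss [simp]: "space gauss = UNIV"
  by (simp add: gauss_def)

lemma integral_gauss:
  fixes g :: "real^'n \<Rightarrow> real"
  assumes [measurable]: "g \<in> borel_measurable borel"
  shows "(LINT x|gauss. g x)
    = pi powr (- real CARD('n) / 2) * (LINT x|lborel. exp (- (norm x)\<^sup>2) * g x)"
  unfolding gauss_def by (subst integral_density) (auto simp: mult.assoc)

lemma integrable_lborel_exp_bounded:
  fixes g :: "'a::euclidean_space \<Rightarrow> real"
  assumes "exp_bounded g"
  shows "integrable lborel (\<lambda>x. exp (- (norm x)\<^sup>2) * g x)"
proof -
  have [measurable]: "g \<in> borel_measurable borel"
    using assms by (rule borel_measurable_exp_bounded)
  obtain C where C: "C \<ge> 0" "\<And>x. \<bar>g x\<bar> \<le> C * exp (C * norm x)"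
    using exp_boundedE[OF assms] by blast
  show ?thesis
  proof (rule Bochner_Integration.integrable_bound)
    show "integrable lborel (\<lambda>x::'a. C * exp ((C + 1)\<^sup>2 / 4) * exp (- norm x))"
      by (intro integrable_mult_right integrable_exp_minus_norm)
    show "AE x in lborel. norm (exp (- (norm x)\<^sup>2) * g x) \<le> norm (C * exp ((C + 1)\<^sup>2 / 4) * exp (- norm x))"
    proof (intro always_eventually allI)
      fix x :: 'a
      \<comment> \<open>Completing the square trades the Gaussian for \<open>exp (- norm x)\<close>
        and moves the growth rate \<open>C\<close> into a constant.\<close>
      have "0 \<le> (norm x - (C + 1) / 2)\<^sup>2" by simp
      then have sq: "- (norm x)\<^sup>2 + C * norm x \<le> (C + 1)\<^sup>2 / 4 - norm x"
        by (simp add: power2_eq_square algebra_simps add_divide_distrib)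
      have "norm (exp (- (norm x)\<^sup>2) * g x) \<le> exp (- (norm x)\<^sup>2) * (C * exp (C * norm x))"
        using C(2)[of x] by (simp add: abs_mult)
      also have "\<dots> = C * exp (- (norm x)\<^sup>2 + C * norm x)" by (simp add: exp_add[symmetric])
      also have "\<dots> \<le> C * exp ((C + 1)\<^sup>2 / 4 - norm x)"
        using sq C(1) by (intro mult_left_mono) auto
      also have "\<dots> = C * exp ((C + 1)\<^sup>2 / 4) * exp (- norm x)"
        by (simp only: diff_conv_add_uminus exp_add mult.assoc)
      finally show "norm (exp (- (norm x)\<^sup>2) * g x) \<le> norm (C * exp ((C + 1)\<^sup>2 / 4) * exp (- norm x))"
        using C(1) by simp
    qed
  qed measurable
qed

lemma integrable_gauss_exp_bounded:
  fixes g :: "real^'n \<Rightarrow> real"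
  assumes "exp_bounded g" shows "integrable gauss g"
proof -
  have [measurable]: "g \<in> borel_measurable borel"
    using assms by (rule borel_measurable_exp_bounded)
  show ?thesis
    unfolding gauss_def
    using integrable_mult_right[OF integrable_lborel_exp_bounded[OF assms], of "pi powr (- real CARD('n) / 2)"]
    by (subst integrable_density) (auto simp: mult.assoc)
qed

lemma finite_measure_gauss: "finite_measure (gauss :: (real^'n) measure)"
  using integrable_gauss_exp_bounded[OF exp_bounded_const[of 1]]
  by (intro finite_measureI) (simp add: integrable_iff_bounded less_top)

interpretation gauss: finite_measure "gauss :: (real^'n) measure"
  by (rule finite_measure_gauss)

text \<open>The density is positive everywhere, so zero mass would make Lebesgue measure trivial.
  This anchors the positivity of the Hermite norms.\<close>

lemma gauss_pos: "measure (gauss :: (real^'n) measure) UNIV > 0"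
proof (rule ccontr)
  assume "\<not> ?thesis"
  then have "measure (gauss :: (real^'n) measure) UNIV = 0"
    by (simp add: zero_less_measure_iff)
  then have "emeasure (gauss :: (real^'n) measure) UNIV = 0"
    by (simp add: gauss.emeasure_eq_measure)
  then have "(\<integral>\<^sup>+x. ennreal (pi powr (- real CARD('n) / 2) * exp (- (norm (x::real^'n))\<^sup>2)) \<partial>lborel) = 0"
    unfolding gauss_def by (subst (asm) emeasure_density) (auto simp: mult.commute)
  then have "AE x::real^'n in lborel. False"
    by (subst (asm) nn_integral_0_iff_AE) (auto simp: ennreal_eq_0_iff not_le)
  then show False
    by (simp add: eventually_False trivial_limit_def[symmetric] ae_filter_eq_bot_iff)
qed

lemma lborel_integral_translate:
  fixes g :: "'a::euclidean_space \<Rightarrow> real"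
  assumes [measurable]: "g \<in> borel_measurable borel"
  shows "(LINT x|lborel. g (x + a)) = (LINT x|lborel. g x)"
proof -
  have "(LINT x|lborel. g x) = (LINT x|distr lborel borel ((+) a). g x)"
    by (simp add: lborel_distr_plus)
  also have "\<dots> = (LINT x|lborel. g (a + x))"
    by (subst integral_distr) auto
  finally show ?thesis by (simp add: add.commute)
qed

lemma lborel_integrable_translate:
  fixes g :: "'a::euclidean_space \<Rightarrow> real"
  assumes "integrable lborel g"
  shows "integrable lborel (\<lambda>x. g (x + a))"
proof -
  have [measurable]: "g \<in> borel_measurable borel" using assms by auto
  have "integrable (distr lborel borel ((+) a)) g"
    using assms by (simp add: lborel_distr_plus)
  then show ?thesis by (subst (asm) integrable_distr_eq) (auto simp: add.commute)
qed

text \<open>An argument without boundary terms at infinity: \<open>F (x + e) - F x\<close> is the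
  integral of \<open>F'\<close> over a segment. Integrating in \<open>x\<close> and exchanging the
  integrals, translation invariance turns one side into 0 and the other into the integral of
  \<open>F'\<close>.\<close>

lemma integral_directional_derivative_eq_0:
  fixes F F' :: "'a::euclidean_space \<Rightarrow> real"
  assumes cont: "continuous_on UNIV F'" and int: "integrable lborel F" "integrable lborel F'"
    and deriv: "\<And>x. ((\<lambda>s. F (x + s *\<^sub>R e)) has_real_derivative F' x) (at 0)"
  shows "(LINT x|lborel. F' x) = 0"
proof -
  have [measurable]: "F \<in> borel_measurable borel" "F' \<in> borel_measurable borel"
    using int by auto
  \<comment> \<open>The hypothesis speaks of the parameter 0 only; moving the base point gives the
    derivative along the whole line.\<close>
  have deriv': "((\<lambda>s. F (x + s *\<^sub>R e)) has_real_derivative F' (x + r *\<^sub>R e)) (at r)" for x r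
  proof -
    have "((\<lambda>s. F ((x + r *\<^sub>R e) + (s - r) *\<^sub>R e)) has_real_derivative F' (x + r *\<^sub>R e)) (at r)"
      using deriv[of "x + r *\<^sub>R e"] DERIV_shift[of "\<lambda>s. F ((x + r *\<^sub>R e) + s *\<^sub>R e)" "F' (x + r *\<^sub>R e)" r "-r"]
      by simp
    then show ?thesis by (simp add: algebra_simps)
  qed
  let ?f = "\<lambda>r x. indicator {0..1::real} r * F' (x + r *\<^sub>R e)"
  have FTC: "(LINT r|lborel. ?f r x) = F (x + e) - F x" for x
  proof -
    have "(LINT r|lborel. indicator {0..1} r *\<^sub>R F' (x + r *\<^sub>R e)) = F (x + 1 *\<^sub>R e) - F (x + 0 *\<^sub>R e)"
    proof (rule integral_FTC_atLeastAtMost)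
      show "((\<lambda>s. F (x + s *\<^sub>R e)) has_vector_derivative F' (x + r *\<^sub>R e)) (at r within {0..1})" for r
        using deriv'[of x r] by (auto simp: has_real_derivative_iff_has_vector_derivative intro: has_vector_derivative_at_within)
      show "continuous_on {0..1} (\<lambda>r. F' (x + r *\<^sub>R e))"
        by (intro continuous_on_compose2[OF cont] continuous_intros) auto
    qed simp
    then show ?thesis by simp
  qed
  have meas: "(\<lambda>z. ?f (fst z) (snd z)) \<in> borel_measurable (lborel \<Otimes>\<^sub>M lborel)"
    by measurable
  have "integrable (lborel \<Otimes>\<^sub>M lborel) (case_prod ?f)"
  proof (rule lborel_pair.Fubini_integrable)
    show "case_prod ?f \<in> borel_measurable (lborel \<Otimes>\<^sub>M lborel)"
      using meas by (simp add: case_prod_beta)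
    have "(LINT x|lborel. norm (?f r x)) = indicator {0..1} r * (LINT x|lborel. \<bar>F' x\<bar>)" for r
      using lborel_integral_translate[of "\<lambda>x. \<bar>F' x\<bar>" "r *\<^sub>R e"] by (simp add: abs_mult)
    then show "integrable lborel (\<lambda>r. LINT x|lborel. norm (case_prod ?f (r, x)))"
      by simp
    show "AE r in lborel. integrable lborel (\<lambda>x. case_prod ?f (r, x))"
      using int(2) by (auto intro!: lborel_integrable_translate)
  qed
  from lborel_pair.Fubini_integral[OF this]
  have "(LINT x|lborel. F (x + e) - F x) = (LINT r|lborel. LINT x|lborel. ?f r x)"
    by (simp add: FTC)
  also have "(LINT x|lborel. F (x + e) - F x) = 0"
    using int(1) by (subst Bochner_Integration.integral_diff)
      (auto intro: lborel_integrable_translate simp: lborel_integral_translate)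
  also have "(LINT r|lborel. LINT x|lborel. ?f r x) = (LINT r|lborel. indicator {0..1::real} r * (LINT x|lborel. F' x))"
    by (simp add: lborel_integral_translate)
  also have "\<dots> = (LINT x|lborel. F' x)" by simp
  finally show ?thesis by simp
qed

text \<open>The product of \<open>G\<close> with \<open>exp (- (norm x)^2)\<close> has a derivative
  of integral 0. In other words, the Gaussian adjoint of the \<open>i\<close>-th derivative is
  \<open>2 x_i\<close> minus that derivative.\<close>

lemma gauss_integral_by_parts:
  fixes G G' :: "real^'n \<Rightarrow> real"
  assumes "exp_bounded G" "exp_bounded G'"
    and deriv: "\<And>x. ((\<lambda>s. G (x + s *\<^sub>R axis i 1)) has_real_derivative G' x) (at 0)"
  shows "(LINT x|gauss. G' x) = (LINT x|gauss. 2 * x $ i * G x)"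
proof -
  let ?F = "\<lambda>x. exp (- (norm x)\<^sup>2) * G x"
  let ?F' = "\<lambda>x. exp (- (norm x)\<^sup>2) * (G' x - 2 * x $ i * G x)"
  have eb: "exp_bounded (\<lambda>x. 2 * x $ i * G x)"
    by (intro exp_bounded_intros assms)
  have "(LINT x|lborel. ?F' x) = 0"
  proof (rule integral_directional_derivative_eq_0)
    show "continuous_on UNIV ?F'"
      using assms eb by (intro continuous_intros exp_bounded_continuous)
    show "integrable lborel ?F" "integrable lborel ?F'"
      by (intro integrable_lborel_exp_bounded exp_bounded_diff eb assms)+
    fix x :: "real^'n"
    have n: "(norm (x + s *\<^sub>R axis i 1))\<^sup>2 = (norm x)\<^sup>2 + 2 * s * x $ i + s\<^sup>2" for s
      by (simp only: power2_norm_eq_inner inner_add_left inner_add_right)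
        (simp add: inner_axis inner_axis' power2_eq_square algebra_simps)
    show "((\<lambda>s. ?F (x + s *\<^sub>R axis i 1)) has_real_derivative ?F' x) (at 0)"
      unfolding n by (auto intro!: derivative_eq_intros deriv simp: algebra_simps)
  qed
  then have "(LINT x|gauss. G' x - 2 * x $ i * G x) = 0"
    by (subst integral_gauss) (auto intro!: borel_measurable_exp_bounded exp_bounded_diff eb assms)
  then show ?thesis
    using integrable_gauss_exp_bounded[OF eb] integrable_gauss_exp_bounded[OF assms(2)] by simp
qed

subsection \<open>The Bellman function\<close>

locale bellman =
  fixes p :: real
  assumes p_gt_1: "1 < p" and p_le_2: "p \<le> 2"
begin

definition q :: real where "q = p / (p - 1)"
text \<open>Half of the exponent \<open>2 - p\<close> of \<open>|z|\<close>, since \<open>W\<close>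
  has the size of a square of \<open>z\<close>.\<close>

definition a :: real where "a = (2 - p) / 2"
text \<open>As \<open>q = \<beta> p\<close>, the region \<open>|e|^q \<le> |z|^p\<close> is the
  region \<open>|e|^\<beta> \<le> |z|\<close>. Up to constants, the two summands of \<open>W\<close>
  exchange dominance at its boundary.\<close>

definition \<beta> :: real where "\<beta> = 1 / (p - 1)"
text \<open>With \<open>\<kappa> = p (p - 1)\<close>, the diagonal Hessian entries are at least
  \<open>\<kappa> / 2\<close> and \<open>2 \<delta>\<close> times reciprocal weights, a gain of
  \<open>2 sqrt (\<kappa> \<delta>)\<close> on \<open>|r s|\<close>. The mixed term costs at most
  \<open>4 \<delta> q\<close>. This value makes the cost exactly half of the gain.\<close>

definition \<delta> :: real where "\<delta> = p * (p - 1) / (16 * q\<^sup>2)"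

definition X :: "real \<Rightarrow> real" where "X z = 1 + z\<^sup>2"
definition W :: "real \<Rightarrow> real \<Rightarrow> real" where "W z e = X z + X e powr \<beta>"

text \<open>
  The term \<open>X e * W z e powr a\<close> is a smooth version of \<open>e\<^sup>2 |z|\<^sup>2\<^sup>-\<^sup>p\<close>, which
  Nazarov and Treil use in the region \<open>|e|\<^sup>q \<le> |z|\<^sup>p\<close>; through \<open>W\<close> it behaves like
  \<open>|e|\<^sup>q\<close> in the other region. All bases are at least 1, so no power is singular.
\<close>

definition Q :: "real \<Rightarrow> real \<Rightarrow> real" where
  "Q z e = X z powr (p / 2) + \<delta> * (X e * W z e powr a)"
definition Qz :: "real \<Rightarrow> real \<Rightarrow> real" where
  "Qz z e = p * z * X z powr (- a) + \<delta> * (2 * a * z * X e * W z e powr (a - 1))"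
definition Qe :: "real \<Rightarrow> real \<Rightarrow> real" where
  "Qe z e = \<delta> * (2 * e * W z e powr a + 2 * a * \<beta> * e * X e powr \<beta> * W z e powr (a - 1))"
definition Qzz :: "real \<Rightarrow> real \<Rightarrow> real" where
  "Qzz z e = p * X z powr (- a) - 2 * a * p * z\<^sup>2 * X z powr (- a - 1)
     + \<delta> * (2 * a * X e * W z e powr (a - 1) + 4 * a * (a - 1) * z\<^sup>2 * X e * W z e powr (a - 2))"
definition Qze :: "real \<Rightarrow> real \<Rightarrow> real" where
  "Qze z e = \<delta> * (4 * a * z * e * W z e powr (a - 1)
     + 4 * a * \<beta> * (a - 1) * z * e * X e powr \<beta> * W z e powr (a - 2))"
definition Qee :: "real \<Rightarrow> real \<Rightarrow> real" where
  "Qee z e = \<delta> * (2 * W z e powr a + 4 * a * \<beta> * e\<^sup>2 * X e powr (\<beta> - 1) * W z e powr (a - 1)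
     + 2 * a * \<beta> * X e powr \<beta> * W z e powr (a - 1)
     + 4 * a * \<beta>\<^sup>2 * e\<^sup>2 * X e powr (\<beta> - 1) * W z e powr (a - 1)
     + 4 * a * \<beta>\<^sup>2 * (a - 1) * e\<^sup>2 * X e powr (\<beta> - 1) * X e powr \<beta> * W z e powr (a - 2))"

lemma params: "0 \<le> a" "2 * a \<le> 1" "1 \<le> \<beta>" "2 \<le> q" "0 < \<delta>" "q = 1 + \<beta>" "q = \<beta> * p"
  "\<beta> * (p - 1) = 1"
proof -
  show "0 \<le> a" "2 * a \<le> 1" "1 \<le> \<beta>" "2 \<le> q"
    using p_gt_1 p_le_2 by (auto simp: a_def \<beta>_def q_def field_simps)
  then show "0 < \<delta>" using p_gt_1 by (auto simp: \<delta>_def)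
  show "q = 1 + \<beta>" "q = \<beta> * p" "\<beta> * (p - 1) = 1"
    using p_gt_1 by (auto simp: q_def \<beta>_def field_simps)
qed

lemma X_ge_1: "1 \<le> X z" by (simp add: X_def)
lemma X_pos: "0 < X z" using X_ge_1[of z] by linarith
lemma Xpowr_ge_1: "1 \<le> X e powr \<beta>" using X_ge_1 params by (intro ge_one_powr_ge_zero) auto
lemma W_ge: "X z \<le> W z e" "X e powr \<beta> \<le> W z e" "1 \<le> W z e"
  using X_ge_1[of z] Xpowr_ge_1[of e] by (auto simp: W_def)
lemma W_pos: "0 < W z e" using W_ge(3)[of z e] by linarith

section \<open>Derivatives of the Bellman function along curves, for use in time and along
  coordinate lines\<close>

lemma DERIV_X:
  assumes "(z has_real_derivative z') (at t)"
  shows "((\<lambda>t. X (z t)) has_real_derivative 2 * z t * z') (at t)"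
  unfolding X_def by (auto intro!: derivative_eq_intros assms)

lemma DERIV_X_powr:
  assumes "(z has_real_derivative z') (at t)"
  shows "((\<lambda>t. X (z t) powr r) has_real_derivative 2 * r * z t * X (z t) powr (r - 1) * z') (at t)"
  using DERIV_fun_powr[OF DERIV_X[OF assms] X_pos, of r] by (simp add: mult_ac)

lemma DERIV_W_powr:
  assumes "(z has_real_derivative z') (at t)" "(e has_real_derivative e') (at t)"
  shows "((\<lambda>t. W (z t) (e t) powr r) has_real_derivative
    r * W (z t) (e t) powr (r - 1) * (2 * z t * z' + 2 * \<beta> * e t * X (e t) powr (\<beta> - 1) * e')) (at t)"
proof -
  have "((\<lambda>t. W (z t) (e t)) has_real_derivative
      (2 * z t * z' + 2 * \<beta> * e t * X (e t) powr (\<beta> - 1) * e')) (at t)"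
    unfolding W_def by (intro DERIV_add DERIV_X DERIV_X_powr assms)
  from DERIV_fun_powr[OF this W_pos, of r] show ?thesis by simp
qed

lemma X_mult_powr: "X e * X e powr (\<beta> - 1) = X e powr \<beta>"
  using X_pos[of e] by (simp add: powr_mult_base)

lemma DERIV_Q:
  assumes "(z has_real_derivative z') (at t)" "(e has_real_derivative e') (at t)"
  shows "((\<lambda>t. Q (z t) (e t)) has_real_derivative Qz (z t) (e t) * z' + Qe (z t) (e t) * e') (at t)"
proof -
  have "p / 2 - 1 = - a" by (simp add: a_def field_simps)
  note DERIV_add[OF DERIV_X_powr[OF assms(1), of "p / 2"]
      DERIV_cmult[OF DERIV_mult[OF DERIV_X[OF assms(2)] DERIV_W_powr[OF assms, of a]], of \<delta>], unfolded this]
  then show ?thesis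
    unfolding Q_def
    by (elim DERIV_cong) (simp add: Qz_def Qe_def X_mult_powr[symmetric] algebra_simps)
qed

lemma DERIV_Qz:
  assumes "(z has_real_derivative z') (at t)" "(e has_real_derivative e') (at t)"
  shows "((\<lambda>t. Qz (z t) (e t)) has_real_derivative Qzz (z t) (e t) * z' + Qze (z t) (e t) * e') (at t)"
proof -
  note DERIV_add[OF DERIV_mult[OF DERIV_cmult[OF assms(1), of p] DERIV_X_powr[OF assms(1), of "- a"]]
      DERIV_cmult[OF DERIV_mult[OF DERIV_mult[OF DERIV_cmult[OF assms(1), of "2 * a"] DERIV_X[OF assms(2)]]
        DERIV_W_powr[OF assms, of "a - 1"]], of \<delta>]]
  then show ?thesis
    unfolding Qz_def
    by (elim DERIV_cong) (simp add: Qzz_def Qze_def X_mult_powr[symmetric] power2_eq_square algebra_simps)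
qed

lemma DERIV_Qe:
  assumes "(z has_real_derivative z') (at t)" "(e has_real_derivative e') (at t)"
  shows "((\<lambda>t. Qe (z t) (e t)) has_real_derivative Qze (z t) (e t) * z' + Qee (z t) (e t) * e') (at t)"
proof -
  note DERIV_cmult[OF DERIV_add[OF DERIV_mult[OF DERIV_cmult[OF assms(2), of 2] DERIV_W_powr[OF assms, of a]]
      DERIV_mult[OF DERIV_mult[OF DERIV_cmult[OF assms(2), of "2 * a * \<beta>"] DERIV_X_powr[OF assms(2), of \<beta>]]
        DERIV_W_powr[OF assms, of "a - 1"]]], of \<delta>]
  then show ?thesis
    unfolding Qe_def
    by (elim DERIV_cong) (simp add: Qee_def Qze_def power2_eq_square algebra_simps)
qed

section \<open>Lower bound for the Hessian form\<close>

lemma X_le_W_powr: "X e \<le> W z e powr (p - 1)"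
proof -
  have "X e = (X e powr \<beta>) powr (p - 1)"
    using X_pos[of e] params(8) by (simp add: powr_powr)
  also have "\<dots> \<le> W z e powr (p - 1)"
    using W_ge(2)[of e z] p_gt_1 by (intro powr_mono2) auto
  finally show ?thesis .
qed

lemma sq_le_W: "z\<^sup>2 \<le> W z e" using W_ge(1)[of z e] by (simp add: X_def)

lemma W_powr_shift: "W z e * W z e powr (r - 1) = W z e powr r"
  using W_pos[of z e] by (simp add: powr_mult_base)

text \<open>The exponents add up to \<open>(p - 1) + (a - 1) = - a\<close>, and a nonpositive power
  of \<open>W\<close> only grows when \<open>W\<close> is replaced by its part
  \<open>X z\<close>.\<close>

lemma X_mult_W_powr_le: "X e * W z e powr (a - 1) \<le> X z powr (- a)"
proof -
  have "X e * W z e powr (a - 1) \<le> W z e powr (p - 1) * W z e powr (a - 1)"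
    by (intro mult_right_mono X_le_W_powr) auto
  also have "\<dots> = W z e powr (- a)"
  proof -
    have "p - 1 + (a - 1) = - a" by (simp add: a_def field_simps)
    then show ?thesis by (simp only: powr_add[symmetric])
  qed
  also have "\<dots> \<le> X z powr (- a)" using W_ge X_pos params by (intro powr_mono2') auto
  finally show ?thesis .
qed

text \<open>The first summand of \<open>Q\<close> contributes at least
  \<open>p (1 - 2 a) = p (p - 1)\<close> times the weight. The second may bend the wrong way, but
  because of \<open>z^2 \<le> W\<close> by at most \<open>\<delta>\<close> times the same
  weight.\<close>

lemma Qzz_ge: "(p * (p - 1) - \<delta>) * X z powr (- a) \<le> Qzz z e"
proof -
  have 1: "z\<^sup>2 * X z powr (- a - 1) \<le> X z powr (- a)"
    using mult_right_mono[of "z\<^sup>2" "X z" "X z powr (- a - 1)"] X_pos[of z]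
    by (simp add: powr_mult_base) (simp add: X_def)
  have "z\<^sup>2 * W z e powr (a - 2) \<le> W z e * W z e powr (a - 1 - 1)"
    using sq_le_W[of z e] by (simp add: mult_right_mono)
  then have 2: "z\<^sup>2 * W z e powr (a - 2) \<le> W z e powr (a - 1)"
    by (simp only: W_powr_shift)
  have "2 * a * p * (z\<^sup>2 * X z powr (- a - 1)) \<le> 2 * a * p * X z powr (- a)"
    using 1 params p_gt_1 by (intro mult_left_mono) auto
  moreover have pp: "p * (p - 1) = p - 2 * a * p" by (simp add: a_def field_simps)
  ultimately have A: "p * (p - 1) * X z powr (- a) \<le> p * X z powr (- a) - 2 * a * p * z\<^sup>2 * X z powr (- a - 1)"
    unfolding pp by (simp add: algebra_simps)
  have "4 * a * (1 - a) * (X e * (z\<^sup>2 * W z e powr (a - 2))) \<le> 4 * a * (1 - a) * (X e * W z e powr (a - 1))"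
    using 2 params X_pos[of e] by (intro mult_left_mono) auto
  then have "- (2 * a * (1 - 2 * a) * (X e * W z e powr (a - 1)))
      \<le> 2 * a * X e * W z e powr (a - 1) + 4 * a * (a - 1) * z\<^sup>2 * X e * W z e powr (a - 2)"
    by (simp add: algebra_simps)
  moreover have "2 * a * (1 - 2 * a) * (X e * W z e powr (a - 1)) \<le> 1 * X z powr (- a)"
  proof (intro mult_mono X_mult_W_powr_le)
    have "2 * a * (1 - 2 * a) \<le> 1 * 1" using params by (intro mult_mono) auto
    then show "2 * a * (1 - 2 * a) \<le> 1" by simp
  qed (use X_pos[of e] in auto)
  ultimately have "- (X z powr (- a)) \<le> 2 * a * X e * W z e powr (a - 1) + 4 * a * (a - 1) * z\<^sup>2 * X e * W z e powr (a - 2)"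
    by linarith
  from mult_left_mono[OF this, of \<delta>] A params(5) show ?thesis
    by (simp add: Qzz_def left_diff_distrib)
qed

text \<open>Only the term with the factor \<open>a - 1\<close> can be negative. Since
  \<open>X e powr \<beta> \<le> W z e\<close> and \<open>1 - a \<le> 1\<close>, the term just before
  it absorbs it. Of the remaining terms only the one with \<open>W z e powr a\<close> is
  kept.\<close>

lemma Qee_ge: "2 * \<delta> * X z powr a \<le> Qee z e"
proof -
  have "X e powr \<beta> * W z e powr (a - 2) \<le> W z e * W z e powr (a - 1 - 1)"
    using W_ge(2)[of e z] by (simp add: mult_right_mono)
  then have 2: "X e powr \<beta> * W z e powr (a - 2) \<le> W z e powr (a - 1)"
    by (simp only: W_powr_shift)
  have "4 * a * \<beta>\<^sup>2 * (1 - a) * e\<^sup>2 * X e powr (\<beta> - 1) * (X e powr \<beta> * W z e powr (a - 2))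
     \<le> 4 * a * \<beta>\<^sup>2 * (1 - a) * e\<^sup>2 * X e powr (\<beta> - 1) * W z e powr (a - 1)"
    using 2 params by (intro mult_left_mono) auto
  moreover have "4 * a * \<beta>\<^sup>2 * (1 - a) * e\<^sup>2 * X e powr (\<beta> - 1) * W z e powr (a - 1)
     \<le> 4 * a * \<beta>\<^sup>2 * 1 * e\<^sup>2 * X e powr (\<beta> - 1) * W z e powr (a - 1)"
    using params by (intro mult_left_mono mult_right_mono) auto
  moreover have "0 \<le> 4 * a * \<beta> * e\<^sup>2 * X e powr (\<beta> - 1) * W z e powr (a - 1)"
     "0 \<le> 2 * a * \<beta> * X e powr \<beta> * W z e powr (a - 1)"
    using params by auto
  moreover have "X z powr a \<le> W z e powr a" using W_ge X_pos[of z] params by (intro powr_mono2) auto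
  ultimately have "2 * X z powr a \<le> 2 * W z e powr a + 4 * a * \<beta> * e\<^sup>2 * X e powr (\<beta> - 1) * W z e powr (a - 1)
     + 2 * a * \<beta> * X e powr \<beta> * W z e powr (a - 1)
     + 4 * a * \<beta>\<^sup>2 * e\<^sup>2 * X e powr (\<beta> - 1) * W z e powr (a - 1)
     + 4 * a * \<beta>\<^sup>2 * (a - 1) * e\<^sup>2 * X e powr (\<beta> - 1) * X e powr \<beta> * W z e powr (a - 2)"
    by (simp add: algebra_simps)
  from mult_left_mono[OF this, of \<delta>] params(5) show ?thesis
    by (simp add: Qee_def mult_ac)
qed

text \<open>In powers of \<open>W\<close>, \<open>z\<close> counts at most \<open>1 / 2\<close> and
  \<open>e\<close> at most \<open>(p - 1) / 2\<close>. With \<open>a - 1 = - p / 2\<close> the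
  exponents cancel, and the bound is free of \<open>z\<close> and \<open>e\<close>.\<close>

lemma Qze_le: "\<bar>Qze z e\<bar> \<le> 2 * \<delta> * q"
proof -
  have "\<bar>e\<bar> = (e\<^sup>2) powr (1/2)" by (simp add: powr_half_sqrt)
  also have "\<dots> \<le> (W z e powr (p - 1)) powr (1/2)"
    using X_le_W_powr[of e z] by (intro powr_mono2) (auto simp: X_def)
  finally have e: "\<bar>e\<bar> \<le> W z e powr ((p - 1) / 2)" by (simp add: powr_powr)
  have "\<bar>z\<bar> = (z\<^sup>2) powr (1/2)" by (simp add: powr_half_sqrt)
  also have "\<dots> \<le> W z e powr (1/2)"
    using sq_le_W[of z e] by (intro powr_mono2) auto
  finally have z: "\<bar>z\<bar> \<le> W z e powr (1/2)" .
  have "\<bar>z * e\<bar> * W z e powr (a - 1) \<le> (W z e powr (1/2) * W z e powr ((p - 1) / 2)) * W z e powr (a - 1)"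
    unfolding abs_mult by (intro mult_right_mono mult_mono z e) auto
  also have "\<dots> = 1"
    using W_pos[of z e] by (simp add: powr_add[symmetric] a_def field_simps)
  finally have ze: "\<bar>z * e\<bar> * W z e powr (a - 1) \<le> 1" .
  have "X e powr \<beta> * W z e powr (a - 2) \<le> W z e * W z e powr (a - 1 - 1)"
    using W_ge(2)[of e z] by (simp add: mult_right_mono)
  then have "\<bar>z * e\<bar> * (X e powr \<beta> * W z e powr (a - 2)) \<le> \<bar>z * e\<bar> * W z e powr (a - 1)"
    by (intro mult_left_mono) (simp_all only: W_powr_shift abs_ge_zero)
  with ze have ze': "\<bar>z * e\<bar> * (X e powr \<beta> * W z e powr (a - 2)) \<le> 1" by linarith
  have "\<bar>4 * a * z * e * W z e powr (a - 1)
     + 4 * a * \<beta> * (a - 1) * z * e * X e powr \<beta> * W z e powr (a - 2)\<bar>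
    \<le> 4 * a * (\<bar>z * e\<bar> * W z e powr (a - 1))
      + 4 * a * \<beta> * (1 - a) * (\<bar>z * e\<bar> * (X e powr \<beta> * W z e powr (a - 2)))"
    using params by (intro order_trans[OF abs_triangle_ineq]) (simp add: abs_mult mult_ac)
  also have "\<dots> \<le> 4 * a * 1 + 4 * a * \<beta> * (1 - a) * 1"
    using params ze ze' by (intro add_mono mult_left_mono) auto
  also have "\<dots> \<le> 2 * 1 + 2 * \<beta> * 1"
  proof (intro add_mono)
    have "2 * a * (1 - a) \<le> 1 * 1" using params by (intro mult_mono) auto
    from mult_left_mono[OF this, of "2 * \<beta>"] show "4 * a * \<beta> * (1 - a) * 1 \<le> 2 * \<beta> * 1"
      using params by (simp add: mult_ac)
  qed (use params in auto)
  also have "\<dots> = 2 * q" using params by simp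
  finally show ?thesis
    using params(5) by (simp add: Qze_def abs_mult mult_ac)
qed

text \<open>The weights of the diagonal entries, \<open>X z powr (- a)\<close> and
  \<open>X z powr a\<close>, have product 1, so the inequality of arithmetic and geometric means
  gives a multiple of \<open>|r s|\<close> without weights.\<close>

lemma hessian_ge:
  "(p - 1)\<^sup>2 / 4 * \<bar>r * s\<bar> \<le> Qzz z e * r\<^sup>2 + 2 * Qze z e * r * s + Qee z e * s\<^sup>2"
proof -
  define \<kappa> where "\<kappa> = p * (p - 1)"
  have \<kappa>: "\<kappa> > 0" using p_gt_1 by (simp add: \<kappa>_def)
  have \<delta>: "\<delta> = \<kappa> / (16 * q\<^sup>2)" by (simp add: \<delta>_def \<kappa>_def)
  have q: "q > 0" "1 \<le> q\<^sup>2" using params(4) by (auto intro: one_le_power)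
  have \<delta>\<kappa>: "\<delta> \<le> \<kappa> / 2" unfolding \<delta> using \<kappa> q by (intro divide_left_mono) auto
  define P where "P = sqrt (X z powr a)"
  have P: "P > 0" "X z powr a = P\<^sup>2" "X z powr (- a) = 1 / P\<^sup>2"
    using X_pos[of z] by (auto simp: P_def powr_minus divide_inverse)
  have "\<kappa> / 2 * (1 / P\<^sup>2) \<le> Qzz z e"
  proof -
    have "\<kappa> / 2 * (1 / P\<^sup>2) \<le> (\<kappa> - \<delta>) * (1 / P\<^sup>2)" using \<delta>\<kappa> by (intro mult_right_mono) auto
    also have "\<dots> \<le> Qzz z e" using Qzz_ge[of z e] by (simp add: \<kappa>_def P)
    finally show ?thesis .
  qed
  then have 1: "\<kappa> / 2 * (1 / P\<^sup>2) * r\<^sup>2 \<le> Qzz z e * r\<^sup>2" by (intro mult_right_mono) auto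
  have 2: "\<kappa> / (8 * q\<^sup>2) * P\<^sup>2 * s\<^sup>2 \<le> Qee z e * s\<^sup>2"
    using Qee_ge[of z e] unfolding \<delta> P by (intro mult_right_mono) auto
  have "\<bar>2 * Qze z e * r * s\<bar> \<le> 2 * (2 * \<delta> * q) * \<bar>r * s\<bar>"
    using mult_right_mono[OF Qze_le[of z e], of "2 * \<bar>r * s\<bar>"] by (simp add: abs_mult mult_ac)
  also have "2 * (2 * \<delta> * q) = \<kappa> / (4 * q)"
    using q by (simp add: \<delta> power2_eq_square field_simps)
  finally have 3: "- (\<kappa> / (4 * q) * \<bar>r * s\<bar>) \<le> 2 * Qze z e * r * s" by linarith
  \<comment> \<open>The square is balanced so that its cross term has the coefficient
    \<open>\<kappa> / (2 q)\<close>, twice what the mixed derivative can cost.\<close>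
  have "0 \<le> \<kappa> / 2 * (\<bar>r\<bar> / P - P * \<bar>s\<bar> / (2 * q))\<^sup>2" using \<kappa> by simp
  also have "\<dots> = \<kappa> / 2 * (1 / P\<^sup>2) * r\<^sup>2 + \<kappa> / (8 * q\<^sup>2) * P\<^sup>2 * s\<^sup>2 - \<kappa> / (2 * q) * \<bar>r * s\<bar>"
    using P(1) q by (simp add: power2_diff power_divide power_mult_distrib abs_mult field_simps power2_eq_square power4_eq_xxxx)
  finally have 4: "\<kappa> / (2 * q) * \<bar>r * s\<bar> \<le> \<kappa> / 2 * (1 / P\<^sup>2) * r\<^sup>2 + \<kappa> / (8 * q\<^sup>2) * P\<^sup>2 * s\<^sup>2" by simp
  have eq: "\<kappa> / (4 * q) = (p - 1)\<^sup>2 / 4"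
    using p_gt_1 by (simp add: \<kappa>_def q_def power2_eq_square field_simps)
  have "\<kappa> / (2 * q) * \<bar>r * s\<bar> = \<kappa> / (4 * q) * \<bar>r * s\<bar> + \<kappa> / (4 * q) * \<bar>r * s\<bar>"
    by (simp add: field_simps)
  with 1 2 3 4 show ?thesis unfolding eq[symmetric] by linarith
qed

section \<open>Size of the Bellman function\<close>

lemma Q_nonneg: "0 \<le> Q z e"
  using params X_pos[of e] by (auto simp: Q_def)

text \<open>Both summands are controlled by \<open>W powr (p / 2)\<close>, the second because of
  \<open>(p - 1) + a = p / 2\<close>. Then \<open>\<beta> p / 2 = q / 2\<close> turns the
  \<open>e\<close>-part of \<open>W\<close> into \<open>|e|^q\<close>.\<close>

lemma Q_le: obtains C where "C \<ge> 0" "\<And>z e. Q z e \<le> C * (1 + \<bar>z\<bar> powr p + \<bar>e\<bar> powr q)"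
proof -
  have max3: "(x + y) powr r \<le> 2 powr r * (x powr r + y powr r)"
    if "0 \<le> x" "0 \<le> y" "0 \<le> r" for x y r :: real
  proof -
    have "(x + y) powr r \<le> (2 * max x y) powr r" using that by (intro powr_mono2) auto
    also have "\<dots> = 2 powr r * max x y powr r" using that by (simp add: powr_mult)
    also have "max x y powr r \<le> x powr r + y powr r" by (auto simp: max_def)
    finally show ?thesis by simp
  qed
  define C where "C = 2 powr (p/2) * (2 powr (p/2) + 2 powr (q/2))"
  have sq: "(x\<^sup>2) powr (r / 2) = \<bar>x\<bar> powr r" for x r :: real
  proof -
    have "x\<^sup>2 = \<bar>x\<bar> powr 2" by simp
    then show ?thesis by (simp only: powr_powr) simp
  qed
  have W: "W z e powr (p / 2) \<le> C * (1 + \<bar>z\<bar> powr p + \<bar>e\<bar> powr q)" for z e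
  proof -
    have "W z e powr (p / 2) \<le> 2 powr (p/2) * (X z powr (p/2) + (X e powr \<beta>) powr (p/2))"
      unfolding W_def using X_pos[of z] p_gt_1 by (intro max3) auto
    also have "(X e powr \<beta>) powr (p/2) = X e powr (q / 2)" using params by (simp add: powr_powr)
    also have "X z powr (p/2) \<le> 2 powr (p/2) * (1 + \<bar>z\<bar> powr p)"
      using max3[of 1 "z\<^sup>2" "p/2"] p_gt_1 by (simp add: X_def sq)
    also have "X e powr (q/2) \<le> 2 powr (q/2) * (1 + \<bar>e\<bar> powr q)"
      using max3[of 1 "e\<^sup>2" "q/2"] params by (simp add: X_def sq)
    also have "2 powr (p/2) * (2 powr (p/2) * (1 + \<bar>z\<bar> powr p) + 2 powr (q/2) * (1 + \<bar>e\<bar> powr q))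
       \<le> C * (1 + \<bar>z\<bar> powr p + \<bar>e\<bar> powr q)"
      unfolding C_def by (simp add: algebra_simps)
    finally show ?thesis by (simp add: mult_left_mono add_mono)
  qed
  show ?thesis
  proof (rule that[of "(1 + \<delta>) * C"])
    show "(1 + \<delta>) * C \<ge> 0" using params by (simp add: C_def)
    fix z e
    have "X z powr (p/2) \<le> W z e powr (p/2)"
      using W_ge X_pos[of z] p_gt_1 by (intro powr_mono2) auto
    moreover have "X e * W z e powr a \<le> W z e powr (p/2)"
    proof -
      have "X e * W z e powr a \<le> W z e powr (p - 1) * W z e powr a"
        by (intro mult_right_mono X_le_W_powr) auto
      also have "\<dots> = W z e powr (p/2)" by (simp add: powr_add[symmetric] a_def field_simps)
      finally show ?thesis .
    qed
    ultimately have "Q z e \<le> (1 + \<delta>) * W z e powr (p/2)"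
      using params(5) by (simp add: Q_def distrib_right add_mono mult_left_mono)
    also have "\<dots> \<le> (1 + \<delta>) * (C * (1 + \<bar>z\<bar> powr p + \<bar>e\<bar> powr q))"
      using params(5) by (intro mult_left_mono W) auto
    finally show "Q z e \<le> (1 + \<delta>) * C * (1 + \<bar>z\<bar> powr p + \<bar>e\<bar> powr q)" by (simp add: mult.assoc)
  qed
qed

lemma exp_bounded_Qs [exp_bounded_intros]:
  assumes "exp_bounded z" "exp_bounded e"
  shows "exp_bounded (\<lambda>x. Q (z x) (e x))"
    "exp_bounded (\<lambda>x. Qz (z x) (e x))" "exp_bounded (\<lambda>x. Qe (z x) (e x))"
    "exp_bounded (\<lambda>x. Qzz (z x) (e x))" "exp_bounded (\<lambda>x. Qze (z x) (e x))"
    "exp_bounded (\<lambda>x. Qee (z x) (e x))"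
proof -
  note [exp_bounded_intros] = assms
  have [exp_bounded_intros]: "exp_bounded (\<lambda>x. X (z x))" "exp_bounded (\<lambda>x. X (e x))"
    unfolding X_def by (intro exp_bounded_intros)+
  have [exp_bounded_intros]: "exp_bounded (\<lambda>x. X (z x) powr r)" "exp_bounded (\<lambda>x. X (e x) powr r)" for r
    by (intro exp_bounded_intros exp_bounded_powr X_ge_1)+
  have "exp_bounded (\<lambda>x. W (z x) (e x))"
    unfolding W_def by (intro exp_bounded_intros)
  then have [exp_bounded_intros]: "exp_bounded (\<lambda>x. W (z x) (e x) powr r)" for r
    by (rule exp_bounded_powr) (rule W_ge)
  show "exp_bounded (\<lambda>x. Q (z x) (e x))"
    "exp_bounded (\<lambda>x. Qz (z x) (e x))" "exp_bounded (\<lambda>x. Qe (z x) (e x))"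
    "exp_bounded (\<lambda>x. Qzz (z x) (e x))" "exp_bounded (\<lambda>x. Qze (z x) (e x))"
    "exp_bounded (\<lambda>x. Qee (z x) (e x))"
    unfolding Q_def Qz_def Qe_def Qzz_def Qze_def Qee_def by (intro exp_bounded_intros)+
qed

end

subsection \<open>Hermite expansions of polynomials\<close>

text \<open>Products of one-variable polynomials are closed under partial derivatives, so Hermite
  products and their first two derivatives obey the same rules.\<close>

definition poly_prod :: "('n::finite \<Rightarrow> real poly) \<Rightarrow> real ^ 'n \<Rightarrow> real" where
  "poly_prod q x = (\<Prod>j\<in>UNIV. poly (q j) (x $ j))"

lemma poly_prod_upd:
  "poly_prod (q(i := r)) x = poly r (x $ i) * (\<Prod>j\<in>UNIV - {i}. poly (q j) (x $ j))"
  by (simp add: poly_prod_def prod.remove[of UNIV i])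

lemma poly_prod_split:
  "poly_prod q x = poly (q i) (x $ i) * (\<Prod>j\<in>UNIV - {i}. poly (q j) (x $ j))"
  by (simp add: poly_prod_def prod.remove[of UNIV i])

lemma exp_bounded_poly_prod [exp_bounded_intros]: "exp_bounded (poly_prod q)"
  unfolding poly_prod_def[abs_def] by (intro exp_bounded_intros)

lemma DERIV_poly_prod:
  "((\<lambda>s. poly_prod q (x + s *\<^sub>R axis i 1)) has_real_derivative
     poly_prod (q(i := pderiv (q i))) x) (at 0)"
proof -
  let ?K = "\<Prod>j\<in>UNIV - {i}. poly (q j) (x $ j)"
  have "poly_prod q (x + s *\<^sub>R axis i 1) = poly (q i) (x $ i + s) * ?K" for s
    unfolding poly_prod_split[of q _ i] by (auto simp: axis_def intro!: prod.cong)
  moreover have "((\<lambda>s. poly (q i) (x $ i + s) * ?K) has_real_derivative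
      poly_prod (q(i := pderiv (q i))) x) (at 0)"
    unfolding poly_prod_upd
    by (auto intro!: derivative_eq_intros DERIV_chain'[where g = "poly (q i)", OF _ poly_DERIV])
  ultimately show ?thesis by simp
qed

lemma multi_hermite_eq: "multi_hermite \<alpha> = poly_prod (\<lambda>j. hermite (\<alpha> j))"
  by (simp add: multi_hermite_def poly_prod_def fun_eq_iff)

definition hermite_d :: "'n::finite \<Rightarrow> ('n \<Rightarrow> nat) \<Rightarrow> real ^ 'n \<Rightarrow> real" where
  "hermite_d i \<alpha> = poly_prod ((\<lambda>j. hermite (\<alpha> j))(i := pderiv (hermite (\<alpha> i))))"

definition hermite_dd :: "'n::finite \<Rightarrow> ('n \<Rightarrow> nat) \<Rightarrow> real ^ 'n \<Rightarrow> real" where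
  "hermite_dd i \<alpha> = poly_prod ((\<lambda>j. hermite (\<alpha> j))(i := pderiv (pderiv (hermite (\<alpha> i)))))"

lemma exp_bounded_hermite [exp_bounded_intros]:
  "exp_bounded (multi_hermite \<alpha>)" "exp_bounded (hermite_d i \<alpha>)" "exp_bounded (hermite_dd i \<alpha>)"
  by (simp_all add: multi_hermite_eq hermite_d_def hermite_dd_def exp_bounded_poly_prod)

lemma DERIV_multi_hermite:
  "((\<lambda>s. multi_hermite \<alpha> (x + s *\<^sub>R axis i 1)) has_real_derivative hermite_d i \<alpha> x) (at 0)"
  unfolding multi_hermite_eq hermite_d_def by (rule DERIV_poly_prod)

lemma DERIV_hermite_d:
  "((\<lambda>s. hermite_d i \<alpha> (x + s *\<^sub>R axis i 1)) has_real_derivative hermite_dd i \<alpha> x) (at 0)"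
  using DERIV_poly_prod[of "(\<lambda>j. hermite (\<alpha> j))(i := pderiv (hermite (\<alpha> i)))" x i]
  unfolding hermite_d_def hermite_dd_def by simp

lemma hermite_eigen:
  "(\<Sum>i\<in>UNIV. x $ i * hermite_d i \<alpha> x - hermite_dd i \<alpha> x / 2) = real (multi_degree \<alpha>) * multi_hermite \<alpha> x"
proof -
  have "x $ i * hermite_d i \<alpha> x - hermite_dd i \<alpha> x / 2 = real (\<alpha> i) * multi_hermite \<alpha> x" for i
    unfolding hermite_d_def hermite_dd_def multi_hermite_eq poly_prod_upd poly_prod_split[of _ x i]
    by (simp add: hermite_ode field_simps)
  then show ?thesis by (simp add: multi_degree_def sum_distrib_right)
qed

text \<open>The recursion for \<open>hermite\<close> in one coordinate: \<open>2 x_i\<close> minus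
  the \<open>i\<close>-th derivative, the Gaussian adjoint of that derivative, acts as creation
  operator.\<close>

lemma multi_hermite_raise:
  "multi_hermite (\<alpha>(i := Suc (\<alpha> i))) x = 2 * x $ i * multi_hermite \<alpha> x - hermite_d i \<alpha> x"
proof -
  have "(\<lambda>j. hermite ((\<alpha>(i := Suc (\<alpha> i))) j)) = (\<lambda>j. hermite (\<alpha> j))(i := hermite (Suc (\<alpha> i)))"
    by auto
  then show ?thesis
    unfolding hermite_d_def multi_hermite_eq
    by (simp only: poly_prod_upd poly_prod_split[of "\<lambda>j. hermite (\<alpha> j)" x i]) (simp add: algebra_simps)
qed

text \<open>The derivative acts as annihilation operator. For \<open>\<alpha> i = 0\<close> the
  truncated subtraction leaves the index unchanged, and the factor 0 makes the formula
  correct.\<close>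

lemma hermite_d_eq:
  "hermite_d i \<alpha> x = 2 * real (\<alpha> i) * multi_hermite (\<alpha>(i := \<alpha> i - 1)) x"
proof -
  have "(\<lambda>j. hermite ((\<alpha>(i := \<alpha> i - 1)) j)) = (\<lambda>j. hermite (\<alpha> j))(i := hermite (\<alpha> i - 1))"
    by auto
  then show ?thesis
    unfolding hermite_d_def multi_hermite_eq
    by (simp only: poly_prod_upd) (cases "\<alpha> i"; simp add: pderiv_1 pderiv_hermite_Suc del: hermite.simps(2))
qed

text \<open>Creation is adjoint to annihilation, so an index raised on one factor becomes an index
  lowered on the other.\<close>

lemma integral_hermite_raise:
  "(LINT x|gauss. multi_hermite (\<alpha>(i := Suc (\<alpha> i))) x * multi_hermite \<beta> x)
    = 2 * real (\<beta> i) * (LINT x|gauss. multi_hermite \<alpha> x * multi_hermite (\<beta>(i := \<beta> i - 1)) x)"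
proof -
  have "(LINT x|gauss. hermite_d i \<alpha> x * multi_hermite \<beta> x + multi_hermite \<alpha> x * hermite_d i \<beta> x)
      = (LINT x|gauss. 2 * x $ i * (multi_hermite \<alpha> x * multi_hermite \<beta> x))"
  proof (rule gauss_integral_by_parts)
    show "((\<lambda>s. multi_hermite \<alpha> (x + s *\<^sub>R axis i 1) * multi_hermite \<beta> (x + s *\<^sub>R axis i 1)) has_real_derivative
        hermite_d i \<alpha> x * multi_hermite \<beta> x + multi_hermite \<alpha> x * hermite_d i \<beta> x) (at 0)" for x
      using DERIV_mult[OF DERIV_multi_hermite[of \<alpha> x i] DERIV_multi_hermite[of \<beta> x i]]
      by (simp add: mult_ac)
  qed (intro exp_bounded_intros)+
  also have "(LINT x|gauss. hermite_d i \<alpha> x * multi_hermite \<beta> x + multi_hermite \<alpha> x * hermite_d i \<beta> x)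
     = (LINT x|gauss. hermite_d i \<alpha> x * multi_hermite \<beta> x) + (LINT x|gauss. multi_hermite \<alpha> x * hermite_d i \<beta> x)"
    by (intro Bochner_Integration.integral_add integrable_gauss_exp_bounded exp_bounded_intros)
  finally have "(LINT x|gauss. 2 * x $ i * (multi_hermite \<alpha> x * multi_hermite \<beta> x)) - (LINT x|gauss. hermite_d i \<alpha> x * multi_hermite \<beta> x)
     = (LINT x|gauss. multi_hermite \<alpha> x * hermite_d i \<beta> x)" by linarith
  also have "(LINT x|gauss. 2 * x $ i * (multi_hermite \<alpha> x * multi_hermite \<beta> x)) - (LINT x|gauss. hermite_d i \<alpha> x * multi_hermite \<beta> x)
     = (LINT x|gauss. 2 * x $ i * (multi_hermite \<alpha> x * multi_hermite \<beta> x) - hermite_d i \<alpha> x * multi_hermite \<beta> x)"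
    by (intro Bochner_Integration.integral_diff[symmetric] integrable_gauss_exp_bounded exp_bounded_intros)
  also have "\<dots> = (LINT x|gauss. multi_hermite (\<alpha>(i := Suc (\<alpha> i))) x * multi_hermite \<beta> x)"
    by (simp only: multi_hermite_raise) (simp add: algebra_simps)
  finally show ?thesis
    by (simp add: hermite_d_eq mult.left_commute[of "multi_hermite \<alpha> _"])
qed

text \<open>The raising formula lowers both \<open>i\<close>-th indices in step. The smaller one
  reaches 0 first, and then its factor \<open>real (\<beta> i)\<close> kills the integral.\<close>

lemma hermite_orthogonal_aux:
  "\<beta> i < \<alpha> i \<Longrightarrow> (LINT x|gauss. multi_hermite \<alpha> x * multi_hermite \<beta> x) = 0"
proof (induction "\<beta> i" arbitrary: \<alpha> \<beta>)
  case 0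
  have "\<alpha> = (\<alpha>(i := \<alpha> i - 1))(i := Suc ((\<alpha>(i := \<alpha> i - 1)) i))" using 0 by (auto simp: fun_eq_iff)
  then show ?case using integral_hermite_raise[of "\<alpha>(i := \<alpha> i - 1)" i \<beta>] 0 by simp
next
  case (Suc b)
  have "\<alpha> = (\<alpha>(i := \<alpha> i - 1))(i := Suc ((\<alpha>(i := \<alpha> i - 1)) i))" using Suc by (auto simp: fun_eq_iff)
  moreover have "(LINT x|gauss. multi_hermite (\<alpha>(i := \<alpha> i - 1)) x * multi_hermite (\<beta>(i := \<beta> i - 1)) x) = 0"
    using Suc.hyps(2) Suc.prems by (intro Suc.hyps(1)) auto
  ultimately show ?case using integral_hermite_raise[of "\<alpha>(i := \<alpha> i - 1)" i \<beta>] by simp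
qed

lemma hermite_orthogonal:
  assumes "\<alpha> \<noteq> \<beta>"
  shows "(LINT x|gauss. multi_hermite \<alpha> x * multi_hermite \<beta> x) = 0"
proof -
  obtain i where "\<alpha> i \<noteq> \<beta> i" using assms by auto
  then show ?thesis
    using hermite_orthogonal_aux[of \<beta> i \<alpha>] hermite_orthogonal_aux[of \<alpha> i \<beta>]
    by (cases "\<alpha> i < \<beta> i") (auto simp: mult.commute)
qed

definition hermite_norm2 :: "('n::finite \<Rightarrow> nat) \<Rightarrow> real" where
  "hermite_norm2 \<alpha> = (LINT x|gauss. multi_hermite \<alpha> x * multi_hermite \<alpha> x)"

text \<open>Lowering one index divides the squared norm by the positive factor
  \<open>2 * real (\<alpha> i)\<close>, which leads down to the constant 1 and the total Gaussian
  mass.\<close>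

lemma hermite_norm2_pos: "hermite_norm2 \<alpha> > 0"
proof (induction "multi_degree \<alpha>" arbitrary: \<alpha>)
  case 0
  then have "\<alpha> = (\<lambda>_. 0)" by (auto simp: multi_degree_def)
  then have "multi_hermite \<alpha> = (\<lambda>_. 1)" by (simp add: multi_hermite_def fun_eq_iff)
  then show ?case using gauss_pos by (simp add: hermite_norm2_def)
next
  case (Suc n)
  then obtain i where i: "\<alpha> i > 0"
    by (metis multi_degree_def neq0_conv sum.neutral nat.distinct(1))
  define \<beta> where "\<beta> = \<alpha>(i := \<alpha> i - 1)"
  have eq: "\<alpha> = \<beta>(i := Suc (\<beta> i))" using i by (auto simp: fun_eq_iff \<beta>_def)
  have "multi_degree \<alpha> = Suc (multi_degree \<beta>)"
    using i by (simp add: multi_degree_def \<beta>_def sum.remove[of UNIV i])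
  then have "hermite_norm2 \<beta> > 0" using Suc by auto
  moreover have "hermite_norm2 \<alpha> = 2 * real (\<alpha> i) * hermite_norm2 \<beta>"
    using integral_hermite_raise[of \<beta> i \<alpha>, folded eq] unfolding hermite_norm2_def by (simp only: \<beta>_def)
  ultimately show ?case using i by simp
qed

lemma integral_hermite:
  "(LINT x|gauss. multi_hermite \<alpha> x * multi_hermite \<beta> x) = (if \<alpha> = \<beta> then hermite_norm2 \<alpha> else 0)"
  by (simp add: hermite_orthogonal hermite_norm2_def)

definition hermite_sum :: "(('n::finite \<Rightarrow> nat) \<Rightarrow> real) \<Rightarrow> ('n \<Rightarrow> nat) set \<Rightarrow> real ^ 'n \<Rightarrow> real" where
  "hermite_sum c F x = (\<Sum>\<alpha>\<in>F. c \<alpha> * multi_hermite \<alpha> x)"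

lemma exp_bounded_hermite_sum [exp_bounded_intros]: "exp_bounded (hermite_sum c F)"
  unfolding hermite_sum_def[abs_def] by (intro exp_bounded_intros)

lemma integral_hermite_sum:
  assumes "finite F"
  shows "(LINT x|gauss. hermite_sum c F x * hermite_sum d F x) = (\<Sum>\<alpha>\<in>F. c \<alpha> * d \<alpha> * hermite_norm2 \<alpha>)"
proof -
  have "(LINT x|gauss. hermite_sum c F x * hermite_sum d F x)
      = (LINT x|gauss. (\<Sum>\<alpha>\<in>F. \<Sum>\<beta>\<in>F. c \<alpha> * d \<beta> * (multi_hermite \<alpha> x * multi_hermite \<beta> x)))"
    by (simp add: hermite_sum_def sum_product mult_ac)
  also have "\<dots> = (\<Sum>\<alpha>\<in>F. \<Sum>\<beta>\<in>F. LINT x|gauss. c \<alpha> * d \<beta> * (multi_hermite \<alpha> x * multi_hermite \<beta> x))"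
    by (subst Bochner_Integration.integral_sum Bochner_Integration.integral_sum,
        intro integrable_gauss_exp_bounded exp_bounded_intros, intro sum.cong refl
        Bochner_Integration.integral_sum integrable_gauss_exp_bounded exp_bounded_intros)
  also have "\<dots> = (\<Sum>\<alpha>\<in>F. \<Sum>\<beta>\<in>F. if \<alpha> = \<beta> then c \<alpha> * d \<beta> * hermite_norm2 \<alpha> else 0)"
    by (intro sum.cong refl) (simp add: integral_hermite)
  also have "\<dots> = (\<Sum>\<alpha>\<in>F. c \<alpha> * d \<alpha> * hermite_norm2 \<alpha>)"
    using assms by (simp add: sum.delta')
  finally show ?thesis .
qed

section \<open>Polynomials as finite combinations of Hermite polynomials\<close>

inductive hermite_span :: "(real ^ 'n \<Rightarrow> real) \<Rightarrow> bool" where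
  base: "hermite_span (multi_hermite \<alpha>)"
| add: "hermite_span f \<Longrightarrow> hermite_span g \<Longrightarrow> hermite_span (\<lambda>x. f x + g x)"
| scale: "hermite_span f \<Longrightarrow> hermite_span (\<lambda>x. c * f x)"

lemma hermite_span_0: "hermite_span (\<lambda>x. 0)"
  using hermite_span.scale[OF hermite_span.base, of 0] by simp

lemma hermite_span_sum:
  "(\<And>i. i \<in> I \<Longrightarrow> hermite_span (f i)) \<Longrightarrow> hermite_span (\<lambda>x. \<Sum>i\<in>I. f i x)"
  by (induction I rule: infinite_finite_induct) (auto intro: hermite_span.add hermite_span_0)

lemma hermite_span_d: "hermite_span (hermite_d i \<alpha>)"
  unfolding hermite_d_eq[abs_def] by (intro hermite_span.intros)

text \<open>Creation plus differentiation is multiplication by \<open>2 x_i\<close>, and both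
  operations stay in the span.\<close>

lemma hermite_span_nth:
  "hermite_span f \<Longrightarrow> hermite_span (\<lambda>x. x $ i * f x)"
proof (induction rule: hermite_span.induct)
  case (base \<alpha>)
  have "(\<lambda>x. x $ i * multi_hermite \<alpha> x)
      = (\<lambda>x. (1/2) * (multi_hermite (\<alpha>(i := Suc (\<alpha> i))) x + hermite_d i \<alpha> x))"
    by (simp add: multi_hermite_raise)
  then show ?case by (simp only:) (intro hermite_span.intros hermite_span_d)
next
  case (add f g)
  then show ?case using hermite_span.add by (simp add: distrib_left)
next
  case (scale f c)
  from hermite_span.scale[OF scale.IH, of c] show ?case by (simp add: mult.left_commute)
qed

text \<open>Multiplying an arbitrary member \<open>f\<close> of the span, and not just 1, makes the
  product case of the induction two successive multiplications.\<close>

lemma hermite_span_polynomial_mult: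
  assumes "real_polynomial_function g"
  shows "hermite_span f \<Longrightarrow> hermite_span (\<lambda>x. g x * f x)"
  using assms
proof (induction arbitrary: f rule: real_polynomial_function.induct)
  case (linear g)
  have "g x = (\<Sum>i\<in>UNIV. g (axis i 1) * x $ i)" for x
  proof -
    have "g x = g (\<Sum>i\<in>UNIV. x $ i *\<^sub>R axis i 1)"
      using basis_expansion[of x] by (simp add: scalar_mult_eq_scaleR)
    also have "\<dots> = (\<Sum>i\<in>UNIV. g (axis i 1) * x $ i)"
      using linear(1) by (simp add: linear_sum bounded_linear.linear linear_cmul mult.commute)
    finally show ?thesis .
  qed
  then have "(\<lambda>x. g x * f x) = (\<lambda>x. \<Sum>i\<in>UNIV. g (axis i 1) * (x $ i * f x))"
    by (metis (no_types, lifting) mult.assoc sum_distrib_right sum.cong)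
  then show ?case
    using linear by (simp only:) (intro hermite_span_sum hermite_span.scale hermite_span_nth)
next
  case (const c)
  then show ?case by (intro hermite_span.scale)
next
  case (add f1 f2)
  from hermite_span.add[OF add.IH(1)[OF add.prems] add.IH(2)[OF add.prems]]
  show ?case by (simp add: distrib_right)
next
  case (mult f1 f2)
  then show ?case by (simp add: mult.assoc)
qed

lemma hermite_span_finite_sum:
  "hermite_span f \<Longrightarrow> \<exists>c F. finite F \<and> f = hermite_sum c F"
proof (induction rule: hermite_span.induct)
  case (base \<alpha>)
  have "multi_hermite \<alpha> = hermite_sum (\<lambda>_. 1) {\<alpha>}" by (simp add: hermite_sum_def fun_eq_iff)
  then show ?case by blast
next
  case (add f g)
  then obtain c F d G where *: "finite F" "f = hermite_sum c F" "finite G" "g = hermite_sum d G" by blast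
  have "(\<lambda>x. f x + g x) = hermite_sum (\<lambda>\<alpha>. (if \<alpha> \<in> F then c \<alpha> else 0) + (if \<alpha> \<in> G then d \<alpha> else 0)) (F \<union> G)"
  proof
    fix x
    have "(\<Sum>\<alpha>\<in>F. c \<alpha> * multi_hermite \<alpha> x) = (\<Sum>\<alpha>\<in>F \<union> G. (if \<alpha> \<in> F then c \<alpha> else 0) * multi_hermite \<alpha> x)"
      using * by (intro sum.mono_neutral_cong_left) auto
    moreover have "(\<Sum>\<alpha>\<in>G. d \<alpha> * multi_hermite \<alpha> x) = (\<Sum>\<alpha>\<in>F \<union> G. (if \<alpha> \<in> G then d \<alpha> else 0) * multi_hermite \<alpha> x)"
      using * by (intro sum.mono_neutral_cong_left) auto
    ultimately show "f x + g x = hermite_sum (\<lambda>\<alpha>. (if \<alpha> \<in> F then c \<alpha> else 0) + (if \<alpha> \<in> G then d \<alpha> else 0)) (F \<union> G) x"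
      by (simp add: * hermite_sum_def distrib_right sum.distrib)
  qed
  with * show ?case by blast
next
  case (scale f c)
  then obtain d F where *: "finite F" "f = hermite_sum d F" by blast
  have "(\<lambda>x. c * f x) = hermite_sum (\<lambda>\<alpha>. c * d \<alpha>) F"
    by (simp add: * hermite_sum_def fun_eq_iff sum_distrib_left mult.assoc)
  with * show ?case by blast
qed

lemma polynomial_hermite_expansion:
  fixes g :: "real ^ 'n \<Rightarrow> real"
  assumes "real_polynomial_function g"
  obtains c F where "finite F" "g = hermite_sum c F"
proof -
  have "multi_hermite (\<lambda>_::'n. 0) = (\<lambda>_. 1)" by (simp add: multi_hermite_def fun_eq_iff)
  then have "hermite_span (\<lambda>x. g x * 1)"
    using hermite_span_polynomial_mult[OF assms hermite_span.base[of "\<lambda>_. 0"]] by simp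
  then show ?thesis using hermite_span_finite_sum that by auto
qed

subsection \<open>Heat flow\<close>

text \<open>For \<open>G = multi_hermite\<close> this is \<open>e^(- t L / 2)\<close> applied to
  \<open>hermite_sum c F\<close>; the derivative families give its spatial derivatives. Time and
  space form one argument, so that growth and measurability can be stated jointly.\<close>

definition flow :: "(('n::finite \<Rightarrow> nat) \<Rightarrow> real ^ 'n \<Rightarrow> real) \<Rightarrow> (('n \<Rightarrow> nat) \<Rightarrow> real) \<Rightarrow> ('n \<Rightarrow> nat) set
    \<Rightarrow> real \<times> (real ^ 'n) \<Rightarrow> real" where
  "flow G c F z = (\<Sum>\<alpha>\<in>F. c \<alpha> * (exp (- (real (multi_degree \<alpha>) / 2) * fst z) * G \<alpha> (snd z)))"

lemma exp_bounded_flow: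
  assumes "\<And>\<alpha>. exp_bounded (G \<alpha>)"
  shows "exp_bounded (flow G c F)"
  unfolding flow_def[abs_def]
  by (intro exp_bounded_sum exp_bounded_mult exp_bounded_const exp_bounded_exp_fst
      exp_bounded_compose_snd assms)

lemma exp_bounded_flow_hermite [exp_bounded_intros]:
  "exp_bounded (flow multi_hermite c F)" "exp_bounded (flow (hermite_d i) c F)"
  "exp_bounded (flow (hermite_dd i) c F)"
  by (intro exp_bounded_flow exp_bounded_intros)+

lemma exp_bounded_flow_slice [exp_bounded_intros]:
  "exp_bounded (\<lambda>x. flow multi_hermite c F (t, x))" "exp_bounded (\<lambda>x. flow (hermite_d i) c F (t, x))"
  "exp_bounded (\<lambda>x. flow (hermite_dd i) c F (t, x))"
  by (intro exp_bounded_slice exp_bounded_intros)+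

lemma flow_eq_hermite_sum:
  "flow multi_hermite c F (t, x) = hermite_sum (\<lambda>\<alpha>. c \<alpha> * exp (- (real (multi_degree \<alpha>) / 2) * t)) F x"
  by (simp add: flow_def hermite_sum_def mult.assoc)

lemma DERIV_flow:
  assumes "\<And>\<alpha>. ((\<lambda>s. G \<alpha> (x + s *\<^sub>R axis i 1)) has_real_derivative G' \<alpha> x) (at 0)"
  shows "((\<lambda>s. flow G c F (t, x + s *\<^sub>R axis i 1)) has_real_derivative flow G' c F (t, x)) (at 0)"
  unfolding flow_def fst_conv snd_conv by (intro DERIV_sum DERIV_cmult assms)

lemma DERIV_flow_time:
  "((\<lambda>t. flow multi_hermite c F (t, x)) has_real_derivative
     - flow multi_hermite (\<lambda>\<alpha>. real (multi_degree \<alpha>) * c \<alpha>) F (t, x) / 2) (at t)"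
proof -
  have "((\<lambda>t. flow multi_hermite c F (t, x)) has_real_derivative
     (\<Sum>\<alpha>\<in>F. c \<alpha> * (exp (- (real (multi_degree \<alpha>) / 2) * t) * (- (real (multi_degree \<alpha>) / 2)) * multi_hermite \<alpha> x))) (at t)"
    unfolding flow_def fst_conv snd_conv
    by (intro DERIV_sum DERIV_cmult DERIV_cmult_right DERIV_fun_exp DERIV_cmult_Id)
  also have "(\<Sum>\<alpha>\<in>F. c \<alpha> * (exp (- (real (multi_degree \<alpha>) / 2) * t) * (- (real (multi_degree \<alpha>) / 2)) * multi_hermite \<alpha> x))
     = - flow multi_hermite (\<lambda>\<alpha>. real (multi_degree \<alpha>) * c \<alpha>) F (t, x) / 2"
    by (simp add: flow_def sum_negf[symmetric] sum_divide_distrib mult_ac)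
  finally show ?thesis .
qed

lemma flow_eigen:
  "(\<Sum>i\<in>UNIV. x $ i * flow (hermite_d i) c F (t, x) - flow (hermite_dd i) c F (t, x) / 2)
    = flow multi_hermite (\<lambda>\<alpha>. real (multi_degree \<alpha>) * c \<alpha>) F (t, x)"
proof -
  let ?e = "\<lambda>\<alpha>. exp (- (real (multi_degree \<alpha>) / 2) * t)"
  have "(\<Sum>i\<in>UNIV. x $ i * flow (hermite_d i) c F (t, x) - flow (hermite_dd i) c F (t, x) / 2)
     = (\<Sum>i\<in>UNIV. \<Sum>\<alpha>\<in>F. c \<alpha> * ?e \<alpha> * (x $ i * hermite_d i \<alpha> x - hermite_dd i \<alpha> x / 2))"
    by (simp add: flow_def sum_distrib_left sum_divide_distrib sum_subtractf[symmetric] right_diff_distrib mult_ac)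
  also have "\<dots> = (\<Sum>\<alpha>\<in>F. c \<alpha> * ?e \<alpha> * (real (multi_degree \<alpha>) * multi_hermite \<alpha> x))"
    by (subst sum.swap) (simp only: sum_distrib_left[symmetric] hermite_eigen)
  also have "\<dots> = flow multi_hermite (\<lambda>\<alpha>. real (multi_degree \<alpha>) * c \<alpha>) F (t, x)"
    by (simp add: flow_def mult_ac)
  finally show ?thesis .
qed

text \<open>For finite \<open>F\<close>, the pairing of \<open>L e^(- t L)\<close> applied to
  \<open>hermite_sum c F\<close> with \<open>hermite_sum d F\<close>, evaluated by
  orthogonality.\<close>

definition energy :: "(('n::finite \<Rightarrow> nat) \<Rightarrow> real) \<Rightarrow> (('n \<Rightarrow> nat) \<Rightarrow> real) \<Rightarrow> ('n \<Rightarrow> nat) set \<Rightarrow> real \<Rightarrow> real" where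
  "energy c d F t = (\<Sum>\<alpha>\<in>F. real (multi_degree \<alpha>) * exp (- t * real (multi_degree \<alpha>)) * (c \<alpha> * d \<alpha> * hermite_norm2 \<alpha>))"

text \<open>The two half-speed exponentials multiply to the full one. Since \<open>L\<close>
  contains half the Laplacian, integration by parts turns the pairing of \<open>L U\<close> with
  \<open>V\<close> into half the integral of the product of the gradients.\<close>

lemma energy_eq_gradient:
  assumes "finite F"
  shows "2 * energy c d F t
    = (LINT x|gauss. (\<Sum>i\<in>UNIV. flow (hermite_d i) c F (t, x) * flow (hermite_d i) d F (t, x)))"
proof -
  let ?U = "\<lambda>x. flow multi_hermite c F (t, x)" and ?Ui = "\<lambda>i x. flow (hermite_d i) c F (t, x)"
    and ?Uii = "\<lambda>i x. flow (hermite_dd i) c F (t, x)"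
    and ?V = "\<lambda>x. flow multi_hermite d F (t, x)" and ?Vi = "\<lambda>i x. flow (hermite_d i) d F (t, x)"
    and ?LU = "\<lambda>x. flow multi_hermite (\<lambda>\<alpha>. real (multi_degree \<alpha>) * c \<alpha>) F (t, x)"
  have ibp: "(LINT x|gauss. ?Ui i x * ?Vi i x) = (LINT x|gauss. ?V x * (2 * (x $ i * ?Ui i x - ?Uii i x / 2)))" for i
  proof -
    have "(LINT x|gauss. ?Ui i x * ?Vi i x + ?V x * ?Uii i x) = (LINT x|gauss. 2 * x $ i * (?V x * ?Ui i x))"
    proof (rule gauss_integral_by_parts)
      fix x
      have V: "((\<lambda>s. ?V (x + s *\<^sub>R axis i 1)) has_real_derivative ?Vi i x) (at 0)"
        and Ui: "((\<lambda>s. ?Ui i (x + s *\<^sub>R axis i 1)) has_real_derivative ?Uii i x) (at 0)"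
        by (intro DERIV_flow DERIV_multi_hermite DERIV_hermite_d)+
      show "((\<lambda>s. ?V (x + s *\<^sub>R axis i 1) * ?Ui i (x + s *\<^sub>R axis i 1)) has_real_derivative
          ?Ui i x * ?Vi i x + ?V x * ?Uii i x) (at 0)"
        using DERIV_mult[OF V Ui] by (simp add: mult.commute)
    qed (intro exp_bounded_intros)+
    also have "(LINT x|gauss. ?Ui i x * ?Vi i x + ?V x * ?Uii i x) = (LINT x|gauss. ?Ui i x * ?Vi i x) + (LINT x|gauss. ?V x * ?Uii i x)"
      by (intro Bochner_Integration.integral_add integrable_gauss_exp_bounded exp_bounded_intros)
    finally have "(LINT x|gauss. ?Ui i x * ?Vi i x)
       = (LINT x|gauss. 2 * x $ i * (?V x * ?Ui i x)) - (LINT x|gauss. ?V x * ?Uii i x)" by linarith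
    also have "\<dots> = (LINT x|gauss. 2 * x $ i * (?V x * ?Ui i x) - ?V x * ?Uii i x)"
      by (intro Bochner_Integration.integral_diff[symmetric] integrable_gauss_exp_bounded exp_bounded_intros)
    finally show ?thesis by (simp add: algebra_simps)
  qed
  have "(LINT x|gauss. (\<Sum>i\<in>UNIV. ?Ui i x * ?Vi i x)) = (\<Sum>i\<in>UNIV. LINT x|gauss. ?Ui i x * ?Vi i x)"
    by (intro Bochner_Integration.integral_sum integrable_gauss_exp_bounded exp_bounded_intros)
  also have "\<dots> = (LINT x|gauss. (\<Sum>i\<in>UNIV. ?V x * (2 * (x $ i * ?Ui i x - ?Uii i x / 2))))"
    unfolding ibp
    by (intro Bochner_Integration.integral_sum[symmetric] integrable_gauss_exp_bounded exp_bounded_intros)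
  also have "\<dots> = (LINT x|gauss. 2 * (?LU x * ?V x))"
    unfolding flow_eigen[symmetric] by (simp only: sum_distrib_left sum_distrib_right mult_ac)
  also have "\<dots> = 2 * (LINT x|gauss. ?LU x * ?V x)" by simp
  also have "(LINT x|gauss. ?LU x * ?V x) = energy c d F t"
  proof -
    have "exp (- (real k / 2) * t) * exp (- (real k / 2) * t) = exp (- t * real k)" for k
      by (simp add: exp_add[symmetric])
    then show ?thesis
      unfolding flow_eq_hermite_sum integral_hermite_sum[OF assms] energy_def
      by (intro sum.cong refl) (metis (no_types, opaque_lifting) mult.assoc mult.commute mult.left_commute)
  qed
  finally show ?thesis by simp
qed

section \<open>Decay of the Bellman functional along the flow\<close>

context bellman
begin

text \<open>Minus twice the time derivative of \<open>Q (U, V)\<close> at a fixed point; the factor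
  2 compensates the half speed of the flow.\<close>

definition dissipation :: "(('n::finite \<Rightarrow> nat) \<Rightarrow> real) \<Rightarrow> (('n \<Rightarrow> nat) \<Rightarrow> real) \<Rightarrow> ('n \<Rightarrow> nat) set
    \<Rightarrow> real \<times> (real ^ 'n) \<Rightarrow> real" where
  "dissipation c d F z =
     Qz (flow multi_hermite c F z) (flow multi_hermite d F z)
       * flow multi_hermite (\<lambda>\<alpha>. real (multi_degree \<alpha>) * c \<alpha>) F z
   + Qe (flow multi_hermite c F z) (flow multi_hermite d F z)
       * flow multi_hermite (\<lambda>\<alpha>. real (multi_degree \<alpha>) * d \<alpha>) F z"

lemma exp_bounded_dissipation [exp_bounded_intros]:
  "exp_bounded (dissipation c d F)" "exp_bounded (\<lambda>x. dissipation c d F (t, x))"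
  unfolding dissipation_def[abs_def] by (intro exp_bounded_intros)+

text \<open>Integration by parts moves one derivative of \<open>L\<close> onto \<open>Qz\<close> and
  \<open>Qe\<close> and produces half the Hessian form, evaluated at the partial derivatives of
  \<open>U\<close> and \<open>V\<close>. Its pointwise lower bound involves the products of these
  derivatives, and the sum of the products integrates to twice the energy.\<close>

lemma dissipation_ge:
  assumes "finite F"
  shows "(p - 1)\<^sup>2 / 4 * \<bar>energy c d F t\<bar> \<le> (LINT x|gauss. dissipation c d F (t, x))"
proof -
  let ?U = "\<lambda>x. flow multi_hermite c F (t, x)" and ?Ui = "\<lambda>i x. flow (hermite_d i) c F (t, x)"
    and ?Uii = "\<lambda>i x. flow (hermite_dd i) c F (t, x)"
    and ?V = "\<lambda>x. flow multi_hermite d F (t, x)" and ?Vi = "\<lambda>i x. flow (hermite_d i) d F (t, x)"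
    and ?Vii = "\<lambda>i x. flow (hermite_dd i) d F (t, x)"
  let ?z = "\<lambda>x. Qz (?U x) (?V x)" and ?e = "\<lambda>x. Qe (?U x) (?V x)"
  let ?H = "\<lambda>i x. Qzz (?U x) (?V x) * (?Ui i x)\<^sup>2 + 2 * Qze (?U x) (?V x) * ?Ui i x * ?Vi i x
      + Qee (?U x) (?V x) * (?Vi i x)\<^sup>2"
  let ?D = "\<lambda>i x. ?z x * ?Uii i x + ?e x * ?Vii i x"
  \<comment> \<open>\<open>?G i\<close> is the \<open>i\<close>-th derivative of
    \<open>Q (U, V)\<close>; hence \<open>?H i + ?D i\<close> is its pure second derivative.\<close>
  let ?G = "\<lambda>i x. ?z x * ?Ui i x + ?e x * ?Vi i x"
  have ibp: "(LINT x|gauss. ?H i x) = (LINT x|gauss. 2 * (?z x * (x $ i * ?Ui i x - ?Uii i x / 2) + ?e x * (x $ i * ?Vi i x - ?Vii i x / 2)))" for i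
  proof -
    have "(LINT x|gauss. ?H i x + ?D i x) = (LINT x|gauss. 2 * x $ i * ?G i x)"
    proof (rule gauss_integral_by_parts)
      fix x
      have U: "((\<lambda>s. ?U (x + s *\<^sub>R axis i 1)) has_real_derivative ?Ui i x) (at 0)"
        and V: "((\<lambda>s. ?V (x + s *\<^sub>R axis i 1)) has_real_derivative ?Vi i x) (at 0)"
        and Ui: "((\<lambda>s. ?Ui i (x + s *\<^sub>R axis i 1)) has_real_derivative ?Uii i x) (at 0)"
        and Vi: "((\<lambda>s. ?Vi i (x + s *\<^sub>R axis i 1)) has_real_derivative ?Vii i x) (at 0)"
        by (intro DERIV_flow DERIV_multi_hermite DERIV_hermite_d)+
      show "((\<lambda>s. ?G i (x + s *\<^sub>R axis i 1)) has_real_derivative ?H i x + ?D i x) (at 0)"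
        using DERIV_add[OF DERIV_mult[OF DERIV_Qz[OF U V] Ui] DERIV_mult[OF DERIV_Qe[OF U V] Vi]]
        by (rule DERIV_cong) (simp add: power2_eq_square algebra_simps)
    qed (intro exp_bounded_intros)+
    also have "(LINT x|gauss. ?H i x + ?D i x) = (LINT x|gauss. ?H i x) + (LINT x|gauss. ?D i x)"
      by (intro Bochner_Integration.integral_add integrable_gauss_exp_bounded exp_bounded_intros)
    finally have "(LINT x|gauss. ?H i x) = (LINT x|gauss. 2 * x $ i * ?G i x) - (LINT x|gauss. ?D i x)" by linarith
    also have "\<dots> = (LINT x|gauss. 2 * x $ i * ?G i x - ?D i x)"
      by (intro Bochner_Integration.integral_diff[symmetric] integrable_gauss_exp_bounded exp_bounded_intros)
    also have "\<dots> = (LINT x|gauss. 2 * (?z x * (x $ i * ?Ui i x - ?Uii i x / 2) + ?e x * (x $ i * ?Vi i x - ?Vii i x / 2)))"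
      by (rule Bochner_Integration.integral_cong[OF refl]) (simp add: algebra_simps)
    finally show ?thesis .
  qed
  have "(p - 1)\<^sup>2 / 4 * \<bar>2 * energy c d F t\<bar>
      = \<bar>LINT x|gauss. (p - 1)\<^sup>2 / 4 * (\<Sum>i\<in>UNIV. ?Ui i x * ?Vi i x)\<bar>"
    unfolding energy_eq_gradient[OF assms] by (simp add: abs_mult)
  also have "\<dots> \<le> (LINT x|gauss. \<bar>(p - 1)\<^sup>2 / 4 * (\<Sum>i\<in>UNIV. ?Ui i x * ?Vi i x)\<bar>)"
    by (rule integral_abs_bound)
  also have "\<dots> \<le> (LINT x|gauss. (\<Sum>i\<in>UNIV. ?H i x))"
  proof (rule integral_mono)
    fix x
    have "\<bar>(p - 1)\<^sup>2 / 4 * (\<Sum>i\<in>UNIV. ?Ui i x * ?Vi i x)\<bar> \<le> (p - 1)\<^sup>2 / 4 * (\<Sum>i\<in>UNIV. \<bar>?Ui i x * ?Vi i x\<bar>)"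
      unfolding abs_mult by (intro mult_mono sum_abs[THEN order_trans]) (auto simp: abs_mult)
    also have "\<dots> \<le> (\<Sum>i\<in>UNIV. ?H i x)"
      unfolding sum_distrib_left by (intro sum_mono hessian_ge)
    finally show "\<bar>(p - 1)\<^sup>2 / 4 * (\<Sum>i\<in>UNIV. ?Ui i x * ?Vi i x)\<bar> \<le> (\<Sum>i\<in>UNIV. ?H i x)" .
  qed (intro integrable_gauss_exp_bounded exp_bounded_intros)+
  also have "\<dots> = (\<Sum>i\<in>UNIV. LINT x|gauss. ?H i x)"
    by (intro Bochner_Integration.integral_sum integrable_gauss_exp_bounded exp_bounded_intros)
  also have "\<dots> = (LINT x|gauss. (\<Sum>i\<in>UNIV. 2 * (?z x * (x $ i * ?Ui i x - ?Uii i x / 2) + ?e x * (x $ i * ?Vi i x - ?Vii i x / 2))))"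
    unfolding ibp
    by (intro Bochner_Integration.integral_sum[symmetric] integrable_gauss_exp_bounded exp_bounded_intros)
  also have "\<dots> = (LINT x|gauss. 2 * dissipation c d F (t, x))"
    unfolding dissipation_def flow_eigen[symmetric] by (simp only: sum_distrib_left sum.distrib distrib_left)
  also have "\<dots> = 2 * (LINT x|gauss. dissipation c d F (t, x))" by simp
  finally show ?thesis by (simp add: abs_mult mult.commute)
qed

text \<open>The dissipation integrates in time to the loss of the functional, and the functional at
  time \<open>T\<close> is dropped as nonnegative. The resulting bound is independent of
  \<open>T\<close>.\<close>

lemma integral_energy_le:
  fixes c d :: "('n::finite \<Rightarrow> nat) \<Rightarrow> real"
  assumes F: "finite F" and T: "0 \<le> T"
  shows "(p - 1)\<^sup>2 / 8 * (LINT t|lborel. indicator {0..T} t * \<bar>energy c d F t\<bar>)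
    \<le> (LINT x|gauss. Q (hermite_sum c F x) (hermite_sum d F x))"
proof -
  let ?Q = "\<lambda>t x. Q (flow multi_hermite c F (t, x)) (flow multi_hermite d F (t, x))"
  let ?f = "\<lambda>t x. indicator {0..T} t * (dissipation c d F (t, x) / 2)"
  interpret pair_sigma_finite lborel "gauss :: (real^'n) measure" ..
  have FTC: "(LINT t|lborel. ?f t x) = ?Q 0 x - ?Q T x" for x
  proof -
    have "(LINT t|lborel. indicator {0..T} t *\<^sub>R (dissipation c d F (t, x) / 2)) = (- ?Q T x) - (- ?Q 0 x)"
    proof (rule integral_FTC_atLeastAtMost[OF T])
      fix t
      have "((\<lambda>t. - ?Q t x) has_real_derivative dissipation c d F (t, x) / 2) (at t)"
        using DERIV_minus[OF DERIV_Q[OF DERIV_flow_time[of c F x t] DERIV_flow_time[of d F x t]]]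
        by (rule DERIV_cong) (simp add: dissipation_def field_simps)
      then show "((\<lambda>t. - ?Q t x) has_vector_derivative dissipation c d F (t, x) / 2) (at t within {0..T})"
        by (auto simp: has_real_derivative_iff_has_vector_derivative intro: has_vector_derivative_at_within)
    next
      have "continuous_on {0..T} (\<lambda>t. dissipation c d F (t, x))"
        by (rule continuous_on_compose2[OF exp_bounded_continuous[OF exp_bounded_dissipation(1), of UNIV]])
          (auto intro: continuous_intros)
      then show "continuous_on {0..T} (\<lambda>t. dissipation c d F (t, x) / 2)"
        by (intro continuous_intros) auto
    qed
    then show ?thesis by simp
  qed
  obtain A where A: "A \<ge> 0" "\<And>t x. \<bar>t\<bar> \<le> T \<Longrightarrow> \<bar>dissipation c d F (t, x)\<bar> \<le> A * exp (A * norm x)"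
    using exp_bounded_slice_uniform[OF exp_bounded_dissipation(1), of T c d F] by metis
  have expA: "exp_bounded (\<lambda>x::real^'n. A * exp (A * norm x))"
    using A(1) by (intro exp_boundedI[of _ A A] continuous_intros) auto
  have [measurable]: "dissipation c d F \<in> borel_measurable (lborel \<Otimes>\<^sub>M gauss)"
    using borel_measurable_exp_bounded[OF exp_bounded_dissipation(1), of c d F]
    by (simp add: measurable_cong_sets[OF sets_pair_measure_cong[OF sets_lborel sets_gauss] refl] borel_prod)
  have int: "integrable (lborel \<Otimes>\<^sub>M gauss) (case_prod ?f)"
  proof (rule Bochner_Integration.integrable_bound)
    show "integrable (lborel \<Otimes>\<^sub>M gauss) (\<lambda>(t, x::real^'n). indicator {0..T} t * (A * exp (A * norm x)))"
    proof (rule Fubini_integrable)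
      show "(\<lambda>(t, x::real^'n). indicator {0..T} t * (A * exp (A * norm x))) \<in> borel_measurable (lborel \<Otimes>\<^sub>M gauss)"
        by measurable
      have "(LINT x|gauss. norm (indicator {0..T} t * (A * exp (A * norm (x::real^'n)))))
         = indicator {0..T} t * (LINT x|gauss. A * exp (A * norm (x::real^'n)))" for t
        using A(1) by (simp add: abs_mult)
      then show "integrable lborel (\<lambda>t. LINT x|gauss. norm (case (t, x) of (t, x::real^'n) \<Rightarrow> indicator {0..T} t * (A * exp (A * norm x))))"
        by (simp only: prod.case) (intro integrable_mult_left integrable_real_indicator; simp add: T)
      show "AE t in lborel. integrable gauss (\<lambda>x. case (t, x) of (t, x::real^'n) \<Rightarrow> indicator {0..T} t * (A * exp (A * norm x)))"
        unfolding prod.case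
        by (intro always_eventually allI integrable_mult_right integrable_gauss_exp_bounded[OF expA])
    qed
    show "case_prod ?f \<in> borel_measurable (lborel \<Otimes>\<^sub>M gauss)" by measurable
    show "AE z in lborel \<Otimes>\<^sub>M gauss. norm (case_prod ?f z)
        \<le> norm ((\<lambda>(t, x::real^'n). indicator {0..T} t * (A * exp (A * norm x))) z)"
    proof (intro always_eventually allI)
      fix z :: "real \<times> (real^'n)"
      obtain t x where z: "z = (t, x)" by (cases z)
      show "norm (case_prod ?f z) \<le> norm ((\<lambda>(t, x::real^'n). indicator {0..T} t * (A * exp (A * norm x))) z)"
        using A(2)[of t x] A(1) by (auto simp: z indicator_def abs_mult)
    qed
  qed
  have "(LINT x|gauss. ?Q 0 x - ?Q T x) = (LINT t|lborel. LINT x|gauss. ?f t x)"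
    using Fubini_integral[OF int] by (simp only: FTC)
  moreover have "(LINT x|gauss. ?Q 0 x - ?Q T x) = (LINT x|gauss. ?Q 0 x) - (LINT x|gauss. ?Q T x)"
    by (intro Bochner_Integration.integral_diff integrable_gauss_exp_bounded exp_bounded_intros)
  moreover have "0 \<le> (LINT x|gauss. ?Q T x)"
    by (intro Bochner_Integration.integral_nonneg Q_nonneg)
  moreover have "(LINT t|lborel. (p - 1)\<^sup>2 / 8 * (indicator {0..T} t * \<bar>energy c d F t\<bar>)) \<le> (LINT t|lborel. LINT x|gauss. ?f t x)"
  proof (rule integral_mono)
    show "integrable lborel (\<lambda>t. LINT x|gauss. ?f t x)"
      using integrable_fst[OF int] by simp
    have "continuous_on {0..T} (\<lambda>t. \<bar>energy c d F t\<bar>)"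
      unfolding energy_def by (intro continuous_intros)
    from borel_integrable_compact[OF _ this]
    show "integrable lborel (\<lambda>t. (p - 1)\<^sup>2 / 8 * (indicator {0..T} t * \<bar>energy c d F t\<bar>))"
      by (intro integrable_mult_right) simp
    fix t :: real
    show "(p - 1)\<^sup>2 / 8 * (indicator {0..T} t * \<bar>energy c d F t\<bar>) \<le> (LINT x|gauss. ?f t x)"
      using dissipation_ge[OF F, of c d t] by (simp add: indicator_def mult.commute)
  qed
  ultimately show ?thesis by (simp add: flow_eq_hermite_sum)
qed

end

subsection \<open>Duality against polynomials\<close>

text \<open>One majorant \<open>D\<close> of exponential growth dominates both
  \<open>g * W k\<close> and, through its \<open>q\<close>-th power, the powers of
  \<open>W k\<close>; dominated convergence then acts on both sides.\<close>

lemma duality_inequality_limit: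
  fixes g w D :: "real^'n \<Rightarrow> real"
  assumes g: "exp_bounded g" and D: "exp_bounded D" and q: "0 < q"
    and meas: "\<And>k. W k \<in> borel_measurable borel"
    and bound: "\<And>k x. \<bar>W k x\<bar> \<le> D x"
    and lim: "\<And>x. (\<lambda>k. W k x) \<longlonglongrightarrow> w x"
    and ineq: "\<And>k. \<bar>LINT x|gauss. g x * W k x\<bar> \<le> A + K * (LINT x|gauss. \<bar>W k x\<bar> powr q)"
  shows "\<bar>LINT x|gauss. g x * w x\<bar> \<le> A + K * (LINT x|gauss. \<bar>w x\<bar> powr q)"
proof -
  note [measurable] = meas borel_measurable_exp_bounded[OF g]
  have [measurable]: "w \<in> borel_measurable borel"
    using lim meas by (rule borel_measurable_LIMSEQ_real)
  have D0: "0 \<le> D x" for x using bound[of 0 x] by linarith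
  have 1: "(\<lambda>k. LINT x|gauss. g x * W k x) \<longlonglongrightarrow> (LINT x|gauss. g x * w x)"
  proof (rule integral_dominated_convergence)
    show "integrable gauss (\<lambda>x. \<bar>g x\<bar> * D x)"
      by (intro integrable_gauss_exp_bounded exp_bounded_intros g D)
    show "AE x in gauss. norm (g x * W k x) \<le> \<bar>g x\<bar> * D x" for k
      using bound by (auto simp: abs_mult intro!: mult_left_mono)
    show "AE x in gauss. (\<lambda>k. g x * W k x) \<longlonglongrightarrow> g x * w x"
      by (intro always_eventually allI tendsto_intros lim)
  qed measurable
  have 2: "(\<lambda>k. LINT x|gauss. \<bar>W k x\<bar> powr q) \<longlonglongrightarrow> (LINT x|gauss. \<bar>w x\<bar> powr q)"
  proof (rule integral_dominated_convergence)
    show "integrable gauss (\<lambda>x. D x powr q)"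
      by (intro integrable_gauss_exp_bounded exp_bounded_powr_pos D D0 q)
    show "AE x in gauss. norm (\<bar>W k x\<bar> powr q) \<le> D x powr q" for k
      using bound q by (auto intro!: powr_mono2)
    show "AE x in gauss. (\<lambda>k. \<bar>W k x\<bar> powr q) \<longlonglongrightarrow> \<bar>w x\<bar> powr q"
      using q by (intro always_eventually allI tendsto_powr' tendsto_rabs lim tendsto_const) auto
  qed measurable
  show ?thesis
    by (rule LIMSEQ_le[OF tendsto_rabs[OF 1] tendsto_add[OF tendsto_const tendsto_mult[OF tendsto_const 2]]])
      (use ineq in auto)
qed

text \<open>Exponential growth would be too weak here: the polynomial gets composed with maps of
  exponential growth, and only a power bound keeps the composition within single exponential
  growth.\<close>

lemma real_polynomial_function_growth:
  fixes h :: "'a::real_normed_vector \<Rightarrow> real"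
  assumes "real_polynomial_function h"
  shows "\<exists>C N. 0 \<le> C \<and> (\<forall>y. \<bar>h y\<bar> \<le> C * (1 + norm y) ^ N)"
  using assms
proof induction
  case (linear h)
  obtain K where K: "\<And>x. norm (h x) \<le> norm x * K" "K > 0"
    using bounded_linear.pos_bounded[OF linear] by auto
  have "\<bar>h y\<bar> \<le> K * (1 + norm y) ^ 1" for y
    using K(1)[of y] K(2) by (simp add: algebra_simps)
  with K(2) show ?case by (meson less_imp_le)
next
  case (const c)
  have "\<bar>c\<bar> \<le> \<bar>c\<bar> * (1 + norm y) ^ 0" for y :: 'a by simp
  then show ?case by (meson abs_ge_zero)
next
  case (add f g)
  then obtain C N D M where *: "0 \<le> C" "0 \<le> D" "\<And>y. \<bar>f y\<bar> \<le> C * (1 + norm y) ^ N"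
    "\<And>y. \<bar>g y\<bar> \<le> D * (1 + norm y) ^ M" by blast
  have "\<bar>f y + g y\<bar> \<le> (C + D) * (1 + norm y) ^ (N + M)" for y
  proof -
    have "C * (1 + norm y) ^ N \<le> C * (1 + norm y) ^ (N + M)"
      "D * (1 + norm y) ^ M \<le> D * (1 + norm y) ^ (N + M)"
      using * by (auto intro!: mult_left_mono power_increasing)
    with *(3)[of y] *(4)[of y] show ?thesis by (simp add: distrib_right)
  qed
  with * show ?case by (meson add_nonneg_nonneg)
next
  case (mult f g)
  then obtain C N D M where *: "0 \<le> C" "0 \<le> D" "\<And>y. \<bar>f y\<bar> \<le> C * (1 + norm y) ^ N"
    "\<And>y. \<bar>g y\<bar> \<le> D * (1 + norm y) ^ M" by blast
  have "\<bar>f y * g y\<bar> \<le> (C * D) * (1 + norm y) ^ (N + M)" for y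
  proof -
    have "\<bar>f y * g y\<bar> \<le> (C * (1 + norm y) ^ N) * (D * (1 + norm y) ^ M)"
      unfolding abs_mult using * by (intro mult_mono) auto
    then show ?thesis by (simp add: power_add mult_ac)
  qed
  with * show ?case by (meson mult_nonneg_nonneg)
qed

text \<open>
  A Stone--Weierstrass approximant on a cube is not controlled outside it. Composed with
  \<open>sin (x $ i / k)\<close> it stays bounded on the whole space, and the Taylor polynomials of the sine
  lead back to polynomials with a common exponential majorant.
\<close>

definition sin_taylor :: "nat \<Rightarrow> real \<Rightarrow> real" where
  "sin_taylor m s = (\<Sum>j<m. sin_coeff j * s ^ j)"

lemma sin_taylor_tendsto: "(\<lambda>m. sin_taylor m s) \<longlonglongrightarrow> sin s"
  using sin_converges[of s] by (simp add: sums_def sin_taylor_def)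

text \<open>Termwise comparison with the exponential series, which makes the bound uniform in the
  degree \<open>m\<close>.\<close>

lemma sin_taylor_le: "\<bar>sin_taylor m s\<bar> \<le> exp \<bar>s\<bar>"
proof -
  have "\<bar>sin_taylor m s\<bar> \<le> (\<Sum>j<m. \<bar>sin_coeff j * s ^ j\<bar>)"
    unfolding sin_taylor_def by (rule sum_abs)
  also have "\<dots> \<le> (\<Sum>j<m. \<bar>s\<bar> ^ j /\<^sub>R fact j)"
    by (intro sum_mono) (auto simp: sin_coeff_def abs_mult power_abs divide_inverse)
  also have "\<dots> \<le> (\<Sum>j. \<bar>s\<bar> ^ j /\<^sub>R fact j)"
    by (intro sum_le_suminf summable_exp_generic) auto
  also have "\<dots> = exp \<bar>s\<bar>" by (simp add: exp_def)
  finally show ?thesis .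
qed

section \<open>From polynomial test functions to all continuous ones of exponential growth\<close>

context
  fixes g :: "real^'n \<Rightarrow> real" and A K q :: real
  assumes g: "exp_bounded g" and q: "0 < q"
    and ineq: "\<And>v. real_polynomial_function v \<Longrightarrow>
      \<bar>LINT x|gauss. g x * v x\<bar> \<le> A + K * (LINT x|gauss. \<bar>v x\<bar> powr q)"
begin

lemma duality_inequality_trig:
  assumes h: "real_polynomial_function (h :: real^'n \<Rightarrow> real)"
  shows "\<bar>LINT x|gauss. g x * h (\<chi> i. sin (x $ i * r))\<bar>
    \<le> A + K * (LINT x|gauss. \<bar>h (\<chi> i. sin (x $ i * r))\<bar> powr q)"
proof -
  obtain C N where C: "0 \<le> C" "\<And>y. \<bar>h y\<bar> \<le> C * (1 + norm y) ^ N"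
    using real_polynomial_function_growth[OF h] by blast
  have h_cont: "isCont h y" for y
    using continuous_real_polymonial_function[OF h] by (simp add: continuous_on_eq_continuous_at)
  let ?W = "\<lambda>m x. h (\<chi> i. sin_taylor m (x $ i * r))"
  \<comment> \<open>The norm of the Taylor vector is bounded by the sum of its coordinates, each at
    most one exponential; the power comes from the growth of \<open>h\<close>.\<close>
  let ?D = "\<lambda>x::real^'n. C * (1 + real CARD('n) * exp (\<bar>r\<bar> * norm x)) ^ N"
  have poly: "real_polynomial_function (?W m)" for m
  proof -
    have "polynomial_function (\<lambda>x::real^'n. \<chi> i. sin_taylor m (x $ i * r))"
      unfolding polynomial_function_iff_Basis_inner
    proof
      fix b :: "real^'n" assume "b \<in> Basis"
      then obtain i where b: "b = axis i 1" by (auto simp: Basis_vec_def)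
      show "real_polynomial_function (\<lambda>x::real^'n. (\<chi> i. sin_taylor m (x $ i * r)) \<bullet> b)"
        unfolding b sin_taylor_def
        by (simp add: inner_axis) (intro real_polynomial_function_sum real_polynomial_function.intros
            real_polynomial_function_power bounded_linear_vec_nth finite_lessThan)
    qed
    from real_polynomial_function_compose[OF this h] show ?thesis by (simp add: o_def)
  qed
  have expr: "exp_bounded (\<lambda>x::real^'n. exp (\<bar>r\<bar> * norm x))"
    by (intro exp_boundedI[of _ 1 "\<bar>r\<bar>"] continuous_intros) auto
  show ?thesis
  proof (rule duality_inequality_limit[of g ?D, where W = ?W])
    show "exp_bounded ?D" by (intro exp_bounded_intros expr)
    show "?W m \<in> borel_measurable borel" for m
      using continuous_real_polymonial_function[OF poly]
      by (intro borel_measurable_continuous_onI) (simp add: continuous_on_eq_continuous_at)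
    show "\<bar>?W m x\<bar> \<le> ?D x" for m x
    proof -
      have "norm (\<chi> i. sin_taylor m (x $ i * r)) \<le> (\<Sum>i\<in>UNIV. \<bar>sin_taylor m (x $ i * r)\<bar>)"
        using norm_le_l1_cart[of "\<chi> i. sin_taylor m (x $ i * r)"] by simp
      also have "\<dots> \<le> (\<Sum>i\<in>(UNIV::'n set). exp (\<bar>r\<bar> * norm x))"
      proof (intro sum_mono)
        fix i
        have "\<bar>sin_taylor m (x $ i * r)\<bar> \<le> exp \<bar>x $ i * r\<bar>" by (rule sin_taylor_le)
        also have "\<dots> \<le> exp (\<bar>r\<bar> * norm x)"
          using mult_left_mono[OF component_le_norm_cart[of x i], of "\<bar>r\<bar>"]
            by (simp add: abs_mult mult.commute)
        finally show "\<bar>sin_taylor m (x $ i * r)\<bar> \<le> exp (\<bar>r\<bar> * norm x)" .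
      qed
      finally have "norm (\<chi> i. sin_taylor m (x $ i * r)) \<le> real CARD('n) * exp (\<bar>r\<bar> * norm x)" by simp
      then have "C * (1 + norm (\<chi> i. sin_taylor m (x $ i * r))) ^ N \<le> ?D x"
        using C(1) by (intro mult_left_mono power_mono) auto
      with C(2) show ?thesis by (rule order_trans)
    qed
    show "(\<lambda>m. ?W m x) \<longlonglongrightarrow> h (\<chi> i. sin (x $ i * r))" for x
      by (rule isCont_tendsto_compose[OF h_cont]) (intro tendsto_vec_lambda sin_taylor_tendsto)
    show "\<bar>LINT x|gauss. g x * ?W m x\<bar> \<le> A + K * (LINT x|gauss. \<bar>?W m x\<bar> powr q)" for m
      by (rule ineq[OF poly])
  qed (fact g q)+
qed

text \<open>The substitution \<open>x_i = (k + 1) arcsin y_i\<close> moves \<open>h\<close> to a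
  cube, where polynomials approximate it uniformly. Going back by
  \<open>y_i = sin (x_i / (k + 1))\<close> recovers \<open>h x\<close> once
  \<open>norm x \<le> k + 1\<close>, since then no argument leaves the range where
  \<open>arcsin\<close> inverts \<open>sin\<close>. For all other \<open>x\<close> the sines still
  lie in the cube, so \<open>B + 1\<close> bounds the approximants everywhere.\<close>

lemma duality_inequality_bounded:
  fixes h :: "real^'n \<Rightarrow> real"
  assumes cont: "continuous_on UNIV h" and B: "\<And>x. \<bar>h x\<bar> \<le> B"
  shows "\<bar>LINT x|gauss. g x * h x\<bar> \<le> A + K * (LINT x|gauss. \<bar>h x\<bar> powr q)"
proof -
  let ?cube = "{y::real^'n. \<forall>i. y $ i \<in> {-1..1}}"
  have cube: "compact ?cube"
  proof -
    have "?cube = cbox (\<chi> i. -1) (\<chi> i. 1)" by (auto simp: mem_box_cart)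
    then show ?thesis by simp
  qed
  have "\<exists>G. real_polynomial_function G \<and> (\<forall>y\<in>?cube. \<bar>h (\<chi> i. real (Suc k) * arcsin (y $ i)) - G y\<bar> < 1 / real (Suc k))" for k
  proof -
    have "continuous_on ?cube (\<lambda>y. h (\<chi> i. real (Suc k) * arcsin (y $ i)))"
      by (rule continuous_on_compose2[OF cont]) (auto intro!: continuous_intros)
    then obtain G where "real_polynomial_function G"
      "\<And>y. y \<in> ?cube \<Longrightarrow> \<bar>h (\<chi> i. real (Suc k) * arcsin (y $ i)) - G y\<bar> < 1 / real (Suc k)"
      by (rule Stone_Weierstrass_real_polynomial_function[OF cube, where e = "1 / real (Suc k)"]) simp_all
    then show ?thesis by blast
  qed
  then obtain G where G: "\<And>k. real_polynomial_function (G k)"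
    "\<And>k y. y \<in> ?cube \<Longrightarrow> \<bar>h (\<chi> i. real (Suc k) * arcsin (y $ i)) - G k y\<bar> < 1 / real (Suc k)" by metis
  let ?s = "\<lambda>k x. \<chi> i. sin (x $ i * (1 / real (Suc k)))"
  have s: "?s k x \<in> ?cube" for k and x :: "real^'n" by auto
  show ?thesis
  proof (rule duality_inequality_limit[of g "\<lambda>_. B + 1", where W = "\<lambda>k x. G k (?s k x)"])
    show "(\<lambda>x. G k (?s k x)) \<in> borel_measurable borel" for k
    proof (intro borel_measurable_continuous_onI)
      have "continuous_on UNIV (G k)"
        using continuous_real_polymonial_function[OF G(1)] by (simp add: continuous_on_eq_continuous_at)
      then show "continuous_on UNIV (\<lambda>x. G k (?s k x))"
        by (rule continuous_on_compose2) (auto intro!: continuous_intros)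
    qed
    show "\<bar>G k (?s k x)\<bar> \<le> B + 1" for k x
    proof -
      have "1 / real (Suc k) \<le> 1" by simp
      with G(2)[OF s[of x k], of k] B[of "\<chi> i. real (Suc k) * arcsin (?s k x $ i)"] show ?thesis by linarith
    qed
    show "(\<lambda>k. G k (?s k x)) \<longlonglongrightarrow> h x" for x
    proof (rule Lim_transform_eventually)
      have "(\<lambda>k. G k (?s k x) - h x) \<longlonglongrightarrow> 0"
      proof (rule Lim_null_comparison)
        show "eventually (\<lambda>k. norm (G k (?s k x) - h x) \<le> 1 / real (Suc k)) sequentially"
          using eventually_ge_at_top[of "nat \<lceil>norm x\<rceil>"]
        proof eventually_elim
          case (elim k)
          have "norm x \<le> real (Suc k)" using elim by linarith
          have "real (Suc k) * arcsin (sin (x $ i * (1 / real (Suc k)))) = x $ i" for i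
          proof -
            have "\<bar>x $ i\<bar> \<le> real (Suc k)"
              using component_le_norm_cart[of x i] \<open>norm x \<le> real (Suc k)\<close> by linarith
            then have "\<bar>x $ i * (1 / real (Suc k))\<bar> \<le> 1" by (simp add: abs_mult field_simps)
            then have "\<bar>x $ i * (1 / real (Suc k))\<bar> \<le> pi / 2" using pi_gt3 by linarith
            then have "arcsin (sin (x $ i * (1 / real (Suc k)))) = x $ i * (1 / real (Suc k))"
              by (intro arcsin_sin) linarith+
            then show ?thesis by (simp del: of_nat_Suc)
          qed
          then have "(\<chi> i. real (Suc k) * arcsin (?s k x $ i)) = x" by (simp add: vec_eq_iff del: of_nat_Suc)
          with G(2)[OF s[of x k], of k] show ?case by (simp add: abs_minus_commute del: of_nat_Suc)
        qed
        show "(\<lambda>k. 1 / real (Suc k)) \<longlonglongrightarrow> 0" using LIMSEQ_inverse_real_of_nat by (simp add: inverse_eq_divide)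
      qed
      from tendsto_add[OF this tendsto_const[of "h x"]] show "(\<lambda>k. G k (?s k x) - h x + h x) \<longlonglongrightarrow> h x" by simp
    qed simp
    show "\<bar>LINT x|gauss. g x * G k (?s k x)\<bar> \<le> A + K * (LINT x|gauss. \<bar>G k (?s k x)\<bar> powr q)" for k
      by (rule duality_inequality_trig[OF G(1)])
  qed (fact g q exp_bounded_const)+
qed

text \<open>Truncations at height \<open>k\<close> are bounded, agree with \<open>h x\<close> for
  large \<open>k\<close>, and are dominated by \<open>|h|\<close>.\<close>

lemma duality_inequality_exp_bounded:
  assumes h: "exp_bounded h"
  shows "\<bar>LINT x|gauss. g x * h x\<bar> \<le> A + K * (LINT x|gauss. \<bar>h x\<bar> powr q)"
proof (rule duality_inequality_limit[of g "\<lambda>x. \<bar>h x\<bar>", where W = "\<lambda>k x. max (- real k) (min (real k) (h x))"])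
  show "exp_bounded (\<lambda>x. \<bar>h x\<bar>)" by (intro exp_bounded_intros h)
  have cont: "continuous_on UNIV (\<lambda>x. max (- real k) (min (real k) (h x)))" for k
    by (intro continuous_intros exp_bounded_continuous h)
  then show "(\<lambda>x. max (- real k) (min (real k) (h x))) \<in> borel_measurable borel" for k
    by (rule borel_measurable_continuous_onI)
  show "\<bar>max (- real k) (min (real k) (h x))\<bar> \<le> \<bar>h x\<bar>" for k x by linarith
  show "\<bar>LINT x|gauss. g x * max (- real k) (min (real k) (h x))\<bar>
     \<le> A + K * (LINT x|gauss. \<bar>max (- real k) (min (real k) (h x))\<bar> powr q)" for k
    by (rule duality_inequality_bounded[OF cont, where B = "real k"]) linarith
  show "(\<lambda>k. max (- real k) (min (real k) (h x))) \<longlonglongrightarrow> h x" for x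
  proof (rule tendsto_eventually)
    show "eventually (\<lambda>k. max (- real k) (min (real k) (h x)) = h x) sequentially"
      using eventually_ge_at_top[of "nat \<lceil>\<bar>h x\<bar>\<rceil>"] by eventually_elim linarith
  qed
qed (fact g q)+

end

text \<open>In the application \<open>J\<close> is the \<open>p\<close>-th power of the norm of the
  input and \<open>N\<close> a dilation of that input. Testing with a multiple of
  \<open>N^(p - 1) sgn g |g|^(p - 1)\<close> gives every term the order \<open>N^p\<close> except
  the constant 1.\<close>

lemma (in bellman) norm_bound_from_pairing:
  assumes K: "K > 0" and g: "exp_bounded (g :: real^'n \<Rightarrow> real)"
    and ineq: "\<And>N v. 1 \<le> N \<Longrightarrow> real_polynomial_function v \<Longrightarrow>
      N * \<bar>LINT x|gauss. g x * v x\<bar> \<le> K * (1 + N powr p * J + (LINT x|gauss. \<bar>v x\<bar> powr q))"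
  shows "(LINT x|gauss. \<bar>g x\<bar> powr p) \<le> 2 * K / (1 / (2 * K)) powr (p - 1) * J"
proof -
  \<comment> \<open>Chosen so that \<open>K * \<kappa> powr q = \<kappa> / 2\<close>: the term
    coming from the test function is half of the left side and is absorbed.\<close>
  define \<kappa> where "\<kappa> = (1 / (2 * K)) powr (p - 1)"
  have \<kappa>: "\<kappa> > 0" using K by (simp add: \<kappa>_def)
  have pq: "(p - 1) * q = p" "(p - 1) * (q - 1) = 1" using p_gt_1 by (auto simp: q_def field_simps)
  have "\<kappa> powr q = \<kappa> * \<kappa> powr (q - 1)" using \<kappa> by (simp add: powr_mult_base)
  also have "\<kappa> powr (q - 1) = 1 / (2 * K)" using K pq by (simp add: \<kappa>_def powr_powr)
  finally have \<kappa>q: "\<kappa> powr q = \<kappa> / (2 * K)" by simp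
  \<comment> \<open>This is \<open>sgn g |g|^(p - 1)\<close>, written with the positive and negative
    parts of \<open>g\<close> so that the rule for positive powers of nonnegative functions
    applies.\<close>
  define h where "h x = ((\<bar>g x\<bar> + g x) / 2) powr (p - 1) - ((\<bar>g x\<bar> - g x) / 2) powr (p - 1)" for x
  have h: "exp_bounded h"
    unfolding h_def using p_gt_1 by (intro exp_bounded_intros exp_bounded_powr_pos g) auto
  have gh: "g x * h x = \<bar>g x\<bar> powr p" "\<bar>h x\<bar> = \<bar>g x\<bar> powr (p - 1)" for x
    using powr_mult_base[of "\<bar>g x\<bar>" "p - 1"] by (auto simp: h_def abs_if)
  define I where "I = (LINT x|gauss. \<bar>g x\<bar> powr p)"
  have main: "\<kappa> / 2 * I \<le> K * N powr (- p) + K * J" if N: "1 \<le> N" for N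
  proof -
    let ?c = "\<kappa> * N powr (p - 1)"
    have c: "?c \<ge> 0" using \<kappa> by simp
    have "\<bar>LINT x|gauss. g x * (?c * h x)\<bar>
       \<le> K / N * (1 + N powr p * J) + K / N * (LINT x|gauss. \<bar>?c * h x\<bar> powr q)"
    proof (rule duality_inequality_exp_bounded)
      show "\<bar>LINT x|gauss. g x * v x\<bar> \<le> K / N * (1 + N powr p * J) + K / N * (LINT x|gauss. \<bar>v x\<bar> powr q)"
        if "real_polynomial_function v" for v
      proof -
        have "\<bar>LINT x|gauss. g x * v x\<bar> \<le> K * (1 + N powr p * J + (LINT x|gauss. \<bar>v x\<bar> powr q)) / N"
          using ineq[OF N that] N by (simp add: pos_le_divide_eq mult.commute)
        then show ?thesis by (simp add: add_divide_distrib distrib_left)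
      qed
    qed (use params g h in \<open>auto intro!: exp_bounded_intros\<close>)
    moreover have "(LINT x|gauss. g x * (?c * h x)) = ?c * I"
      by (simp add: I_def mult.left_commute[of "g _"] gh(1)) 
    moreover have "(LINT x|gauss. \<bar>?c * h x\<bar> powr q) = (\<kappa> / (2 * K) * N powr p) * I"
    proof -
      have "\<bar>?c * h x\<bar> powr q = (\<kappa> / (2 * K) * N powr p) * \<bar>g x\<bar> powr p" for x
        using \<kappa> c by (simp add: abs_mult powr_mult gh powr_powr pq \<kappa>q)
      then show ?thesis by (simp add: I_def)
    qed
    moreover have "0 \<le> I" by (simp add: I_def)
    ultimately have "?c * I \<le> K / N * (1 + N powr p * J) + K / N * ((\<kappa> / (2 * K) * N powr p) * I)"
      using c by simp
    \<comment> \<open>A factor \<open>N\<close> has been divided out before, so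
      \<open>N powr (1 - p)\<close> completes the normalization by \<open>N^p\<close>.\<close>
    then have "N powr (1 - p) * (?c * I)
        \<le> N powr (1 - p) * (K / N * (1 + N powr p * J) + K / N * ((\<kappa> / (2 * K) * N powr p) * I))"
      by (intro mult_left_mono) auto
    also have "\<dots> = K * N powr (- p) + K * J + \<kappa> / 2 * I"
    proof -
      have "N powr (1 - p) / N = N powr (- p)" using N by (simp add: powr_diff powr_minus field_simps)
      moreover have "N powr (- p) * N powr p = 1" using N by (simp add: powr_add[symmetric])
      ultimately have *: "N powr (1 - p) / N = N powr (- p)" "N powr (1 - p) / N * N powr p = 1" by simp_all
      have "N powr (1 - p) * (K / N * (1 + N powr p * J) + K / N * ((\<kappa> / (2 * K) * N powr p) * I))
         = K * (N powr (1 - p) / N) + K * (N powr (1 - p) / N * N powr p) * J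
           + K * (\<kappa> / (2 * K)) * (N powr (1 - p) / N * N powr p) * I"
        by (simp add: algebra_simps add_divide_distrib)
      then show ?thesis unfolding *(2) unfolding *(1) using K by simp
    qed
    also have "N powr (1 - p) * (?c * I) = \<kappa> * I * (N powr (1 - p) * N powr (p - 1))" by simp
    also have "N powr (1 - p) * N powr (p - 1) = 1" using N by (simp add: powr_add[symmetric])
    finally show ?thesis by simp
  qed
  have "\<kappa> / 2 * I \<le> K * 0 + K * J"
  proof (rule tendsto_lowerbound)
    show "((\<lambda>N. K * N powr (- p) + K * J) \<longlongrightarrow> K * 0 + K * J) at_top"
      using p_gt_1 by (intro tendsto_intros tendsto_neg_powr filterlim_ident) auto
    show "eventually (\<lambda>N. \<kappa> / 2 * I \<le> K * N powr (- p) + K * J) at_top"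
      using eventually_ge_at_top[of 1] by eventually_elim (rule main)
  qed simp
  then have "I \<le> 2 * K / \<kappa> * J" using \<kappa> by (simp add: field_simps)
  then show ?thesis by (simp only: I_def \<kappa>_def)
qed

subsection \<open>Multipliers of Laplace transform type\<close>

lemma set_integrable_exp_decay:
  fixes f :: "real \<Rightarrow> 'b::{banach, second_countable_topology}"
  assumes cont: "continuous_on {0<..} f" and r: "r > 0"
    and bound: "\<And>t. t > 0 \<Longrightarrow> norm (f t) \<le> C * exp (- r * t)"
  shows "set_integrable lborel {0<..} f"
  unfolding set_integrable_def
proof (rule Bochner_Integration.integrable_bound)
  have "integrable lborel (\<lambda>t. exp (- norm (0 + r * t)))"
    using r by (intro lborel_integrable_real_affine[OF integrable_exp_minus_norm]) auto
  then show "integrable lborel (\<lambda>t. C * exp (- \<bar>r * t\<bar>))" by simp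
  show "(\<lambda>t. indicator {0<..} t *\<^sub>R f t) \<in> borel_measurable lborel"
    using borel_measurable_continuous_on_indicator[OF _ cont] by simp
  show "AE t in lborel. norm (indicator {0<..} t *\<^sub>R f t) \<le> norm (C * exp (- \<bar>r * t\<bar>))"
  proof (intro always_eventually allI)
    fix t
    show "norm (indicator {0<..} t *\<^sub>R f t) \<le> norm (C * exp (- \<bar>r * t\<bar>))"
    proof (cases "t > 0")
      case True
      then have "norm (f t) \<le> norm (C * exp (- \<bar>r * t\<bar>))"
        using bound[OF True] r by (simp add: abs_mult) (meson abs_ge_self mult_right_mono order_trans exp_ge_zero)
      then show ?thesis using True by simp
    qed simp
  qed
qed

text \<open>Half of the decay rate pays for the linear factor.\<close>

lemma mult_exp_minus_le:
  fixes x :: real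
  assumes "0 \<le> x" shows "x * exp (- x) \<le> 2 * exp (- x / 2)"
proof -
  have "x \<le> 2 * exp (x / 2)" using exp_ge_add_one_self[of "x / 2"] by linarith
  then have "x * exp (- x) \<le> (2 * exp (x / 2)) * exp (- x)" by (intro mult_right_mono) auto
  also have "\<dots> = 2 * exp (- x / 2)" by (simp add: exp_add[symmetric])
  finally show ?thesis .
qed

text \<open>For \<open>s > 0\<close>, the derivative of \<open>t s exp (- t s) \<Phi> t\<close> is
  the difference of the two integrands. This function vanishes at both ends, at 0 by the factor
  \<open>t\<close> and at infinity by the exponential, as \<open>\<Phi>\<close> is bounded.\<close>

lemma multiplier_laplace:
  fixes \<Phi> \<Phi>' :: "real \<Rightarrow> complex"
  assumes d: "\<And>t. t > 0 \<Longrightarrow> (\<Phi> has_vector_derivative \<Phi>' t) (at t)"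
    and c': "continuous_on {0<..} \<Phi>'"
    and bd: "\<And>t. t > 0 \<Longrightarrow> cmod (\<Phi> t) + t * cmod (\<Phi>' t) \<le> M" and s: "0 \<le> s"
  shows "multiplier \<Phi> s = (LINT t:{0<..}|lborel. (s * exp (- t * s)) *\<^sub>R (\<Phi> t + t *\<^sub>R \<Phi>' t))"
proof (cases "s = 0")
  case True
  then show ?thesis by (simp add: multiplier_def)
next
  case False
  with s have s: "s > 0" by simp
  have M: "0 \<le> M" using bd[of 1] by (smt (verit) norm_ge_zero mult_1)
  have c: "continuous_on {0<..} \<Phi>"
    by (intro continuous_at_imp_continuous_on ballI has_vector_derivative_continuous[OF d]) auto
  have b1: "cmod (\<Phi> t) \<le> M" "cmod (\<Phi> t + t *\<^sub>R \<Phi>' t) \<le> M" if "t > 0" for t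
  proof -
    have "0 \<le> t * cmod (\<Phi>' t)" using that by simp
    then show "cmod (\<Phi> t) \<le> M" using bd[OF that] by linarith
    have "cmod (\<Phi> t + t *\<^sub>R \<Phi>' t) \<le> cmod (\<Phi> t) + t * cmod (\<Phi>' t)"
      using norm_triangle_ineq[of "\<Phi> t" "t *\<^sub>R \<Phi>' t"] that by simp
    then show "cmod (\<Phi> t + t *\<^sub>R \<Phi>' t) \<le> M" using bd[OF that] by linarith
  qed
  let ?f = "\<lambda>t. (s * exp (- t * s)) *\<^sub>R (\<Phi> t + t *\<^sub>R \<Phi>' t)"
  let ?g = "\<lambda>t. (s * (t * s * exp (- t * s))) *\<^sub>R \<Phi> t"
  let ?F = "\<lambda>t. (t * s * exp (- t * s)) *\<^sub>R \<Phi> t"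
  have intf: "set_integrable lborel {0<..} ?f"
  proof (rule set_integrable_exp_decay[where C = "s * M" and r = s])
    show "continuous_on {0<..} ?f" by (intro continuous_intros c c')
    show "norm (?f t) \<le> s * M * exp (- s * t)" if "t > 0" for t
      using b1(2)[OF that] s by (simp add: mult_ac mult_left_mono)
  qed (rule s)
  have F_le: "norm (?F t) \<le> 2 * M * exp (- (s / 2) * t)" if "t > 0" for t
  proof -
    have "norm (?F t) = (t * s * exp (- (t * s))) * cmod (\<Phi> t)" using s that by simp
    also have "\<dots> \<le> (2 * exp (- (t * s) / 2)) * M"
      using s that by (intro mult_mono mult_exp_minus_le b1) auto
    finally show ?thesis by (simp add: mult_ac)
  qed
  have intg: "set_integrable lborel {0<..} ?g"
  proof (rule set_integrable_exp_decay[where C = "s * (2 * M)" and r = "s / 2"])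
    show "continuous_on {0<..} ?g" by (intro continuous_intros c)
    show "norm (?g t) \<le> s * (2 * M) * exp (- (s / 2) * t)" if "t > 0" for t
    proof -
      have "norm (?g t) = s * norm (?F t)" using s that by (simp add: abs_mult)
      also have "\<dots> \<le> s * (2 * M * exp (- (s / 2) * t))"
        using s by (intro mult_left_mono F_le that) auto
      finally show ?thesis by (simp only: mult.assoc)
    qed
  qed (use s in simp)
  have "(LBINT t=ereal 0..\<infinity>. ?f t - ?g t) = 0 - 0"
  proof (rule interval_integral_FTC_integrable[where F = ?F])
    fix t assume "ereal 0 < ereal t"
    then have t: "t > 0" by simp
    have e: "((\<lambda>t. t * s * exp (- t * s)) has_real_derivative s * exp (- t * s) - s * (t * s * exp (- t * s))) (at t)"
      by (auto intro!: derivative_eq_intros simp: algebra_simps)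
    have "(?F has_vector_derivative (t * s * exp (- t * s)) *\<^sub>R \<Phi>' t
        + (s * exp (- t * s) - s * (t * s * exp (- t * s))) *\<^sub>R \<Phi> t) (at t)"
      by (rule has_vector_derivative_scaleR[OF e d[OF t]])
    then show "(?F has_vector_derivative ?f t - ?g t) (at t)"
      by (simp add: algebra_simps scaleR_diff_left)
    have "isCont \<Phi> t" "isCont \<Phi>' t"
      using c c' t continuous_on_interior[of "{0<..}" _ t] by (auto simp: interior_open)
    then show "isCont (\<lambda>t. ?f t - ?g t) t" by (intro continuous_intros)
  next
    show "set_integrable lborel (einterval (ereal 0) \<infinity>) (\<lambda>t. ?f t - ?g t)"
      using intf intg by (simp add: set_integral_diff)
    have "(?F \<longlongrightarrow> 0) (at_right 0)"
    proof (rule Lim_null_comparison)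
      show "eventually (\<lambda>t. norm (?F t) \<le> M * (t * s)) (at_right 0)"
        using eventually_at_right_less[of 0]
      proof eventually_elim
        case (elim t)
        have "norm (?F t) = (t * s) * (exp (- (t * s)) * cmod (\<Phi> t))" using s elim by simp
        also have "\<dots> \<le> (t * s) * (1 * M)"
          using s elim by (intro mult_left_mono mult_mono b1) auto
        finally show ?case by (simp add: mult_ac)
      qed
      show "((\<lambda>t. M * (t * s)) \<longlongrightarrow> 0) (at_right 0)"
        by (auto intro!: tendsto_eq_intros)
    qed
    then show "((?F \<circ> real_of_ereal) \<longlongrightarrow> 0) (at_right (ereal 0))"
      by (simp only: ereal_tendsto_simps1)
    have "(?F \<longlongrightarrow> 0) at_top"
    proof (rule Lim_null_comparison)
      show "eventually (\<lambda>t. norm (?F t) \<le> 2 * M * exp (- (s / 2) * t)) at_top"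
        using eventually_gt_at_top[of 0] by eventually_elim (rule F_le)
      have "filterlim (\<lambda>t. (s / 2) * t) at_top at_top"
        using s by (intro filterlim_tendsto_pos_mult_at_top[OF tendsto_const] filterlim_ident) auto
      from tendsto_mult_right_zero[OF filterlim_compose[OF exp_at_bot filterlim_uminus_at_bot_at_top[THEN filterlim_compose, OF this]], of "2 * M"]
      show "((\<lambda>t. 2 * M * exp (- (s / 2) * t)) \<longlongrightarrow> 0) at_top" by simp
    qed
    then show "((?F \<circ> real_of_ereal) \<longlongrightarrow> 0) (at_left \<infinity>)"
      by (simp only: ereal_tendsto_simps1)
  qed auto
  then have "(LINT t:{0<..}|lborel. ?f t - ?g t) = 0"
    by (simp add: interval_lebesgue_integral_0_infty[symmetric] zero_ereal_def)
  then have "(LINT t:{0<..}|lborel. ?f t) = (LINT t:{0<..}|lborel. ?g t)"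
    using intf intg by (simp add: set_integral_diff)
  also have "\<dots> = multiplier \<Phi> s"
    unfolding multiplier_def set_lebesgue_integral_def
    by (intro Bochner_Integration.integral_cong refl) (auto simp: indicator_def power2_eq_square field_simps)
  finally show ?thesis by simp
qed

text \<open>The eigenvalue 0 is included: there the exponential does not decay, but the factor
  \<open>k\<close> vanishes.\<close>

lemma integrable_laplace_term:
  fixes k :: real assumes k: "0 \<le> k"
  shows "integrable lborel (\<lambda>t. indicator {0..} t * (k * exp (- t * k)))"
proof (cases "k = 0")
  case False
  with k have k: "k > 0" by simp
  have "integrable lborel (\<lambda>t. exp (- norm (0 + k * t)))"
    using k by (intro lborel_integrable_real_affine[OF integrable_exp_minus_norm]) auto
  then have "integrable lborel (\<lambda>t. k * exp (- \<bar>k * t\<bar>))" by simp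
  then show ?thesis
    by (rule Bochner_Integration.integrable_bound)
      (use k in \<open>auto simp: indicator_def abs_mult mult.commute\<close>)
qed simp

lemma energy_measurable [measurable]: "energy c d F \<in> borel_measurable borel"
  unfolding energy_def[abs_def] by measurable

lemma integrable_energy: "integrable lborel (\<lambda>t. indicator {0..} t * energy c d F t)"
proof -
  have "integrable lborel (\<lambda>t. \<Sum>\<alpha>\<in>F. (indicator {0..} t * (real (multi_degree \<alpha>) * exp (- t * real (multi_degree \<alpha>))))
      * (c \<alpha> * d \<alpha> * hermite_norm2 \<alpha>))"
    by (intro Bochner_Integration.integrable_sum integrable_mult_left integrable_laplace_term) simp
  then show ?thesis by (simp add: energy_def sum_distrib_left mult.assoc)
qed

section \<open>From the energy bound to multipliers\<close>

context bellman
begin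

lemma integral_energy_infinite_le:
  fixes c d :: "('n::finite \<Rightarrow> nat) \<Rightarrow> real"
  assumes F: "finite F"
  shows "(p - 1)\<^sup>2 / 8 * (LINT t|lborel. indicator {0..} t * \<bar>energy c d F t\<bar>)
    \<le> (LINT x|gauss. Q (hermite_sum c F x) (hermite_sum d F x))"
proof -
  have int: "integrable lborel (\<lambda>t. indicator {0..} t * \<bar>energy c d F t\<bar>)"
    using integrable_abs[OF integrable_energy[of c d F]] by (simp add: abs_mult)
  have "(\<lambda>n. LINT t|lborel. indicator {0..real n} t * \<bar>energy c d F t\<bar>)
      \<longlonglongrightarrow> (LINT t|lborel. indicator {0..} t * \<bar>energy c d F t\<bar>)"
  proof (rule integral_dominated_convergence)
    show "integrable lborel (\<lambda>t. indicator {0..} t * \<bar>energy c d F t\<bar>)" by (rule int)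
    show "AE t in lborel. (\<lambda>n. indicator {0..real n} t * \<bar>energy c d F t\<bar>) \<longlonglongrightarrow> indicator {0..} t * \<bar>energy c d F t\<bar>"
    proof (rule always_eventually, rule allI, rule tendsto_eventually)
      fix t
      show "eventually (\<lambda>n. indicator {0..real n} t * \<bar>energy c d F t\<bar> = indicator {0..} t * \<bar>energy c d F t\<bar>) sequentially"
        using eventually_ge_at_top[of "nat \<lceil>t\<rceil>"]
        by eventually_elim (auto simp: indicator_def)
    qed
    show "AE t in lborel. norm (indicator {0..real n} t * \<bar>energy c d F t\<bar>) \<le> indicator {0..} t * \<bar>energy c d F t\<bar>" for n
      by (auto simp: indicator_def)
  qed measurable
  from tendsto_mult_left[OF this, of "(p - 1)\<^sup>2 / 8"] show ?thesis
    by (rule LIMSEQ_le_const2) (use integral_energy_le[OF F] in auto)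
qed

text \<open>On finite expansions, pairing \<open>m (L) u\<close> with \<open>v\<close> is the same
  as integrating \<open>A\<close> against the energy. Hence only a bound for \<open>A\<close> and
  the absolute integral of the energy enter; \<open>8 / (p - 1)^2\<close> inverts the constant of
  the energy estimate.\<close>

lemma pairing_le:
  fixes c d :: "('n::finite \<Rightarrow> nat) \<Rightarrow> real" and A :: "real \<Rightarrow> real"
  assumes F: "finite F" and A [measurable]: "A \<in> borel_measurable borel"
    and B: "\<And>t. \<bar>A t\<bar> \<le> B * indicator {0..} t" and B0: "0 \<le> B"
    and m: "\<And>k::nat. m k = (LINT t|lborel. A t * (real k * exp (- t * real k)))"
  shows "\<bar>LINT x|gauss. hermite_sum (\<lambda>\<alpha>. m (multi_degree \<alpha>) * c \<alpha>) F x * hermite_sum d F x\<bar>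
    \<le> B * (8 / (p - 1)\<^sup>2) * (LINT x|gauss. Q (hermite_sum c F x) (hermite_sum d F x))"
proof -
  have intA: "integrable lborel (\<lambda>t. A t * (real k * exp (- t * real k)))" for k
  proof (rule Bochner_Integration.integrable_bound)
    show "integrable lborel (\<lambda>t. B * (indicator {0..} t * (real k * exp (- t * real k))))"
      by (intro integrable_mult_right integrable_laplace_term) simp
    show "AE t in lborel. norm (A t * (real k * exp (- t * real k)))
        \<le> norm (B * (indicator {0..} t * (real k * exp (- t * real k))))"
    proof (intro always_eventually allI)
      fix t
      have "\<bar>A t\<bar> * (real k * exp (- t * real k)) \<le> (B * indicator {0..} t) * (real k * exp (- t * real k))"
        by (intro mult_right_mono B) auto
      then show "norm (A t * (real k * exp (- t * real k)))
        \<le> norm (B * (indicator {0..} t * (real k * exp (- t * real k))))"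
        using B0 by (simp add: abs_mult mult_ac)
    qed
  qed measurable
  have "(LINT x|gauss. hermite_sum (\<lambda>\<alpha>. m (multi_degree \<alpha>) * c \<alpha>) F x * hermite_sum d F x)
     = (\<Sum>\<alpha>\<in>F. m (multi_degree \<alpha>) * (c \<alpha> * d \<alpha> * hermite_norm2 \<alpha>))"
    by (simp add: integral_hermite_sum[OF F] mult.assoc)
  also have "\<dots> = (\<Sum>\<alpha>\<in>F. LINT t|lborel. A t * (real (multi_degree \<alpha>) * exp (- t * real (multi_degree \<alpha>)))
      * (c \<alpha> * d \<alpha> * hermite_norm2 \<alpha>))"
    unfolding m by simp
  also have "\<dots> = (LINT t|lborel. (\<Sum>\<alpha>\<in>F. A t * (real (multi_degree \<alpha>) * exp (- t * real (multi_degree \<alpha>)))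
      * (c \<alpha> * d \<alpha> * hermite_norm2 \<alpha>)))"
    by (intro Bochner_Integration.integral_sum[symmetric] integrable_mult_left intA)
  also have "\<dots> = (LINT t|lborel. A t * energy c d F t)"
    by (simp add: energy_def sum_distrib_left mult.assoc)
  also have "\<bar>\<dots>\<bar> \<le> (LINT t|lborel. \<bar>A t * energy c d F t\<bar>)" by (rule integral_abs_bound)
  also have "\<dots> \<le> (LINT t|lborel. B * (indicator {0..} t * \<bar>energy c d F t\<bar>))"
  proof (rule integral_mono')
    show "integrable lborel (\<lambda>t. B * (indicator {0..} t * \<bar>energy c d F t\<bar>))"
      using integrable_abs[OF integrable_energy[of c d F]] by (simp add: abs_mult)
    show "\<bar>A t * energy c d F t\<bar> \<le> B * (indicator {0..} t * \<bar>energy c d F t\<bar>)" for t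
      using mult_right_mono[OF B[of t], of "\<bar>energy c d F t\<bar>"] by (simp add: abs_mult mult.assoc)
  qed (use B0 in auto)
  also have "\<dots> = B * (8 / (p - 1)\<^sup>2) * ((p - 1)\<^sup>2 / 8 * (LINT t|lborel. indicator {0..} t * \<bar>energy c d F t\<bar>))"
    using p_gt_1 by simp
  also have "\<dots> \<le> B * (8 / (p - 1)\<^sup>2) * (LINT x|gauss. Q (hermite_sum c F x) (hermite_sum d F x))"
    using B0 by (intro mult_left_mono integral_energy_infinite_le F) auto
  finally show ?thesis .
qed

text \<open>Brings two expansions to the common index set that the bilinear formulas
  require.\<close>

lemma hermite_sum_extend:
  assumes "finite G" "F \<subseteq> G"
  shows "hermite_sum c F = hermite_sum (\<lambda>\<alpha>. if \<alpha> \<in> F then c \<alpha> else 0) G"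
  unfolding hermite_sum_def[abs_def] fun_eq_iff
  using assms by (auto intro!: sum.mono_neutral_cong_left)

text \<open>The pairing bound for the input scaled by \<open>N\<close>, combined with the growth of
  \<open>Q\<close>, is exactly the hypothesis of \<open>norm_bound_from_pairing\<close>.
  \<open>K\<close> depends neither on the expansion nor on \<open>N\<close>, hence neither does the
  final constant.\<close>

lemma real_multiplier_bounded:
  fixes A :: "real \<Rightarrow> real"
  assumes A: "A \<in> borel_measurable borel"
    and B: "\<And>t. \<bar>A t\<bar> \<le> B * indicator {0..} t" and B0: "0 \<le> B"
    and m: "\<And>k::nat. m k = (LINT t|lborel. A t * (real k * exp (- t * real k)))"
  shows "\<exists>C\<ge>0. \<forall>(c :: ('n::finite \<Rightarrow> nat) \<Rightarrow> real) F. finite F \<longrightarrow>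
    (LINT x|gauss. \<bar>hermite_sum (\<lambda>\<alpha>. m (multi_degree \<alpha>) * c \<alpha>) F x\<bar> powr p)
      \<le> C * (LINT x|gauss. \<bar>hermite_sum c F x\<bar> powr p)"
proof -
  obtain C0 where C0: "C0 \<ge> 0" "\<And>z e. Q z e \<le> C0 * (1 + \<bar>z\<bar> powr p + \<bar>e\<bar> powr q)"
    using Q_le by metis
  define \<mu> where "\<mu> = measure (gauss :: (real^'n) measure) UNIV"
  \<comment> \<open>The summand 1 makes \<open>K\<close> positive even for \<open>B = 0\<close>. The
    factor \<open>1 + \<mu>\<close> absorbs the total mass \<open>\<mu>\<close>, which arises from
    integrating the constant in the bound for \<open>Q\<close>.\<close>
  define K where "K = B * (8 / (p - 1)\<^sup>2) * C0 * (1 + \<mu>) + 1"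
  have \<mu>: "\<mu> \<ge> 0" by (simp add: \<mu>_def)
  have K: "K > 0" unfolding K_def using B0 C0 \<mu> by (intro add_nonneg_pos mult_nonneg_nonneg) auto
  let ?C = "2 * K / (1 / (2 * K)) powr (p - 1)"
  have "(LINT x|gauss. \<bar>hermite_sum (\<lambda>\<alpha>. m (multi_degree \<alpha>) * c \<alpha>) F x\<bar> powr p)
      \<le> ?C * (LINT x|gauss. \<bar>hermite_sum c F x\<bar> powr p)"
    if F: "finite F" for F and c :: "('n \<Rightarrow> nat) \<Rightarrow> real"
  proof (rule norm_bound_from_pairing[OF K])
    let ?J = "LINT x|gauss. \<bar>hermite_sum c F x\<bar> powr p"
    fix N :: real and v :: "real^'n \<Rightarrow> real"
    assume N: "1 \<le> N" and v: "real_polynomial_function v"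
    obtain d G where G: "finite G" "v = hermite_sum d G"
      using polynomial_hermite_expansion[OF v] by metis
    define c' where "c' \<alpha> = (if \<alpha> \<in> F then c \<alpha> else 0)" for \<alpha>
    define d' where "d' \<alpha> = (if \<alpha> \<in> G then d \<alpha> else 0)" for \<alpha>
    have u: "hermite_sum c F = hermite_sum c' (F \<union> G)" and v': "v = hermite_sum d' (F \<union> G)"
      unfolding G(2) c'_def d'_def using F G(1) by (intro hermite_sum_extend; simp)+
    have Tu: "hermite_sum (\<lambda>\<alpha>. m (multi_degree \<alpha>) * c \<alpha>) F = hermite_sum (\<lambda>\<alpha>. m (multi_degree \<alpha>) * c' \<alpha>) (F \<union> G)"
      using hermite_sum_extend[of "F \<union> G" F "\<lambda>\<alpha>. m (multi_degree \<alpha>) * c \<alpha>"] F G(1)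
      by (simp add: c'_def if_distrib cong: if_cong)
    have scale: "hermite_sum (\<lambda>\<alpha>. N * c' \<alpha>) (F \<union> G) x = N * hermite_sum c F x"
      "hermite_sum (\<lambda>\<alpha>. m (multi_degree \<alpha>) * (N * c' \<alpha>)) (F \<union> G) x
        = N * hermite_sum (\<lambda>\<alpha>. m (multi_degree \<alpha>) * c \<alpha>) F x" for x
      unfolding u Tu by (simp_all add: hermite_sum_def sum_distrib_left mult_ac)
    have vb: "exp_bounded v" unfolding G(2) by (intro exp_bounded_intros)
    have intp: "integrable gauss (\<lambda>x. \<bar>hermite_sum c F x\<bar> powr p)" "integrable gauss (\<lambda>x. \<bar>v x\<bar> powr q)"
      using p_gt_1 params
      by (auto intro!: integrable_gauss_exp_bounded exp_bounded_powr_pos exp_bounded_intros vb)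
    have "N * \<bar>LINT x|gauss. hermite_sum (\<lambda>\<alpha>. m (multi_degree \<alpha>) * c \<alpha>) F x * v x\<bar>
        = \<bar>LINT x|gauss. hermite_sum (\<lambda>\<alpha>. m (multi_degree \<alpha>) * (N * c' \<alpha>)) (F \<union> G) x * v x\<bar>"
      unfolding scale using N by (simp add: abs_mult mult.assoc)
    also have "\<dots> \<le> B * (8 / (p - 1)\<^sup>2) * (LINT x|gauss. Q (N * hermite_sum c F x) (v x))"
      using pairing_le[of "F \<union> G" A B m "\<lambda>\<alpha>. N * c' \<alpha>" d', OF _ A B B0 m] F G(1)
      unfolding scale v'[symmetric] by simp
    also have "\<dots> \<le> B * (8 / (p - 1)\<^sup>2) * (C0 * (\<mu> + N powr p * ?J + (LINT x|gauss. \<bar>v x\<bar> powr q)))"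
    proof (intro mult_left_mono)
      have "(LINT x|gauss. Q (N * hermite_sum c F x) (v x))
          \<le> (LINT x|gauss. C0 * (1 + N powr p * \<bar>hermite_sum c F x\<bar> powr p + \<bar>v x\<bar> powr q))"
      proof (rule integral_mono)
        show "integrable gauss (\<lambda>x. Q (N * hermite_sum c F x) (v x))"
          by (intro integrable_gauss_exp_bounded exp_bounded_intros vb)
        show "integrable gauss (\<lambda>x. C0 * (1 + N powr p * \<bar>hermite_sum c F x\<bar> powr p + \<bar>v x\<bar> powr q))"
          by (intro integrable_mult_right Bochner_Integration.integrable_add intp) simp
        show "Q (N * hermite_sum c F x) (v x) \<le> C0 * (1 + N powr p * \<bar>hermite_sum c F x\<bar> powr p + \<bar>v x\<bar> powr q)" for x
          using C0(2)[of "N * hermite_sum c F x" "v x"] N by (simp add: abs_mult powr_mult)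
      qed
      also have "\<dots> = C0 * (\<mu> + N powr p * ?J + (LINT x|gauss. \<bar>v x\<bar> powr q))"
        using intp by (simp add: \<mu>_def)
      finally show "(LINT x|gauss. Q (N * hermite_sum c F x) (v x))
          \<le> C0 * (\<mu> + N powr p * ?J + (LINT x|gauss. \<bar>v x\<bar> powr q))" .
    qed (use B0 in auto)
    also have "\<dots> \<le> K * (1 + N powr p * ?J + (LINT x|gauss. \<bar>v x\<bar> powr q))"
    proof -
      let ?R = "N powr p * ?J + (LINT x|gauss. \<bar>v x\<bar> powr q)"
      have R: "0 \<le> ?R" by simp
      have "0 \<le> \<mu> * ?R" using \<mu> R by simp
      then have "\<mu> + ?R \<le> (1 + \<mu>) * (1 + ?R)" using \<mu> by (simp add: distrib_left distrib_right)
      then have "B * (8 / (p - 1)\<^sup>2) * C0 * (\<mu> + ?R) \<le> B * (8 / (p - 1)\<^sup>2) * C0 * ((1 + \<mu>) * (1 + ?R))"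
        using B0 C0 by (intro mult_left_mono) auto
      also have "\<dots> \<le> K * (1 + ?R)" using R by (simp add: K_def distrib_right mult.assoc)
      finally show ?thesis by (simp add: add.assoc mult.assoc)
    qed
    finally show "N * \<bar>LINT x|gauss. hermite_sum (\<lambda>\<alpha>. m (multi_degree \<alpha>) * c \<alpha>) F x * v x\<bar>
        \<le> K * (1 + N powr p * ?J + (LINT x|gauss. \<bar>v x\<bar> powr q))" .
  qed (intro exp_bounded_intros)
  moreover have "?C \<ge> 0" using K by simp
  ultimately show ?thesis by blast
qed

end

subsection \<open>The functional calculus on polynomials\<close>

lemma hermite_coeff_eq:
  assumes F: "finite F" and f: "\<And>x. f x = of_real (hermite_sum c F x) + \<i> * of_real (hermite_sum d F x)"
  shows "hermite_coeff f \<alpha> = (if \<alpha> \<in> F then Complex (c \<alpha>) (d \<alpha>) else 0)"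
proof -
  have coef: "(LINT x|gauss. multi_hermite \<alpha> x * hermite_sum e F x) = (if \<alpha> \<in> F then e \<alpha> * hermite_norm2 \<alpha> else 0)"
    for e
  proof -
    have "(LINT x|gauss. multi_hermite \<alpha> x * hermite_sum e F x)
       = (LINT x|gauss. (\<Sum>\<beta>\<in>F. e \<beta> * (multi_hermite \<alpha> x * multi_hermite \<beta> x)))"
      by (simp add: hermite_sum_def sum_distrib_left mult_ac)
    also have "\<dots> = (\<Sum>\<beta>\<in>F. LINT x|gauss. e \<beta> * (multi_hermite \<alpha> x * multi_hermite \<beta> x))"
      by (intro Bochner_Integration.integral_sum integrable_gauss_exp_bounded exp_bounded_intros)
    also have "\<dots> = (\<Sum>\<beta>\<in>F. if \<alpha> = \<beta> then e \<beta> * hermite_norm2 \<alpha> else 0)"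
      by (intro sum.cong refl) (simp add: integral_hermite)
    finally show ?thesis using F by (simp add: sum.delta)
  qed
  have int: "integrable gauss (\<lambda>x. multi_hermite \<alpha> x * hermite_sum e F x)" for e
    by (intro integrable_gauss_exp_bounded exp_bounded_intros)
  have "(LINT x|gauss. multi_hermite \<alpha> x *\<^sub>R f x)
      = (LINT x|gauss. of_real (multi_hermite \<alpha> x * hermite_sum c F x)
          + \<i> * of_real (multi_hermite \<alpha> x * hermite_sum d F x))"
    by (simp add: f scaleR_conv_of_real algebra_simps)
  also have "\<dots> = of_real (LINT x|gauss. multi_hermite \<alpha> x * hermite_sum c F x)
      + \<i> * of_real (LINT x|gauss. multi_hermite \<alpha> x * hermite_sum d F x)"
    using int[of c] int[of d]
    by (subst Bochner_Integration.integral_add)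
      (auto simp del: of_real_mult intro!: integrable_mult_right integrable_of_real)
  also have "\<dots> = (if \<alpha> \<in> F then Complex (c \<alpha>) (d \<alpha>) * of_real (hermite_norm2 \<alpha>) else 0)"
    by (simp add: coef complex_eq_iff)
  finally have num: "(LINT x|gauss. multi_hermite \<alpha> x *\<^sub>R f x)
    = (if \<alpha> \<in> F then Complex (c \<alpha>) (d \<alpha>) * of_real (hermite_norm2 \<alpha>) else 0)" .
  have den: "(LINT x|gauss. (multi_hermite \<alpha> x)\<^sup>2) = hermite_norm2 \<alpha>"
    by (simp add: hermite_norm2_def power2_eq_square)
  show ?thesis
    unfolding hermite_coeff_def num den using hermite_norm2_pos[of \<alpha>] by simp
qed

text \<open>\<open>OU_calculus\<close> is a choice among \<open>L^2\<close> limits. For a finite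
  expansion the partial sums eventually equal \<open>g\<close>, so \<open>g\<close> is a possible
  choice, and the distance of any other choice to \<open>g\<close> is a constant that tends to
  0.\<close>

lemma OU_calculus_polynomial:
  fixes f :: "real ^ 'n \<Rightarrow> complex" and \<phi> :: "real \<Rightarrow> complex"
  assumes F: "finite F" and coeff: "\<And>\<alpha>. \<alpha> \<notin> F \<Longrightarrow> hermite_coeff f \<alpha> = 0"
  defines "g \<equiv> \<lambda>x. \<Sum>\<alpha>\<in>F. \<phi> (real (multi_degree \<alpha>)) * hermite_coeff f \<alpha> * of_real (multi_hermite \<alpha> x)"
  shows "AE x in gauss. OU_calculus \<phi> f x = g x" and "OU_calculus \<phi> f \<in> borel_measurable gauss"
proof -
  let ?S = "\<lambda>F x. \<Sum>\<alpha>\<in>F. \<phi> (real (multi_degree \<alpha>)) * hermite_coeff f \<alpha> * of_real (multi_hermite \<alpha> x)"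
  have S: "?S G = g" if "finite G" "F \<subseteq> G" for G
    unfolding g_def using that coeff by (auto intro!: ext sum.mono_neutral_right)
  have ev: "eventually (\<lambda>G. gauss_norm 2 (\<lambda>x. h x - ?S G x) = gauss_norm 2 (\<lambda>x. h x - g x))
      (finite_subsets_at_top UNIV)" for h
  proof -
    have "eventually (\<lambda>G. ?S G = g) (finite_subsets_at_top UNIV)"
      unfolding eventually_finite_subsets_at_top using F S by blast
    then show ?thesis by eventually_elim (simp add: fun_eq_iff)
  qed
  have g_meas [measurable]: "g \<in> borel_measurable borel"
  proof -
    have [measurable]: "multi_hermite \<alpha> \<in> borel_measurable borel" for \<alpha> :: "'n \<Rightarrow> nat"
      by (intro borel_measurable_exp_bounded exp_bounded_intros)
    show ?thesis unfolding g_def by measurable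
  qed
  have g_sq: "integrable gauss (\<lambda>x. (cmod (g x))\<^sup>2)"
  proof -
    have "exp_bounded (\<lambda>x. (Re (g x))\<^sup>2 + (Im (g x))\<^sup>2)"
      unfolding g_def by (simp add: Re_sum Im_sum) (intro exp_bounded_intros)
    from integrable_gauss_exp_bounded[OF this] show ?thesis by (simp add: cmod_power2)
  qed
  have "is_OU_calculus \<phi> f g"
    unfolding is_OU_calculus_def
  proof (intro conjI g_sq)
    show "((\<lambda>G. gauss_norm 2 (\<lambda>x. g x - ?S G x)) \<longlongrightarrow> 0) (finite_subsets_at_top UNIV)"
      by (rule tendsto_eventually, rule eventually_mono[OF ev[of g]]) (simp add: gauss_norm_def)
  qed simp
  then have "is_OU_calculus \<phi> f (OU_calculus \<phi> f)"
    unfolding OU_calculus_def by (rule someI[where P = "is_OU_calculus \<phi> f"])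
  then have h: "OU_calculus \<phi> f \<in> borel_measurable gauss" "integrable gauss (\<lambda>x. (cmod (OU_calculus \<phi> f x))\<^sup>2)"
    "((\<lambda>G. gauss_norm 2 (\<lambda>x. OU_calculus \<phi> f x - ?S G x)) \<longlongrightarrow> 0) (finite_subsets_at_top UNIV)"
    unfolding is_OU_calculus_def by auto
  show "OU_calculus \<phi> f \<in> borel_measurable gauss" by (rule h(1))
  have "gauss_norm 2 (\<lambda>x. OU_calculus \<phi> f x - g x) = 0"
    using tendsto_unique[OF _ h(3) tendsto_eventually[OF ev]] finite_subsets_at_top_neq_bot by metis
  then have zero: "(LINT x|gauss. (cmod (OU_calculus \<phi> f x - g x))\<^sup>2) = 0"
    by (simp add: gauss_norm_def powr_eq_0_iff)
  have [measurable]: "OU_calculus \<phi> f \<in> borel_measurable borel" using h(1) by simp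
  \<comment> \<open>Without integrability the vanishing integral would say nothing, because the
    Bochner integral of a nonintegrable function is 0 by default.\<close>
  have "integrable gauss (\<lambda>x. (cmod (OU_calculus \<phi> f x - g x))\<^sup>2)"
  proof (rule Bochner_Integration.integrable_bound)
    show "integrable gauss (\<lambda>x. 2 * (cmod (OU_calculus \<phi> f x))\<^sup>2 + 2 * (cmod (g x))\<^sup>2)"
      by (intro Bochner_Integration.integrable_add integrable_mult_right h g_sq)
    show "AE x in gauss. norm ((cmod (OU_calculus \<phi> f x - g x))\<^sup>2)
        \<le> norm (2 * (cmod (OU_calculus \<phi> f x))\<^sup>2 + 2 * (cmod (g x))\<^sup>2)"
    proof (intro always_eventually allI)
      fix x
      let ?a = "cmod (OU_calculus \<phi> f x)" and ?b = "cmod (g x)"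
      have "(cmod (OU_calculus \<phi> f x - g x))\<^sup>2 \<le> (?a + ?b)\<^sup>2"
        by (intro power_mono norm_triangle_ineq4) auto
      also have "\<dots> \<le> 2 * ?a\<^sup>2 + 2 * ?b\<^sup>2"
        using zero_le_power2[of "?a - ?b"] by (simp add: power2_sum power2_diff)
      finally show "norm ((cmod (OU_calculus \<phi> f x - g x))\<^sup>2) \<le> norm (2 * ?a\<^sup>2 + 2 * ?b\<^sup>2)"
        by simp
    qed
  qed measurable
  with zero have "AE x in gauss. (cmod (OU_calculus \<phi> f x - g x))\<^sup>2 = 0"
    by (subst (asm) integral_nonneg_eq_0_iff_AE) auto
  then show "AE x in gauss. OU_calculus \<phi> f x = g x" by eventually_elim simp
qed

lemma sum4_powr_le:
  fixes a b c d :: real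
  assumes "0 \<le> a" "0 \<le> b" "0 \<le> c" "0 \<le> d" "0 \<le> p"
  shows "(a + b + c + d) powr p \<le> 4 powr p * (a powr p + b powr p + c powr p + d powr p)"
proof -
  define m where "m = max (max a b) (max c d)"
  have "(a + b + c + d) powr p \<le> (4 * m) powr p"
    using assms by (intro powr_mono2) (auto simp: m_def)
  also have "\<dots> = 4 powr p * m powr p" using assms by (simp add: powr_mult m_def)
  also have "m powr p \<le> a powr p + b powr p + c powr p + d powr p"
    by (auto simp: m_def max_def)
  finally show ?thesis by simp
qed

theorem mainTheorem2:
  fixes p :: real and \<Phi> \<Phi>' \<Phi>'' :: "real \<Rightarrow> complex"
  assumes "1 < p" and "p \<le> 2"
    and "\<And>t. t > 0 \<Longrightarrow> (\<Phi> has_vector_derivative \<Phi>' t) (at t)"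
    and "\<And>t. t > 0 \<Longrightarrow> (\<Phi>' has_vector_derivative \<Phi>'' t) (at t)"
    and "continuous_on {0<..} \<Phi>''"
    and "bdd_above ((\<lambda>t. cmod (\<Phi> t) + t * cmod (\<Phi>' t)) ` {0<..})"
    and "bdd_above ((\<lambda>t. cmod (t\<^sup>2 *\<^sub>R \<Phi>'' t)) ` {0<..1})"
    and "\<exists>(N::int) (C\<^sub>0::real). \<forall>t\<ge>1. cmod (\<Phi>' t) + t * cmod (\<Phi>'' t) \<le> C\<^sub>0 * t powi N"
  shows "\<exists>C::real. \<forall>f :: real ^ 'n \<Rightarrow> complex.
           polynomial_function f \<longrightarrow> (LINT x|gauss. f x) = 0 \<longrightarrow>
           gauss_norm p (OU_calculus (multiplier \<Phi>) f)
             \<le> C * (gauss_norm p (conical_square f) + gauss_norm p f)"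
proof -
  interpret bellman p by unfold_locales fact+
  obtain M where M: "\<And>t. t > 0 \<Longrightarrow> cmod (\<Phi> t) + t * cmod (\<Phi>' t) \<le> M"
    using assms(6) unfolding bdd_above_def by auto
  have cont': "continuous_on {0<..} \<Phi>'"
    by (intro continuous_at_imp_continuous_on ballI has_vector_derivative_continuous[OF assms(4)]) auto
  have cont: "continuous_on {0<..} \<Phi>"
    by (intro continuous_at_imp_continuous_on ballI has_vector_derivative_continuous[OF assms(3)]) auto
  \<comment> \<open>The derivative of \<open>t \<Phi> t\<close>, extended by 0 to the left
    half-line: the density in the Laplace representation.\<close>
  define a where "a t = indicator {0<..} t *\<^sub>R (\<Phi> t + t *\<^sub>R \<Phi>' t)" for t
  have a_meas: "a \<in> borel_measurable borel"
    unfolding a_def[abs_def]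
    by (intro borel_measurable_continuous_on_indicator continuous_intros cont cont') auto
  have M0: "0 \<le> M"
  proof -
    have "cmod (\<Phi> 1) + cmod (\<Phi>' 1) \<le> M" using M[of 1] by simp
    with norm_ge_zero[of "\<Phi> 1"] norm_ge_zero[of "\<Phi>' 1"] show ?thesis by linarith
  qed
  have a_le: "cmod (a t) \<le> M * indicator {0..} t" for t
  proof (cases "t > 0")
    case True
    then have "cmod (a t) \<le> cmod (\<Phi> t) + t * cmod (\<Phi>' t)"
      using norm_triangle_ineq[of "\<Phi> t" "t *\<^sub>R \<Phi>' t"] by (simp add: a_def)
    then show ?thesis using M[OF True] True by simp
  qed (use M0 in \<open>simp add: a_def\<close>)
  define \<phi> where "\<phi> k = multiplier \<Phi> (real k)" for k :: nat
  have \<phi>: "\<phi> k = (LINT t|lborel. (real k * exp (- t * real k)) *\<^sub>R a t)" for k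
    unfolding \<phi>_def a_def
    by (subst multiplier_laplace[OF assms(3) cont' M])
      (auto simp: set_lebesgue_integral_def mult.commute intro!: Bochner_Integration.integral_cong)
  have inta: "integrable lborel (\<lambda>t. (real k * exp (- t * real k)) *\<^sub>R a t)" for k
  proof (rule Bochner_Integration.integrable_bound)
    show "integrable lborel (\<lambda>t. M * (indicator {0..} t * (real k * exp (- t * real k))))"
      by (intro integrable_mult_right integrable_laplace_term) simp
    show "(\<lambda>t. (real k * exp (- t * real k)) *\<^sub>R a t) \<in> borel_measurable lborel"
      using a_meas by measurable
    show "AE t in lborel. norm ((real k * exp (- t * real k)) *\<^sub>R a t)
        \<le> norm (M * (indicator {0..} t * (real k * exp (- t * real k))))"
    proof (intro always_eventually allI)
      fix t
      have "(real k * exp (- t * real k)) * cmod (a t) \<le> (real k * exp (- t * real k)) * (M * indicator {0..} t)"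
        by (intro mult_left_mono a_le) auto
      then show "norm ((real k * exp (- t * real k)) *\<^sub>R a t)
        \<le> norm (M * (indicator {0..} t * (real k * exp (- t * real k))))"
        using M0 by (simp add: abs_mult mult_ac)
    qed
  qed
  \<comment> \<open>The kernel is real, so the real and imaginary parts of the multiplier are again
    of Laplace transform type, with real densities.\<close>
  have ReIm: "Re (\<phi> k) = (LINT t|lborel. Re (a t) * (real k * exp (- t * real k)))"
    "Im (\<phi> k) = (LINT t|lborel. Im (a t) * (real k * exp (- t * real k)))" for k
    unfolding \<phi> using integral_Re[OF inta[of k]] integral_Im[OF inta[of k]] by (simp_all add: mult.commute)
  have Re_meas: "(\<lambda>t. Re (a t)) \<in> borel_measurable borel" and Im_meas: "(\<lambda>t. Im (a t)) \<in> borel_measurable borel"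
    using a_meas by measurable
  have Re_le: "\<bar>Re (a t)\<bar> \<le> M * indicator {0..} t" and Im_le: "\<bar>Im (a t)\<bar> \<le> M * indicator {0..} t" for t
    using abs_Re_le_cmod[of "a t"] abs_Im_le_cmod[of "a t"] a_le[of t] by linarith+
  obtain A where A: "A \<ge> 0" "\<And>(c :: ('n \<Rightarrow> nat) \<Rightarrow> real) F. finite F \<Longrightarrow>
    (LINT x|gauss. \<bar>hermite_sum (\<lambda>\<alpha>. Re (\<phi> (multi_degree \<alpha>)) * c \<alpha>) F x\<bar> powr p)
      \<le> A * (LINT x|gauss. \<bar>hermite_sum c F x\<bar> powr p)"
    using real_multiplier_bounded[OF Re_meas Re_le M0 ReIm(1), where 'n = 'n] by blast
  obtain B where B: "B \<ge> 0" "\<And>(c :: ('n \<Rightarrow> nat) \<Rightarrow> real) F. finite F \<Longrightarrow>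
    (LINT x|gauss. \<bar>hermite_sum (\<lambda>\<alpha>. Im (\<phi> (multi_degree \<alpha>)) * c \<alpha>) F x\<bar> powr p)
      \<le> B * (LINT x|gauss. \<bar>hermite_sum c F x\<bar> powr p)"
    using real_multiplier_bounded[OF Im_meas Im_le M0 ReIm(2), where 'n = 'n] by blast
  \<comment> \<open>Four real terms occur: each part of the multiplier acts on each part of
    \<open>f\<close>. The factor \<open>4 powr p\<close> comes from the \<open>p\<close>-th power of
    their sum.\<close>
  define D where "D = 4 powr p * (2 * A + 2 * B)"
  have "gauss_norm p (OU_calculus (multiplier \<Phi>) f)
      \<le> D powr (1 / p) * (gauss_norm p (conical_square f) + gauss_norm p f)"
    if f: "polynomial_function f" for f :: "real ^ 'n \<Rightarrow> complex"
  proof -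
    have rp: "real_polynomial_function (Re \<circ> f)" "real_polynomial_function (Im \<circ> f)"
      using f unfolding polynomial_function_def by (simp_all add: bounded_linear_Re bounded_linear_Im)
    obtain c1 F1 where e1: "finite F1" "Re \<circ> f = hermite_sum c1 F1"
      by (rule polynomial_hermite_expansion[OF rp(1)])
    obtain c2 F2 where e2: "finite F2" "Im \<circ> f = hermite_sum c2 F2"
      by (rule polynomial_hermite_expansion[OF rp(2)])
    note e = e1 e2
    define F where "F = F1 \<union> F2"
    define c where "c \<alpha> = (if \<alpha> \<in> F1 then c1 \<alpha> else 0)" for \<alpha>
    define d where "d \<alpha> = (if \<alpha> \<in> F2 then c2 \<alpha> else 0)" for \<alpha>
    have F: "finite F" using e by (simp add: F_def)
    have "Re \<circ> f = hermite_sum c F" "Im \<circ> f = hermite_sum d F"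
      unfolding e c_def d_def using F by (intro hermite_sum_extend; simp add: F_def)+
    then have Rf: "Re (f x) = hermite_sum c F x" "Im (f x) = hermite_sum d F x" for x
      by (auto simp: fun_eq_iff)
    have fx: "f x = of_real (hermite_sum c F x) + \<i> * of_real (hermite_sum d F x)" for x
      using Rf[of x] by (simp add: complex_eq_iff)
    note coeff = hermite_coeff_eq[of F f c d, OF F fx]
    let ?R = "\<lambda>c. hermite_sum (\<lambda>\<alpha>. Re (\<phi> (multi_degree \<alpha>)) * c \<alpha>) F"
    let ?I = "\<lambda>c. hermite_sum (\<lambda>\<alpha>. Im (\<phi> (multi_degree \<alpha>)) * c \<alpha>) F"
    let ?g = "\<lambda>x. \<Sum>\<alpha>\<in>F. multiplier \<Phi> (real (multi_degree \<alpha>)) * hermite_coeff f \<alpha> * of_real (multi_hermite \<alpha> x)"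
    have ae: "AE x in gauss. OU_calculus (multiplier \<Phi>) f x = ?g x"
      and meas: "OU_calculus (multiplier \<Phi>) f \<in> borel_measurable gauss"
      using OU_calculus_polynomial[of F f "multiplier \<Phi>"] F coeff by auto
    have g: "?g x = Complex (?R c x - ?I d x) (?R d x + ?I c x)" for x
      by (simp add: complex_eq_iff coeff \<phi>_def[symmetric] hermite_sum_def Re_sum Im_sum
          sum_subtractf[symmetric] sum.distrib[symmetric] algebra_simps cong: sum.cong)
    have intR: "integrable gauss (\<lambda>x. \<bar>hermite_sum e F x\<bar> powr p)" for e
      using p_gt_1 by (auto intro!: integrable_gauss_exp_bounded exp_bounded_powr_pos exp_bounded_intros)
    have intf: "integrable gauss (\<lambda>x. cmod (f x) powr p)"
    proof -
      have "exp_bounded (\<lambda>x. ((hermite_sum c F x)\<^sup>2 + (hermite_sum d F x)\<^sup>2) powr (p / 2))"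
        using p_gt_1 by (auto intro!: exp_bounded_powr_pos exp_bounded_intros)
      moreover have "((hermite_sum c F x)\<^sup>2 + (hermite_sum d F x)\<^sup>2) powr (p / 2) = cmod (f x) powr p" for x
      proof -
        have "(hermite_sum c F x)\<^sup>2 + (hermite_sum d F x)\<^sup>2 = cmod (f x) powr 2"
          by (simp add: Rf[symmetric] cmod_power2)
        then show ?thesis by (simp only: powr_powr) simp
      qed
      ultimately show ?thesis using integrable_gauss_exp_bounded by fastforce
    qed
    let ?J = "LINT x|gauss. cmod (f x) powr p"
    have J: "(LINT x|gauss. \<bar>hermite_sum c F x\<bar> powr p) \<le> ?J" "(LINT x|gauss. \<bar>hermite_sum d F x\<bar> powr p) \<le> ?J"
      using p_gt_1 intR[of c, folded Rf(1)] intR[of d, folded Rf(2)] abs_Re_le_cmod[of "f _"] abs_Im_le_cmod[of "f _"]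
      by (auto intro!: integral_mono intf powr_mono2 simp: Rf[symmetric])
    have "(LINT x|gauss. norm (OU_calculus (multiplier \<Phi>) f x) powr p) = (LINT x|gauss. cmod (?g x) powr p)"
    proof (rule integral_cong_AE)
      have [measurable]: "hermite_sum e F \<in> borel_measurable borel" for e
        by (intro borel_measurable_exp_bounded exp_bounded_intros)
      show "(\<lambda>x. cmod (?g x) powr p) \<in> borel_measurable gauss"
        unfolding g complex_norm by measurable
    qed (use ae meas in auto)
    also have "\<dots> \<le> (LINT x|gauss. 4 powr p * (\<bar>?R c x\<bar> powr p + \<bar>?I d x\<bar> powr p + \<bar>?R d x\<bar> powr p + \<bar>?I c x\<bar> powr p))"
    proof (rule integral_mono')
      show "integrable gauss (\<lambda>x. 4 powr p * (\<bar>?R c x\<bar> powr p + \<bar>?I d x\<bar> powr p + \<bar>?R d x\<bar> powr p + \<bar>?I c x\<bar> powr p))"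
        by (intro integrable_mult_right Bochner_Integration.integrable_add intR)
      fix x
      have "cmod (?g x) \<le> \<bar>?R c x\<bar> + \<bar>?I d x\<bar> + \<bar>?R d x\<bar> + \<bar>?I c x\<bar>"
        using cmod_le[of "?g x"] unfolding g by simp
      then have "cmod (?g x) powr p \<le> (\<bar>?R c x\<bar> + \<bar>?I d x\<bar> + \<bar>?R d x\<bar> + \<bar>?I c x\<bar>) powr p"
        using p_gt_1 by (intro powr_mono2) auto
      also have "\<dots> \<le> 4 powr p * (\<bar>?R c x\<bar> powr p + \<bar>?I d x\<bar> powr p + \<bar>?R d x\<bar> powr p + \<bar>?I c x\<bar> powr p)"
        using p_gt_1 by (intro sum4_powr_le) auto
      finally show "cmod (?g x) powr p \<le> 4 powr p * (\<bar>?R c x\<bar> powr p + \<bar>?I d x\<bar> powr p + \<bar>?R d x\<bar> powr p + \<bar>?I c x\<bar> powr p)" .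
    qed auto
    also have "\<dots> = 4 powr p * ((LINT x|gauss. \<bar>?R c x\<bar> powr p) + (LINT x|gauss. \<bar>?I d x\<bar> powr p)
        + (LINT x|gauss. \<bar>?R d x\<bar> powr p) + (LINT x|gauss. \<bar>?I c x\<bar> powr p))"
      by (simp add: intR)
    also have "\<dots> \<le> 4 powr p * (A * ?J + B * ?J + A * ?J + B * ?J)"
      using A(2)[OF F, of c] A(2)[OF F, of d] B(2)[OF F, of c] B(2)[OF F, of d]
        mult_left_mono[OF J(1) A(1)] mult_left_mono[OF J(2) A(1)]
        mult_left_mono[OF J(1) B(1)] mult_left_mono[OF J(2) B(1)]
      by (intro mult_left_mono add_mono) (linarith | simp)+
    also have "\<dots> = D * ?J" by (simp add: D_def algebra_simps)
    finally have "(LINT x|gauss. norm (OU_calculus (multiplier \<Phi>) f x) powr p) powr (1 / p) \<le> (D * ?J) powr (1 / p)"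
      using p_gt_1 by (intro powr_mono2) auto
    also have "\<dots> = D powr (1 / p) * gauss_norm p f"
      using A(1) B(1) by (simp add: gauss_norm_def powr_mult D_def)
    finally have "gauss_norm p (OU_calculus (multiplier \<Phi>) f) \<le> D powr (1 / p) * gauss_norm p f"
      by (simp add: gauss_norm_def)
    also have "\<dots> \<le> D powr (1 / p) * (gauss_norm p (conical_square f) + gauss_norm p f)"
      by (intro mult_left_mono) (auto simp: gauss_norm_def)
    finally show ?thesis .
  qed
  then show ?thesis by blast
qed

end
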